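(* Fix $\beta>\beta_c$, $c_\lambda>0$ and let $\lambda=c_\lambda/N$. There exist $C_1,C_2>0$ (depending on $\beta,c_\lambda$) such that for every set $\Gamma$ of admissible interfaces, $$\mu^\pm_{\lambda,N}(\mathscr I\in\Gamma)\le e^{C_1N^{1/3}}\mu^\pm_{0,N}(\mathscr I\in\Gamma)+e^{-C_2N}.$$
   Context: Standing setup. $\beta_c=\log(1+\sqrt2)$. Ising measure on finite $\Lambda\subset\mathbb Z^2$ with boundary condition $\eta$: $\mu^\eta_{\beta,\lambda,\Lambda}(\sigma)\propto\exp\big(-2\beta\big(\sum_{v\sim w,\,v,w\in\Lambda}\mathbf 1\{\sigma_v\ne\sigma_w\}+\sum_{v\sim w,\,v\in\Lambda,w\notin\Lambda}\mathbf 1\{\sigma_v\ne\eta_w\}\big)+\lambda\sum_{v\in\Lambda}\sigma_v\big)$; $\beta$ fixed and suppressed. $\Lambda_N=\{0,\dots,N\}^2$; $\mu^\pm_{\lambda,N}$ uses the Dobrushin boundary condition ($+$ at outside sites with $y\ge0$, $-$ with $y<0$); $\mu^\pm_{0,N}$ is the same with zero field. The interface $\mathscr I$ is the unique path component, joining $(-\tfrac12,-\tfrac12)$ to $(N+\tfrac12,-\tfrac12)$, of the set of dual edges separating differing spins, decomposed into edge-disjoint paths and loops by the south-east splitting rule (at a dual vertex of degree 3 or 4 the pair of edges south and east of it is split from the others, likewise north and west). An admissible interface is any simple path of dual edges of $\Lambda_N^*$ from $(-\tfrac12,-\tfrac12)$ to $(N+\tfrac12,-\tfrac12)$ that arises as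 $\mathscr I$ for some configuration. *)

theory Defs
  imports Complex_Main
begin

type_synonym site = "int \<times> int"

definition Lam :: "nat \<Rightarrow> site set" where
  "Lam N = {0..int N} \<times> {0..int N}"

definition dob :: "site \<Rightarrow> int" where
  "dob v = (if snd v \<ge> 0 then 1 else -1)"

definition configs :: "nat \<Rightarrow> (site \<Rightarrow> int) set" where
  "configs N = {\<sigma>. (\<forall>v\<in>Lam N. \<sigma> v \<in> {-1, 1}) \<and> (\<forall>v. v \<notin> Lam N \<longrightarrow> \<sigma> v = dob v)}"

definition pedges :: "nat \<Rightarrow> (site \<times> site) set" where
  "pedges N = {(v, w). (w = (fst v + 1, snd v) \<or> w = (fst v, snd v + 1))
                        \<and> (v \<in> Lam N \<or> w \<in> Lam N)}"

definition hamil :: "nat \<Rightarrow> (site \<Rightarrow> int) \<Rightarrow> nat" where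
  "hamil N \<sigma> = card {(v, w) \<in> pedges N. \<sigma> v \<noteq> \<sigma> w}"

definition ising_weight :: "real \<Rightarrow> real \<Rightarrow> nat \<Rightarrow> (site \<Rightarrow> int) \<Rightarrow> real" where
  "ising_weight \<beta> h N \<sigma> =
     exp (- 2 * \<beta> * real (hamil N \<sigma>) + h * (\<Sum>v\<in>Lam N. real_of_int (\<sigma> v)))"

definition ising_prob :: "real \<Rightarrow> real \<Rightarrow> nat \<Rightarrow> (site \<Rightarrow> int) set \<Rightarrow> real" where
  "ising_prob \<beta> h N A =
     (\<Sum>\<sigma>\<in>configs N \<inter> A. ising_weight \<beta> h N \<sigma>) / (\<Sum>\<sigma>\<in>configs N. ising_weight \<beta> h N \<sigma>)"

(* Dual lattice: the integer pair (a,b) encodes the dual vertex (a - 1/2, b - 1/2).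
   A dual edge is a pair (d, d') with d' = d + (1,0) (horizontal) or d' = d + (0,1) (vertical). *)
type_synonym dvert = "int \<times> int"
type_synonym dedge = "dvert \<times> dvert"

definition is_dedge :: "dedge \<Rightarrow> bool" where
  "is_dedge e \<longleftrightarrow> snd e = (fst (fst e) + 1, snd (fst e)) \<or> snd e = (fst (fst e), snd (fst e) + 1)"

(* the pair of primal sites separated by a dual edge *)
definition sep :: "dedge \<Rightarrow> site \<times> site" where
  "sep e = (let (a, b) = fst e in
            if snd e = (a + 1, b) then ((a, b - 1), (a, b)) else ((a - 1, b), (a, b)))"

definition dedges :: "nat \<Rightarrow> dedge set" where
  "dedges N = {e. is_dedge e \<and> (fst (sep e) \<in> Lam N \<or> snd (sep e) \<in> Lam N)}"

definition contour :: "nat \<Rightarrow> (site \<Rightarrow> int) \<Rightarrow> dedge set" where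
  "contour N \<sigma> = {e \<in> dedges N. \<sigma> (fst (sep e)) \<noteq> \<sigma> (snd (sep e))}"

definition incident :: "dvert \<Rightarrow> dedge \<Rightarrow> bool" where
  "incident d e \<longleftrightarrow> fst e = d \<or> snd e = d"

definition ddeg :: "dedge set \<Rightarrow> dvert \<Rightarrow> nat" where
  "ddeg S d = card {e \<in> S. incident d e}"

(* south-east splitting rule: two distinct edges of S sharing the dual vertex d are joined
   at d iff d has degree 2, or the pair is {south, east} or {north, west} of d. *)
definition joined :: "dedge set \<Rightarrow> dedge \<Rightarrow> dedge \<Rightarrow> bool" where
  "joined S e f \<longleftrightarrow> e \<noteq> f \<and> e \<in> S \<and> f \<in> S \<and>
     (\<exists>d. incident d e \<and> incident d f \<and>
        (ddeg S d = 2
         \<or> {e, f} = {((fst d, snd d - 1), d), (d, (fst d + 1, snd d))}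
         \<or> {e, f} = {(d, (fst d, snd d + 1)), ((fst d - 1, snd d), d)}))"

definition pieces :: "dedge set \<Rightarrow> dedge set set" where
  "pieces S = {{f. (e, f) \<in> {(x, y). joined S x y}\<^sup>*} | e. e \<in> S}"

definition dedge_of :: "dvert \<Rightarrow> dvert \<Rightarrow> dedge" where
  "dedge_of p q = (if fst p + snd p \<le> fst q + snd q then (p, q) else (q, p))"

definition dadj :: "dvert \<Rightarrow> dvert \<Rightarrow> bool" where
  "dadj p q \<longleftrightarrow> \<bar>fst p - fst q\<bar> + \<bar>snd p - snd q\<bar> = 1"

definition is_dpath :: "nat \<Rightarrow> dedge set \<Rightarrow> dvert \<Rightarrow> dvert \<Rightarrow> bool" where
  "is_dpath N \<gamma> a b \<longleftrightarrow> (\<exists>ps. length ps \<ge> 2 \<and> hd ps = a \<and> last ps = b \<and>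
      (\<forall>i < length ps - 1. dadj (ps ! i) (ps ! Suc i) \<and> dedge_of (ps ! i) (ps ! Suc i) \<in> dedges N) \<and>
      distinct (map (\<lambda>i. dedge_of (ps ! i) (ps ! Suc i)) [0..<length ps - 1]) \<and>
      \<gamma> = set (map (\<lambda>i. dedge_of (ps ! i) (ps ! Suc i)) [0..<length ps - 1]))"

(* start (-1/2,-1/2) and end (N+1/2,-1/2) *)
definition dstart :: dvert where "dstart = (0, 0)"
definition dend :: "nat \<Rightarrow> dvert" where "dend N = (int N + 1, 0)"

definition interface :: "nat \<Rightarrow> (site \<Rightarrow> int) \<Rightarrow> dedge set" where
  "interface N \<sigma> = (THE P. P \<in> pieces (contour N \<sigma>) \<and> is_dpath N P dstart (dend N))"

definition admissible :: "nat \<Rightarrow> dedge set \<Rightarrow> bool" where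
  "admissible N \<gamma> \<longleftrightarrow> is_dpath N \<gamma> dstart (dend N) \<and> (\<exists>\<sigma>\<in>configs N. interface N \<sigma> = \<gamma>)"

definition beta_c :: real where "beta_c = ln (1 + sqrt 2)"

end

(* Write x = exp (- 2 beta) < 1/5, encode a configuration by its set of minus sites, and let Z^D(l) be
   the partition function with minus boundary set D and weight exp (- l |m|) on minus sets m.

   The interface gamma is determined by the spins on a collar F of at most 8 |gamma| sites. By FKG (from
   the four functions theorem), adding the field costs at most as much given gamma in the Dobrushin
   measure as given that F is all plus in the plus measure. Removing the latter condition costs
   exp (O(l E|K|)), where K is the union of the minus clusters that meet F, and E|K| = O(|F|) by a
   Peierls bound; since l = O(1/N), this is O(1) if |gamma| = O(N). Longer interfaces are negligible,
   again by a Peierls bound.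

   What remains is to bound Z^low(0) Z^{}(l) / (Z^low(l) Z^{}(0)), low being the lower half plane. By FKG,
   Z^low(l) / Z^{}(l) is at least the same ratio with minus spins only allowed in the strip of height h,
   where the field costs just exp (O(l h N)) = exp (O(h)). Without field, Z^low / Z^{} is a ratio of
   entries of the column transfer matrix. Conjugation by this matrix acts linearly on the Majorana
   operators through a tridiagonal matrix bounded below by (theta + 1 / theta) / 2, where
   theta = x (1 + x) / (1 - x). Hence the ratio is of order at most theta^N in the box, while the trial
   vector sin (pi j / h) shows that it is at least theta^N exp (- O(h + N / h^2)) in the strip. The choice
   h = N^(1/3) balances the errors. *)

theory Submission
  imports Defs "HOL-Analysis.Analysis" "HOL-Real_Asymp.Real_Asymp"
begin

section \<open>The four functions theorem and cuts\<close>

text \<open>The difficulty is precision. Bounding the field by its maximum already loses exp (O(N)),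
  and so would estimates of the partition function ratio whose exponential rates differ between box
  and strip; the rate \<theta> has to be exact. The free fermion structure supplies it: conjugation
  by the transfer matrix and by its inverse sends an operator \<open>maj_a\<close> to combinations
  whose \<open>maj_b\<close> parts are opposite. Averaging leaves a tridiagonal matrix
  \<open>Lc\<close> on the \<open>maj_a\<close> alone, which away from the ends is the constant
  (\<theta> + 1 / \<theta>) / 2 plus half a discrete Laplacian. The operators \<open>maj_a\<close>
  flip the lower frozen row, so they connect the plus block with the Dobrushin block, and
  \<open>Lc\<close> controls the quotient of the two Perron eigenvalues. The lowest Laplacian mode
  on height h costs order 1 / h^2 per column. Contours serve only where bounded factors or
  exponentially small errors are at stake; walks of length n are counted by 4^n there, so the
  condition is 4 x < 1.\<close>

lemma four_numbers:
  fixes a0 a1 b0 b1 c0 c1 d0 d1 :: real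
  assumes "a0 \<ge> 0" "a1 \<ge> 0" "b0 \<ge> 0" "b1 \<ge> 0" "c0 \<ge> 0" "c1 \<ge> 0" "d0 \<ge> 0" "d1 \<ge> 0"
    and "a0 * b0 \<le> c0 * d0" "a0 * b1 \<le> c1 * d0" "a1 * b0 \<le> c1 * d0" "a1 * b1 \<le> c1 * d1"
  shows "(a0 + a1) * (b0 + b1) \<le> (c0 + c1) * (d0 + d1)"
proof -
  define P where "P = c1 * d0"
  have P: "P \<ge> 0" using assms by (simp add: P_def)
  have "a0 * b1 + a1 * b0 \<le> P + c0 * d1"
  proof (cases "P = 0")
    case True
    then have "a0 * b1 \<le> 0" "a1 * b0 \<le> 0" using assms P_def by auto
    then show ?thesis using True assms by (smt (verit) mult_nonneg_nonneg)
  next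
    case False
    then have pos: "P > 0" using P by simp
    have "(a0 * b1) * (a1 * b0) = (a0 * b0) * (a1 * b1)" by simp
    also have "\<dots> \<le> (c0 * d0) * (c1 * d1)"
      by (intro mult_mono mult_nonneg_nonneg assms)
    also have "\<dots> = P * (c0 * d1)" by (simp add: P_def)
    finally have 1: "(a0 * b1) * (a1 * b0) \<le> P * (c0 * d1)" .
    \<comment> \<open>Both mixed products are at most \<open>P\<close>, and their product is at most
      \<open>P * (c0 * d1)\<close>. Expanding this product and dividing by \<open>P\<close> bounds
      their sum by \<open>P + c0 * d1\<close>.\<close>
    have "0 \<le> (P - a0 * b1) * (P - a1 * b0)"
      by (intro mult_nonneg_nonneg) (use assms P_def in auto)
    then have "P * (a0 * b1 + a1 * b0) \<le> P * P + (a0 * b1) * (a1 * b0)"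
      by (simp add: algebra_simps)
    also have "\<dots> \<le> P * (P + c0 * d1)" using 1 by (simp add: algebra_simps)
    finally show ?thesis using pos by simp
  qed
  then show ?thesis using assms by (simp add: algebra_simps P_def)
qed

lemma sum_Pow_insert:
  assumes "finite S" "a \<notin> S"
  shows "(\<Sum>A\<in>Pow (insert a S). f A) = (\<Sum>A\<in>Pow S. f A + (f (insert a A) :: 'b :: comm_monoid_add))"
proof -
  have inj: "inj_on (insert a) (Pow S)" using assms(2) by (auto simp: inj_on_def)
  have disj: "Pow S \<inter> insert a ` Pow S = {}" using assms(2) by auto
  have "(\<Sum>A\<in>Pow (insert a S). f A) = (\<Sum>A\<in>Pow S. f A) + (\<Sum>A\<in>insert a ` Pow S. f A)"
    unfolding Pow_insert by (rule sum.union_disjoint) (use assms disj in auto)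
  also have "(\<Sum>A\<in>insert a ` Pow S. f A) = (\<Sum>A\<in>Pow S. f (insert a A))"
    using inj by (simp add: sum.reindex)
  finally show ?thesis by (simp add: sum.distrib)
qed

text \<open>Ahlswede-Daykin: one element of the ground set is summed out at a time, and by
  \<open>four_numbers\<close> the partial sums satisfy the same hypothesis. All correlation
  inequalities below, between events, boundary conditions or field strengths, are instances.\<close>

theorem four_functions:
  fixes \<alpha> \<beta> \<gamma> \<delta> :: "'a set \<Rightarrow> real"
  assumes "finite S"
    and "\<And>A. A \<subseteq> S \<Longrightarrow> \<alpha> A \<ge> 0" "\<And>A. A \<subseteq> S \<Longrightarrow> \<beta> A \<ge> 0"
    and "\<And>A. A \<subseteq> S \<Longrightarrow> \<gamma> A \<ge> 0" "\<And>A. A \<subseteq> S \<Longrightarrow> \<delta> A \<ge> 0"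
    and "\<And>A B. A \<subseteq> S \<Longrightarrow> B \<subseteq> S \<Longrightarrow> \<alpha> A * \<beta> B \<le> \<gamma> (A \<union> B) * \<delta> (A \<inter> B)"
  shows "(\<Sum>A\<in>Pow S. \<alpha> A) * (\<Sum>A\<in>Pow S. \<beta> A) \<le> (\<Sum>A\<in>Pow S. \<gamma> A) * (\<Sum>A\<in>Pow S. \<delta> A)"
  using assms
proof (induction S arbitrary: \<alpha> \<beta> \<gamma> \<delta> rule: finite_induct)
  case empty
  then show ?case by simp
next
  case (insert a S)
  have 4: "(\<alpha> A + \<alpha> (insert a A)) * (\<beta> B + \<beta> (insert a B))
      \<le> (\<gamma> (A \<union> B) + \<gamma> (insert a (A \<union> B))) * (\<delta> (A \<inter> B) + \<delta> (insert a (A \<inter> B)))"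
    if "A \<subseteq> S" "B \<subseteq> S" for A B
  proof -
    have a: "a \<notin> A" "a \<notin> B" using that insert.hyps by auto
    have i: "insert a A \<inter> B = A \<inter> B" "A \<inter> insert a B = A \<inter> B" using a by auto
    have sub: "A \<subseteq> insert a S" "B \<subseteq> insert a S" "insert a A \<subseteq> insert a S" "insert a B \<subseteq> insert a S"
      using that by auto
    show ?thesis
    proof (rule four_numbers)
      show "\<alpha> A * \<beta> B \<le> \<gamma> (A \<union> B) * \<delta> (A \<inter> B)" using insert.prems(5) sub by blast
      show "\<alpha> A * \<beta> (insert a B) \<le> \<gamma> (insert a (A \<union> B)) * \<delta> (A \<inter> B)"
        using insert.prems(5)[OF sub(1) sub(4)] i by simp
      show "\<alpha> (insert a A) * \<beta> B \<le> \<gamma> (insert a (A \<union> B)) * \<delta> (A \<inter> B)"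
        using insert.prems(5)[OF sub(3) sub(2)] i by simp
      show "\<alpha> (insert a A) * \<beta> (insert a B) \<le> \<gamma> (insert a (A \<union> B)) * \<delta> (insert a (A \<inter> B))"
        using insert.prems(5)[OF sub(3) sub(4)] by simp
    qed (use that sub in \<open>auto intro!: insert.prems(1-4)\<close>)
  qed
  show ?case
    unfolding sum_Pow_insert[OF insert.hyps(1,2)]
    by (rule insert.IH) (use 4 in \<open>auto intro!: add_nonneg_nonneg insert.prems(1-4)\<close>)
qed

text \<open>The Ising energy of a set of minus sites is such a cut. Its submodularity is the lattice
  condition behind every use of FKG.\<close>

definition cut :: "('a \<times> 'a) set \<Rightarrow> 'a set \<Rightarrow> nat" where
  "cut E P = card {e \<in> E. (fst e \<in> P) \<noteq> (snd e \<in> P)}"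

lemma cut_eq_sum: "finite E \<Longrightarrow> cut E P = (\<Sum>e\<in>E. of_bool ((fst e \<in> P) \<noteq> (snd e \<in> P)))"
  unfolding cut_def by (simp add: sum_of_bool_eq Int_def conj_commute)

lemma cut_submodular:
  assumes "finite E"
  shows "cut E (P \<union> Q) + cut E (P \<inter> Q) \<le> cut E P + cut E Q"
  unfolding cut_eq_sum[OF assms] sum.distrib[symmetric]
  by (rule sum_mono) auto

lemma cut_Un_disjoint:
  assumes "finite E" "finite E'" "E \<inter> E' = {}"
  shows "cut (E \<union> E') P = cut E P + cut E' P"
  using assms by (simp add: cut_eq_sum sum.union_disjoint del: sum_of_bool_eq)

lemma cut_cong:
  "(\<And>e. e \<in> E \<Longrightarrow> ((fst e \<in> P) \<noteq> (snd e \<in> P)) = ((fst e \<in> Q) \<noteq> (snd e \<in> Q))) \<Longrightarrow> cut E P = cut E Q"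
  unfolding cut_def by (rule arg_cong[where f = card]) auto

lemma power_cut_submodular:
  fixes x :: real
  assumes "finite E" "0 \<le> x" "x \<le> 1"
  shows "x ^ cut E P * x ^ cut E Q \<le> x ^ cut E (P \<union> Q) * x ^ cut E (P \<inter> Q)"
  using power_decreasing[OF cut_submodular[OF assms(1)] assms(2,3)] by (simp add: power_add)

section \<open>Perron eigenvectors\<close>

text \<open>Perron-Frobenius by the variational route that symmetry permits: the eigenvector
  maximises the quadratic form on the nonnegative part of the unit sphere.\<close>

lemma symmetric_positive_eigenvector:
  fixes K :: "'a \<Rightarrow> 'a \<Rightarrow> real"
  assumes fin: "finite I" and ne: "I \<noteq> {}"
    and sym: "\<And>i j. i \<in> I \<Longrightarrow> j \<in> I \<Longrightarrow> K i j = K j i"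
    and pos: "\<And>i j. i \<in> I \<Longrightarrow> j \<in> I \<Longrightarrow> K i j > 0"
  obtains \<psi> \<Lambda> where "\<Lambda> > 0" "\<And>i. i \<in> I \<Longrightarrow> \<psi> i > 0" "\<And>i. i \<notin> I \<Longrightarrow> \<psi> i = 0"
    "\<And>i. i \<in> I \<Longrightarrow> (\<Sum>j\<in>I. K i j * \<psi> j) = \<Lambda> * \<psi> i"
proof -
  \<comment> \<open>Coordinates off \<open>I\<close> are pinned to 0, so that the product set is
    compact in the whole function space.\<close>
  define S where "S = (\<lambda>i. if i \<in> I then {0..1::real} else {0})"
  define F where "F = (\<lambda>f. \<Sum>i\<in>I. \<Sum>j\<in>I. K i j * f i * f j)"
  define nn where "nn = (\<lambda>f :: 'a \<Rightarrow> real. \<Sum>i\<in>I. f i * f i)"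
  define D where "D = PiE UNIV S \<inter> {f. nn f = 1}"
  have "compactin (product_topology (\<lambda>i. euclidean) UNIV) (PiE UNIV S)"
    by (subst compactin_PiE) (auto simp: S_def)
  then have "compact (PiE UNIV S)"
    by (metis compactin_euclidean_iff euclidean_product_topology)
  moreover have cn: "continuous_on UNIV nn"
    unfolding nn_def by (intro continuous_intros continuous_on_product_coordinates)
  then have "closed {f. nn f = 1}"
    using continuous_closed_preimage_constant[OF cn closed_UNIV, of 1] by simp
  ultimately have "compact D" unfolding D_def by (rule compact_Int_closed)
  moreover have "D \<noteq> {}"
  proof -
    obtain i0 where i0: "i0 \<in> I" using ne by auto
    define e where "e = (\<lambda>i. of_bool (i = i0) :: real)"
    have "nn e = 1" using i0 fin by (simp add: nn_def e_def of_bool_def if_distrib[of "\<lambda>x. x * x"] cong: if_cong)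
    moreover have "e \<in> PiE UNIV S" using i0 by (auto simp: S_def e_def)
    ultimately show ?thesis unfolding D_def by auto
  qed
  moreover have "continuous_on D F"
    unfolding F_def
    by (intro continuous_intros continuous_on_subset[OF continuous_on_product_coordinates]) auto
  ultimately obtain \<psi> where \<psi>: "\<psi> \<in> D" and max: "\<And>f. f \<in> D \<Longrightarrow> F f \<le> F \<psi>"
    using continuous_attains_sup by metis
  define \<Lambda> where "\<Lambda> = F \<psi>"
  have \<psi>0: "\<And>i. \<psi> i \<ge> 0" "\<And>i. i \<notin> I \<Longrightarrow> \<psi> i = 0" and n1: "nn \<psi> = 1"
    using \<psi> unfolding D_def S_def by (auto simp: PiE_iff split: if_splits; metis atLeastAtMost_iff order_refl singletonD)+
  \<comment> \<open>Passing to normalised absolute values does not decrease the form, since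
    \<open>K\<close> is positive. So the maximum over nonnegative vectors bounds the Rayleigh
    quotient of every vector.\<close>
  have ray: "F f \<le> \<Lambda> * nn f" for f
  proof (cases "nn f = 0")
    case True
    then have z: "\<And>i. i \<in> I \<Longrightarrow> f i = 0"
      unfolding nn_def using fin by (subst (asm) sum_nonneg_eq_0_iff) auto
    then show ?thesis using True by (simp add: F_def)
  next
    case False
    define t where "t = sqrt (nn f)"
    have nnp: "nn f \<ge> 0" unfolding nn_def by (intro sum_nonneg) auto
    then have t: "t > 0" "t * t = nn f" using False by (auto simp: t_def)
    define g where "g = (\<lambda>i. if i \<in> I then \<bar>f i\<bar> / t else 0)"
    have ng: "nn g = 1"
    proof -
      have "nn g = (\<Sum>i\<in>I. f i * f i / (t * t))"
        unfolding nn_def g_def by (intro sum.cong) (auto simp: abs_mult_self_eq)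
      also have "\<dots> = nn f / (t * t)" unfolding nn_def by (simp add: sum_divide_distrib)
      finally show ?thesis using t False by simp
    qed
    have "g i \<le> 1" if "i \<in> I" for i
    proof -
      have "g i * g i \<le> nn g"
        unfolding nn_def by (rule member_le_sum) (use that fin in auto)
      then show ?thesis using ng abs_square_le_1[of "g i"] by (simp add: power2_eq_square)
    qed
    moreover have "g i \<ge> 0" "i \<notin> I \<Longrightarrow> g i = 0" for i using t by (auto simp: g_def)
    ultimately have "g \<in> D" using ng unfolding D_def S_def by (auto simp: PiE_iff)
    then have "F g \<le> \<Lambda>" using max \<Lambda>_def by auto
    moreover have "F f \<le> t * t * F g"
    proof -
      have "F f \<le> (\<Sum>i\<in>I. \<Sum>j\<in>I. K i j * \<bar>f i\<bar> * \<bar>f j\<bar>)"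
        unfolding F_def
      proof (intro sum_mono)
        fix i j assume "i \<in> I" "j \<in> I"
        then have "K i j * (f i * f j) \<le> K i j * \<bar>f i * f j\<bar>"
          using pos[of i j] by (intro mult_left_mono) auto
        then show "K i j * f i * f j \<le> K i j * \<bar>f i\<bar> * \<bar>f j\<bar>" by (simp add: abs_mult mult.assoc)
      qed
      also have "\<dots> = t * t * F g"
        unfolding F_def sum_distrib_left using t(1) by (intro sum.cong) (auto simp: g_def)
      finally show ?thesis .
    qed
    ultimately show ?thesis using t by (smt (verit) mult.commute mult_left_mono mult_pos_pos)
  qed
  have eig: "(\<Sum>j\<in>I. K i j * \<psi> j) = \<Lambda> * \<psi> i" if i: "i \<in> I" for i
  proof -
    define a where "a = (\<Sum>j\<in>I. K i j * \<psi> j) - \<Lambda> * \<psi> i"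
    define b where "b = K i i - \<Lambda>"
    \<comment> \<open>First variation in coordinate \<open>i\<close>: the Rayleigh bound is an
      equality at s = 0, so the linear coefficient has to vanish.\<close>
    have quad: "2 * a * s + b * s * s \<le> 0" for s
    proof -
      define e where "e = (\<lambda>j. of_bool (j = i) :: real)"
      define g where "g = (\<lambda>j. \<psi> j + s * e j)"
      have e: "(\<Sum>j\<in>I. h j * e j) = h i" for h
        using i fin by (simp add: e_def of_bool_def if_distrib cong: if_cong)
      have "nn g = (\<Sum>j\<in>I. \<psi> j * \<psi> j + (2 * s * \<psi> j) * e j + s * s * e j * e j)"
        unfolding nn_def g_def by (intro sum.cong) (auto simp: algebra_simps)
      also have "\<dots> = 1 + 2 * s * \<psi> i + s * s"
        using n1 by (simp only: sum.distrib e) (simp add: nn_def e_def)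
      finally have ng: "nn g = 1 + 2 * s * \<psi> i + s * s" .
      have "F g = (\<Sum>j\<in>I. \<Sum>k\<in>I. K j k * \<psi> j * \<psi> k + (s * K j k * \<psi> j) * e k + (s * K j k * \<psi> k) * e j + (s * s * K j k * e j) * e k)"
        unfolding F_def g_def by (intro sum.cong) (auto simp: algebra_simps)
      also have "\<dots> = F \<psi> + (\<Sum>j\<in>I. s * K j i * \<psi> j) + (\<Sum>k\<in>I. \<Sum>j\<in>I. (s * K j k * \<psi> k) * e j) + (\<Sum>j\<in>I. (s * s * K j i) * e j)"
        unfolding sum.distrib e F_def by (subst sum.swap[of "\<lambda>j k. (s * K j k * \<psi> k) * e j"]) (simp add: e)
      also have "\<dots> = F \<psi> + (\<Sum>j\<in>I. s * K i j * \<psi> j) + (\<Sum>k\<in>I. s * K i k * \<psi> k) + s * s * K i i"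
        unfolding e by (intro arg_cong2[where f = "(+)"] refl sum.cong) (auto simp: sym[OF i])
      also have "\<dots> = \<Lambda> + 2 * s * (\<Sum>j\<in>I. K i j * \<psi> j) + s * s * K i i"
        by (simp add: \<Lambda>_def sum_distrib_left mult.assoc)
      finally have "\<Lambda> + 2 * s * (\<Sum>j\<in>I. K i j * \<psi> j) + s * s * K i i \<le> \<Lambda> * (1 + 2 * s * \<psi> i + s * s)"
        using ray[of g] ng by simp
      then show ?thesis by (simp add: a_def b_def algebra_simps)
    qed
    have "a = 0"
    proof (rule ccontr)
      assume "a \<noteq> 0"
      define B where "B = \<bar>b\<bar> + 1"
      \<comment> \<open>\<open>B\<close> exceeds the modulus of \<open>b\<close>, so at this point
        the linear term outweighs the quadratic one.\<close>
      define s where "s = a / B"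
      have B: "B > 0" "2 * B + b > 0" by (auto simp: B_def abs_if)
      have "2 * a * s + b * s * s = a * a * (2 * B + b) / (B * B)"
        using B(1) by (simp add: s_def field_simps)
      also have "a * a > 0" using \<open>a \<noteq> 0\<close> by (auto simp: zero_less_mult_iff)
      then have "a * a * (2 * B + b) / (B * B) > 0" using B by simp
      finally show False using quad[of s] by simp
    qed
    then show ?thesis by (simp add: a_def)
  qed
  obtain k where k: "k \<in> I" "\<psi> k > 0"
  proof -
    have "\<exists>k\<in>I. \<psi> k \<noteq> 0"
    proof (rule ccontr)
      assume "\<not> ?thesis"
      then have "nn \<psi> = 0" by (simp add: nn_def)
      then show False using n1 by simp
    qed
    then show thesis using that \<psi>0(1) by (metis less_eq_real_def)
  qed
  have sp: "(\<Sum>j\<in>I. K i j * \<psi> j) > 0" if "i \<in> I" for i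
  proof -
    have "0 < K i k * \<psi> k" using pos[OF that k(1)] k by simp
    also have "\<dots> \<le> (\<Sum>j\<in>I. K i j * \<psi> j)"
      by (rule member_le_sum) (use fin k that pos \<psi>0 in \<open>auto intro!: mult_nonneg_nonneg intro: less_imp_le\<close>)
    finally show ?thesis .
  qed
  have "\<Lambda> > 0" using sp[OF k(1)] eig[OF k(1)] k by (simp add: zero_less_mult_iff)
  moreover have "\<psi> i > 0" if "i \<in> I" for i
    using sp[OF that] eig[OF that] \<open>\<Lambda> > 0\<close> by (simp add: zero_less_mult_iff)
  ultimately show ?thesis using that \<psi>0(2) eig by blast
qed

section \<open>The transfer matrix and Majorana operators\<close>

text \<open>Flipping the spins in \<open>d\<close> turns the minus set \<open>c\<close> into
  \<open>sd c d\<close>. Later the same operation adds sets of dual edges modulo 2.\<close>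

definition sd :: "'a set \<Rightarrow> 'a set \<Rightarrow> 'a set" where
  "sd c d = {i. (i \<in> c) \<noteq> (i \<in> d)}"

lemma in_sd [simp]: "i \<in> sd c d \<longleftrightarrow> (i \<in> c) \<noteq> (i \<in> d)"
  by (simp add: sd_def)

lemma sd_sd [simp]: "sd (sd c d) d = c" and sd_commute: "sd c d = sd d c"
  and sd_left: "sd (sd c d) e = sd (sd c e) d" and sd_assoc: "sd (sd c d) e = sd c (sd d e)"
  and sd_empty [simp]: "sd c {} = c"
  by auto

lemma sd_subset: "c \<subseteq> S \<Longrightarrow> d \<subseteq> S \<Longrightarrow> sd c d \<subseteq> S"
  by auto

lemma sum_Pow_sd:
  assumes "d \<subseteq> S"
  shows "(\<Sum>c\<in>Pow S. g (sd c d)) = (\<Sum>c\<in>Pow S. g c)"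
  by (rule sum.reindex_bij_witness[where i = "\<lambda>c. sd c d" and j = "\<lambda>c. sd c d"])
    (use assms in \<open>auto simp: subset_iff\<close>)

definition zs :: "nat \<Rightarrow> nat set \<Rightarrow> real" where
  "zs j c = (if j \<in> c then -1 else 1)"

(* A column is given by its set of minus rows. Rows 1..H carry spins; 0 and Suc H are the frozen
   boundary rows below and above. *)
definition walls :: "nat \<Rightarrow> nat set \<Rightarrow> nat" where
  "walls H c = cut ((\<lambda>j. (j, Suc j)) ` {..H}) c"

text \<open>The vertical bonds of a column, with \<open>y\<close> = exp (- beta) per wall instead of
  \<open>y\<^sup>2\<close>: half of the column's weight goes to each side of a step, which makes
  \<open>tm\<close> symmetric.\<close>

definition diag_op :: "real \<Rightarrow> nat \<Rightarrow> (nat set \<Rightarrow> real) \<Rightarrow> nat set \<Rightarrow> real" where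
  "diag_op y H f c = y ^ walls H c * f c"

text \<open>The horizontal bonds between two columns, where \<open>d\<close> is the set of rows in
  which they differ. As an operator this is the commuting product over \<open>j\<close> in
  \<open>S\<close> of 1 + x X, with X the flip of row \<open>j\<close>.\<close>

definition hop :: "real \<Rightarrow> nat set \<Rightarrow> (nat set \<Rightarrow> real) \<Rightarrow> nat set \<Rightarrow> real" where
  "hop x S f c = (\<Sum>d\<in>Pow S. x ^ card d * f (sd c d))"

definition tm :: "real \<Rightarrow> nat \<Rightarrow> (nat set \<Rightarrow> real) \<Rightarrow> nat set \<Rightarrow> real" where
  "tm y H f = diag_op y H (hop (y\<^sup>2) {1..H} (diag_op y H f))"

(* Majorana operators: a disorder string flipping rows 0..j, times the spin in row j + 1 (for a) or j
   (for b). The factor i making b self-adjoint is dropped. *)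
definition maj_a :: "nat \<Rightarrow> (nat set \<Rightarrow> real) \<Rightarrow> nat set \<Rightarrow> real" where
  "maj_a j f c = zs (Suc j) c * f (sd c {..j})"

definition maj_b :: "nat \<Rightarrow> (nat set \<Rightarrow> real) \<Rightarrow> nat set \<Rightarrow> real" where
  "maj_b j f c = - zs j c * f (sd c {..j})"

definition lincomb :: "real \<Rightarrow> ('a \<Rightarrow> real) \<Rightarrow> real \<Rightarrow> ('a \<Rightarrow> real) \<Rightarrow> 'a \<Rightarrow> real" where
  "lincomb a f b g c = a * f c + b * g c"

section \<open>Commutation of Majorana operators with the factors of the transfer matrix\<close>

lemma lincomb_linear:
  "diag_op y H (lincomb a f b g) = lincomb a (diag_op y H f) b (diag_op y H g)"
  "hop x S (lincomb a f b g) = lincomb a (hop x S f) b (hop x S g)"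
  "tm y H (lincomb a f b g) = lincomb a (tm y H f) b (tm y H g)"
  "maj_a j (lincomb a f b g) = lincomb a (maj_a j f) b (maj_a j g)"
  "maj_b j (lincomb a f b g) = lincomb a (maj_b j f) b (maj_b j g)"
proof -
  show 1: "diag_op y H (lincomb a f b g) = lincomb a (diag_op y H f) b (diag_op y H g)" for f g
    by (auto simp: diag_op_def lincomb_def fun_eq_iff algebra_simps)
  show 2: "hop x S (lincomb a f b g) = lincomb a (hop x S f) b (hop x S g)" for f g x S
    by (auto simp: hop_def lincomb_def fun_eq_iff sum.distrib sum_distrib_left algebra_simps)
  show "tm y H (lincomb a f b g) = lincomb a (tm y H f) b (tm y H g)"
    unfolding tm_def 1 2 ..
qed (auto simp: maj_a_def maj_b_def lincomb_def fun_eq_iff algebra_simps)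

lemma walls_eq: "walls H c = (\<Sum>j\<le>H. of_bool ((j \<in> c) \<noteq> (Suc j \<in> c)))"
  unfolding walls_def by (subst cut_eq_sum) (auto simp: sum.reindex inj_on_def simp del: sum_of_bool_eq)

text \<open>A flip of rows 0 to \<open>j\<close> affects only the bond between rows \<open>j\<close>
  and \<open>Suc j\<close>.\<close>

lemma walls_sd:
  fixes y :: real
  assumes "j \<le> H" "y \<noteq> 0"
  shows "y ^ walls H (sd c {..j}) = y ^ walls H c * (if zs j c = zs (Suc j) c then y else inverse y)"
proof -
  have split: "walls H c = of_bool ((j \<in> c) \<noteq> (Suc j \<in> c)) + (\<Sum>i\<in>{..H} - {j}. of_bool ((i \<in> c) \<noteq> (Suc i \<in> c)))" for c
    unfolding walls_eq using assms(1) by (subst sum.remove[of _ j]) auto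
  have "(\<Sum>i\<in>{..H} - {j}. of_bool ((i \<in> sd c {..j}) \<noteq> (Suc i \<in> sd c {..j}))) =
    (\<Sum>i\<in>{..H} - {j}. of_bool ((i \<in> c) \<noteq> (Suc i \<in> c)) :: nat)"
    by (rule sum.cong) (auto simp: Suc_le_eq)
  then show ?thesis
    unfolding split[of c] split[of "sd c {..j}"] using assms(2) by (auto simp: zs_def)
qed

text \<open>\<open>C\<close> and \<open>S\<close> are cosh and sinh of - ln y. By
  \<open>walls_sd\<close>, moving the string across the diagonal weight produces C + S Z, where Z is
  the product of the spins in rows \<open>j\<close> and \<open>Suc j\<close>; multiplication by Z
  exchanges \<open>maj_a j\<close> and \<open>maj_b j\<close> up to sign, so only this pair
  mixes.\<close>

lemma diag_op_majorana:
  fixes y :: real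
  assumes "j \<le> H" "0 < y"
  defines "C \<equiv> (1 / y + y) / 2" and "S \<equiv> (1 / y - y) / 2"
  shows "diag_op y H (maj_a j f) = lincomb C (maj_a j (diag_op y H f)) (- S) (maj_b j (diag_op y H f))"
    and "diag_op y H (maj_b j f) = lincomb C (maj_b j (diag_op y H f)) (- S) (maj_a j (diag_op y H f))"
proof -
  have y: "y \<noteq> 0" using assms by simp
  show "diag_op y H (maj_a j f) = lincomb C (maj_a j (diag_op y H f)) (- S) (maj_b j (diag_op y H f))"
    "diag_op y H (maj_b j f) = lincomb C (maj_b j (diag_op y H f)) (- S) (maj_a j (diag_op y H f))"
    using y by (auto simp: diag_op_def maj_a_def maj_b_def lincomb_def fun_eq_iff walls_sd[OF assms(1) y] C_def S_def zs_def
        field_simps)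
qed

lemma hop_insert:
  assumes "finite S" "a \<notin> S"
  shows "hop x (insert a S) f c = hop x S f c + x * hop x S f (sd c {a})"
proof -
  have *: "x ^ card (insert a d) * f (sd c (insert a d)) = x * (x ^ card d * f (sd (sd c {a}) d))"
    if "d \<in> Pow S" for d
  proof -
    have "a \<notin> d" "finite d" using that assms finite_subset by auto
    then have "sd c (insert a d) = sd (sd c {a}) d" by auto
    then show ?thesis using \<open>a \<notin> d\<close> \<open>finite d\<close> by simp
  qed
  show ?thesis
    unfolding hop_def sum_Pow_insert[OF assms] sum.distrib sum_distrib_left
    using * by (intro arg_cong2[where f = "(+)"] refl sum.cong) auto
qed

lemma hop_translate: "hop x S (\<lambda>c. f (sd c e)) c = hop x S f (sd c e)"
  unfolding hop_def by (intro sum.cong) (auto simp: sd_left)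

lemma hop_zs:
  assumes "finite S" "j \<notin> S"
  shows "hop x S (\<lambda>c. zs j c * f c) c = zs j c * hop x S f c"
proof -
  have "zs j (sd c d) = zs j c" if "d \<in> Pow S" for d
    using that assms by (auto simp: zs_def)
  then show ?thesis unfolding hop_def sum_distrib_left by (intro sum.cong) auto
qed

text \<open>The spin in row \<open>j\<close> anticommutes with the flip X of that row, hence turns
  the factor 1 + x X into 1 - x X. As X squares to 1, the latter is (c - s X) (1 + x X), with c and
  s the two fractions of the statement.\<close>

lemma hop_zs_in:
  assumes "finite S" "j \<in> S" "0 < x" "x < 1"
  shows "hop x S (\<lambda>c. zs j c * f c) c =
    zs j c * ((1 + x\<^sup>2) / (1 - x\<^sup>2) * hop x S f c - 2 * x / (1 - x\<^sup>2) * hop x S f (sd c {j}))"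
proof -
  define S' where "S' = S - {j}"
  have S: "S = insert j S'" "finite S'" "j \<notin> S'" using assms by (auto simp: S'_def)
  have x: "1 - x\<^sup>2 > 0" using assms by (simp add: power_less_one_iff)
  have z: "zs j (sd c {j}) = - zs j c" by (auto simp: zs_def)
  have e: "(1 + x\<^sup>2) / (1 - x\<^sup>2) * (u + x * v) - 2 * x / (1 - x\<^sup>2) * (v + x * u) = u - x * v" for u v
  proof -
    have "(1 + x\<^sup>2) * (u + x * v) - 2 * x * (v + x * u) = (1 - x\<^sup>2) * (u - x * v)" by algebra
    then have "((1 + x\<^sup>2) * (u + x * v) - 2 * x * (v + x * u)) / (1 - x\<^sup>2) = u - x * v" using x by simp
    then show ?thesis by (simp add: diff_divide_distrib)
  qed
  show ?thesis
    unfolding S(1) hop_insert[OF S(2,3)] hop_zs[OF S(2,3)] z sd_sd e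
    by (simp add: algebra_simps)
qed

lemma hop_maj_a:
  assumes "0 < x" "x < 1" "j \<le> H"
  shows "hop x {1..H} (maj_a j f) =
    lincomb (if j < H then (1 + x\<^sup>2) / (1 - x\<^sup>2) else 1) (maj_a j (hop x {1..H} f))
       (if j < H then 2 * x / (1 - x\<^sup>2) else 0) (maj_b (Suc j) (hop x {1..H} f))"
proof
  fix c
  have maj_a: "maj_a j f = (\<lambda>c. zs (Suc j) c * (\<lambda>c. f (sd c {..j})) c)" by (auto simp: maj_a_def)
  have s: "sd (sd c {Suc j}) {..j} = sd c {..Suc j}" by (auto simp: le_Suc_eq)
  show "hop x {1..H} (maj_a j f) c = lincomb (if j < H then (1 + x\<^sup>2) / (1 - x\<^sup>2) else 1) (maj_a j (hop x {1..H} f))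
       (if j < H then 2 * x / (1 - x\<^sup>2) else 0) (maj_b (Suc j) (hop x {1..H} f)) c"
  proof (cases "j < H")
    case True
    then have "Suc j \<in> {1..H}" by auto
    from hop_zs_in[OF _ this assms(1,2), of "\<lambda>c. f (sd c {..j})" c] show ?thesis
      unfolding maj_a using True by (simp add: hop_translate s lincomb_def maj_a_def maj_b_def algebra_simps)
  next
    case False
    then have "Suc j \<notin> {1..H}" by auto
    from hop_zs[OF _ this, of x "\<lambda>c. f (sd c {..j})" c] show ?thesis
      unfolding maj_a using False by (simp add: hop_translate lincomb_def maj_a_def)
  qed
qed

lemma hop_maj_b:
  assumes "0 < x" "x < 1" "j \<le> H"
  shows "hop x {1..H} (maj_b j f) =
    lincomb (if 0 < j then (1 + x\<^sup>2) / (1 - x\<^sup>2) else 1) (maj_b j (hop x {1..H} f))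
       (if 0 < j then 2 * x / (1 - x\<^sup>2) else 0) (maj_a (j - 1) (hop x {1..H} f))"
proof
  fix c
  have bse: "maj_b j f = (\<lambda>c. zs j c * (\<lambda>c. - f (sd c {..j})) c)" by (auto simp: maj_b_def)
  have m: "hop x V (\<lambda>c. - g c) c = - hop x V g c" for g c V
    by (simp add: hop_def sum_negf)
  have t: "hop x V (\<lambda>c. - f (sd c e)) c = - hop x V f (sd c e)" for c e V
    using m[of V "\<lambda>c. f (sd c e)"] hop_translate[of x V f e c] by simp
  have s: "sd (sd c {j}) {..j} = sd c {..j - Suc 0}" if "0 < j"
    using that by (auto simp: le_less)
  show "hop x {1..H} (maj_b j f) c =
    lincomb (if 0 < j then (1 + x\<^sup>2) / (1 - x\<^sup>2) else 1) (maj_b j (hop x {1..H} f))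
       (if 0 < j then 2 * x / (1 - x\<^sup>2) else 0) (maj_a (j - 1) (hop x {1..H} f)) c"
  proof (cases "0 < j")
    case True
    then have "j \<in> {1..H}" using assms by auto
    from hop_zs_in[OF _ this assms(1,2), of "\<lambda>c. - f (sd c {..j})" c] show ?thesis
      unfolding bse using True
      by (simp add: t s lincomb_def maj_a_def maj_b_def algebra_simps add_divide_distrib diff_divide_distrib)
  next
    case False
    then have "j \<notin> {1..H}" by auto
    from hop_zs[OF _ this, of x "\<lambda>c. - f (sd c {..j})" c] show ?thesis
      unfolding bse using False by (simp add: t lincomb_def maj_b_def)
  qed
qed

section \<open>Conjugation of Majorana operators by the whole transfer matrix\<close>

locale ising_transfer =
  fixes y :: real and H :: nat
  assumes y0: "0 < y" and y1: "y < 1" and H1: "1 \<le> H"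
begin

definition C where "C = (1 / y + y) / 2"
definition S where "S = (1 / y - y) / 2"
definition c0 where "c0 = (1 + (y\<^sup>2)\<^sup>2) / (1 - (y\<^sup>2)\<^sup>2)"
definition s0 where "s0 = 2 * y\<^sup>2 / (1 - (y\<^sup>2)\<^sup>2)"
text \<open>Rows 0 and \<open>Suc H\<close> are never flipped by \<open>hop\<close>, so it does not
  rotate \<open>maj_b 0\<close> and \<open>maj_a H\<close>; the case distinctions record
  this.\<close>

definition ca where "ca j = (if j < H then c0 else 1)"
definition sa where "sa j = (if j < H then s0 else 0)"
definition cb where "cb j = (if 0 < j then c0 else 1)"
definition sb where "sb j = (if 0 < j then s0 else 0)"
definition dg where "dg j = C\<^sup>2 * ca j + S\<^sup>2 * cb j"

text \<open>Conjugation of \<open>maj_a j\<close> by \<open>T\<close> yields \<open>lop j\<close>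
  plus \<open>bop j\<close>, conjugation by the inverse yields \<open>lop j\<close> minus
  \<open>bop j\<close>. The index \<open>Suc j\<close> at \<open>j = H\<close> and the truncated
  \<open>j - 1\<close> at \<open>j = 0\<close> come with coefficient 0.\<close>

definition lop where
  "lop j f c = dg j * maj_a j f c - sa j * C * S * maj_a (Suc j) f c - sb j * C * S * maj_a (j - 1) f c"

definition bop where
  "bop j f c = - C * S * (ca j + cb j) * maj_b j f c + sa j * C\<^sup>2 * maj_b (Suc j) f c + sb j * S\<^sup>2 * maj_b (j - 1) f c"

abbreviation T where "T \<equiv> tm y H"

lemma x01: "0 < y\<^sup>2" "y\<^sup>2 < 1" "(y\<^sup>2)\<^sup>2 < 1"
  using y0 y1 by (auto simp: power_less_one_iff)

lemma CS: "C\<^sup>2 - S\<^sup>2 = 1"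
  unfolding C_def S_def using y0 by (simp add: field_simps power2_eq_square)

lemma cs0: "c0\<^sup>2 - s0\<^sup>2 = 1"
proof -
  define d where "d = 1 - (y\<^sup>2)\<^sup>2"
  have d: "d \<noteq> 0" using x01 by (simp add: d_def)
  have "(1 + (y\<^sup>2)\<^sup>2)\<^sup>2 - (2 * y\<^sup>2)\<^sup>2 = d\<^sup>2" unfolding d_def by algebra
  then show ?thesis
    unfolding c0_def s0_def d_def[symmetric] using d by (simp add: power_divide diff_divide_distrib[symmetric])
qed

lemma tm_maj_a:
  assumes "j \<le> H"
  shows "T (maj_a j f) = lincomb 1 (lop j (T f)) 1 (bop j (T f))"
proof -
  let ?D = "diag_op y H" and ?A = "hop (y\<^sup>2) {1..H}"
  have d: "?D (maj_a j f) = lincomb C (maj_a j (?D f)) (- S) (maj_b j (?D f))"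
      "?D (maj_b j f) = lincomb C (maj_b j (?D f)) (- S) (maj_a j (?D f))" if "j \<le> H" for j f
    using diag_op_majorana[OF that y0] by (auto simp: C_def S_def)
  have a: "?A (maj_a j f) = lincomb (ca j) (maj_a j (?A f)) (sa j) (maj_b (Suc j) (?A f))"
      "?A (maj_b j f) = lincomb (cb j) (maj_b j (?A f)) (sb j) (maj_a (j - 1) (?A f))" for f
    using hop_maj_a[OF x01(1,2) assms] hop_maj_b[OF x01(1,2) assms]
    by (auto simp: ca_def sa_def cb_def sb_def c0_def s0_def)
  define G where "G = ?A (?D f)"
  have R: "T f = ?D G" by (simp add: tm_def G_def)
  \<comment> \<open>For \<open>j = H\<close> the rotation rule does not cover \<open>Suc j\<close>,
    but then \<open>sa j\<close> is 0.\<close>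
  have 1: "sa j * ?D (maj_b (Suc j) G) c = sa j * lincomb C (maj_b (Suc j) (?D G)) (- S) (maj_a (Suc j) (?D G)) c" for c
    by (cases "j < H") (auto simp: d sa_def)
  have 2: "?D (maj_a (j - 1) G) c = lincomb C (maj_a (j - 1) (?D G)) (- S) (maj_b (j - 1) (?D G)) c" for c
    using assms by (subst d) auto
  show ?thesis
  proof
    fix c
    have "T (maj_a j f) c = C * (ca j * ?D (maj_a j G) c + sa j * ?D (maj_b (Suc j) G) c)
        - S * (cb j * ?D (maj_b j G) c + sb j * ?D (maj_a (j - 1) G) c)"
      unfolding tm_def d(1)[OF assms] lincomb_linear a G_def[symmetric] by (simp add: lincomb_def)
    also have "\<dots> = lincomb 1 (lop j (T f)) 1 (bop j (T f)) c"
      unfolding 1 2 d[OF assms] R lincomb_def lop_def bop_def dg_def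
      by (simp add: algebra_simps power2_eq_square)
    finally show "T (maj_a j f) c = lincomb 1 (lop j (T f)) 1 (bop j (T f)) c" .
  qed
qed

text \<open>Conjugation by the inverse of \<open>T\<close>, phrased with \<open>T\<close> on the
  outside. Each factor acts by hyperbolic rotations, which are inverted by means of
  \<open>CS\<close> and \<open>cs0\<close>.\<close>

lemma maj_a_tm:
  assumes "j \<le> H"
  shows "maj_a j (T f) = T (lincomb 1 (lop j f) (- 1) (bop j f))"
proof -
  let ?D = "diag_op y H" and ?A = "hop (y\<^sup>2) {1..H}"
  have d: "?D (maj_a j f) = lincomb C (maj_a j (?D f)) (- S) (maj_b j (?D f))"
      "?D (maj_b j f) = lincomb C (maj_b j (?D f)) (- S) (maj_a j (?D f))" if "j \<le> H" for j f
    using diag_op_majorana[OF that y0] by (auto simp: C_def S_def)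
  have a: "?A (maj_a j f) = lincomb (ca j) (maj_a j (?A f)) (sa j) (maj_b (Suc j) (?A f))"
      "?A (maj_b j f) = lincomb (cb j) (maj_b j (?A f)) (sb j) (maj_a (j - 1) (?A f))" if "j \<le> H" for f j
    using hop_maj_a[OF x01(1,2) that] hop_maj_b[OF x01(1,2) that]
    by (auto simp: ca_def sa_def cb_def sb_def c0_def s0_def)
  have d1: "maj_a j (?D f) c = C * ?D (maj_a j f) c + S * ?D (maj_b j f) c"
      "maj_b j (?D f) c = C * ?D (maj_b j f) c + S * ?D (maj_a j f) c" if "j \<le> H" for j f c
  proof -
    have "C * (C * u - S * v) + S * (C * v - S * u) = u" for u v
      using CS by algebra
    then show "maj_a j (?D f) c = C * ?D (maj_a j f) c + S * ?D (maj_b j f) c"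
      "maj_b j (?D f) c = C * ?D (maj_b j f) c + S * ?D (maj_a j f) c"
      unfolding d[OF that] lincomb_def by simp_all
  qed
  have ainv: "maj_a j (?A f) c = ca j * ?A (maj_a j f) c - sa j * ?A (maj_b (Suc j) f) c" for f c
  proof (cases "j < H")
    case True
    have "c0 * (c0 * u + s0 * v) - s0 * (c0 * v + s0 * u) = u" for u v
      using cs0 by algebra
    then show ?thesis
      using True unfolding a(1)[OF assms] a(2)[OF Suc_leI[OF True]] lincomb_def
      by (simp add: ca_def sa_def cb_def sb_def)
  next
    case False
    then show ?thesis unfolding a(1)[OF assms] lincomb_def by (simp add: ca_def sa_def)
  qed
  have binv: "maj_b j (?A f) c = cb j * ?A (maj_b j f) c - sb j * ?A (maj_a (j - 1) f) c" for f c
  proof (cases "0 < j")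
    case True
    have "c0 * (c0 * u + s0 * v) - s0 * (c0 * v + s0 * u) = u" for u v
      using cs0 by algebra
    moreover have j: "j - 1 < H" "Suc (j - 1) = j" "j - 1 \<le> H" using True assms by auto
    ultimately show ?thesis
      using True unfolding a(2)[OF assms] a(1)[OF j(3)] j(2) lincomb_def
      by (simp add: j ca_def sa_def cb_def sb_def)
  next
    case False
    then show ?thesis unfolding a(2)[OF assms] lincomb_def by (simp add: cb_def sb_def)
  qed
  have 1: "sa j * maj_b (Suc j) (?D f) c = sa j * (C * ?D (maj_b (Suc j) f) c + S * ?D (maj_a (Suc j) f) c)" for c
    by (cases "j < H") (auto simp: d1 sa_def)
  have 2: "maj_a (j - 1) (?D f) c = C * ?D (maj_a (j - 1) f) c + S * ?D (maj_b (j - 1) f) c" for c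
    using assms by (subst d1) auto
  define g where "g = lincomb C (lincomb (ca j) (maj_a j (?D f)) (- sa j) (maj_b (Suc j) (?D f)))
      S (lincomb (cb j) (maj_b j (?D f)) (- sb j) (maj_a (j - 1) (?D f)))"
  have "?D (lincomb 1 (lop j f) (- 1) (bop j f)) c = g c" for c
  proof -
    have D: "?D h c = y ^ walls H c * h c" for h by (simp add: diag_op_def)
    have 3: "g c = C * (ca j * maj_a j (?D f) c - sa j * maj_b (Suc j) (?D f) c)
        + S * (cb j * maj_b j (?D f) c - sb j * maj_a (j - 1) (?D f) c)"
      by (simp add: g_def lincomb_def)
    show ?thesis
      unfolding 3 1 2 d1[OF assms] unfolding D lincomb_def lop_def bop_def dg_def
      by (simp add: algebra_simps power2_eq_square)
  qed
  then have g: "?D (lincomb 1 (lop j f) (- 1) (bop j f)) = g" ..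
  have "?A g c = C * maj_a j (?A (?D f)) c + S * maj_b j (?A (?D f)) c" for c
    unfolding ainv binv g_def lincomb_linear lincomb_def by (simp add: algebra_simps)
  then have "?A g = lincomb C (maj_a j (?A (?D f))) S (maj_b j (?A (?D f)))"
    by (auto simp: lincomb_def)
  then have "T (lincomb 1 (lop j f) (- 1) (bop j f)) c = C * ?D (maj_a j (?A (?D f))) c + S * ?D (maj_b j (?A (?D f))) c" for c
    unfolding tm_def g by (simp add: lincomb_linear) (simp add: lincomb_def)
  then show ?thesis
    unfolding tm_def[of y H f] using d1[OF assms] by auto
qed

end

section \<open>Inner product on columns: self-adjointness, positivity, orthogonality\<close>

definition ip :: "nat \<Rightarrow> (nat set \<Rightarrow> real) \<Rightarrow> (nat set \<Rightarrow> real) \<Rightarrow> real" where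
  "ip H f g = (\<Sum>c\<in>Pow {..Suc H}. f c * g c)"

lemma ip_commute: "ip H f g = ip H g f"
  by (simp add: ip_def mult.commute)

lemma ip_lincomb: "ip H f (lincomb a g b h) = a * ip H f g + b * ip H f h" "ip H (lincomb a g b h) f = a * ip H g f + b * ip H h f"
  by (simp_all add: ip_def lincomb_def sum.distrib sum_distrib_left algebra_simps)

lemma ip_nonneg: "ip H f f \<ge> 0"
  unfolding ip_def by (intro sum_nonneg) auto

lemma ip_diag_op: "ip H f (diag_op y K g) = ip H (diag_op y K f) g"
  by (simp add: ip_def diag_op_def mult_ac)

lemma ip_translate:
  "d \<subseteq> {..Suc H} \<Longrightarrow> ip H (\<lambda>c. f (sd c d)) (\<lambda>c. g (sd c d)) = ip H f g"
  unfolding ip_def by (rule sum_Pow_sd)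

lemma ip_hop: "S \<subseteq> {..Suc H} \<Longrightarrow> ip H f (hop x S g) = ip H (hop x S f) g"
proof -
  assume S: "S \<subseteq> {..Suc H}"
  have "ip H f (hop x S g) = (\<Sum>d\<in>Pow S. x ^ card d * ip H f (\<lambda>c. g (sd c d)))"
    unfolding ip_def hop_def sum_distrib_left by (subst sum.swap) (simp add: mult_ac)
  also have "\<dots> = (\<Sum>d\<in>Pow S. x ^ card d * ip H (\<lambda>c. f (sd c d)) g)"
  proof (intro sum.cong refl)
    fix d assume "d \<in> Pow S"
    then have "d \<subseteq> {..Suc H}" using S by auto
    from ip_translate[OF this, of "\<lambda>c. f (sd c d)" g]
    show "x ^ card d * ip H f (\<lambda>c. g (sd c d)) = x ^ card d * ip H (\<lambda>c. f (sd c d)) g" by simp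
  qed
  also have "\<dots> = ip H (hop x S f) g"
    unfolding ip_def hop_def sum_distrib_left sum_distrib_right by (subst sum.swap) (simp add: mult_ac)
  finally show ?thesis .
qed

lemma ip_tm: "ip H f (tm y H g) = ip H (tm y H f) g"
  unfolding tm_def ip_diag_op by (subst ip_hop) (auto simp: ip_diag_op)

text \<open>A factor 1 + x X with X a self-adjoint involution is positive for x < 1. In the
  induction the hypothesis is applied to f + X f and to f - X f, which bounds the cross term by the
  diagonal one.\<close>

lemma ip_hop_nonneg:
  assumes "finite S" "S \<subseteq> {..Suc H}" "0 < x" "x < 1"
  shows "ip H f (hop x S f) \<ge> 0"
  using assms(1,2)
proof (induction S arbitrary: f rule: finite_induct)
  case empty
  then show ?case using ip_nonneg[of H f] by (simp add: hop_def)
next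
  case (insert a S)
  define g where "g = (\<lambda>c. f (sd c {a}))"
  have S: "S \<subseteq> {..Suc H}" using insert.prems by auto
  have gg: "ip H g (hop x S g) = ip H f (hop x S f)"
  proof -
    have "hop x S g = (\<lambda>c. hop x S f (sd c {a}))" unfolding g_def by (auto simp: hop_translate)
    then show ?thesis unfolding g_def using insert.prems by (simp add: ip_translate)
  qed
  have fg: "ip H g (hop x S f) = ip H f (hop x S g)"
    using ip_hop[OF S, of g x f] ip_commute[of H "hop x S g" f] by simp
  have 1: "ip H f (hop x S f) + ip H f (hop x S g) \<ge> 0"
    using insert.IH[OF S, of "lincomb 1 f 1 g"] by (simp add: lincomb_linear ip_lincomb gg fg)
  have 2: "ip H f (hop x S f) - ip H f (hop x S g) \<ge> 0"
    using insert.IH[OF S, of "lincomb 1 f (-1) g"] by (simp add: lincomb_linear ip_lincomb gg fg)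
  have "hop x (insert a S) f = lincomb 1 (hop x S f) x (hop x S g)"
    unfolding g_def by (auto simp: hop_insert[OF insert.hyps] lincomb_def hop_translate)
  then have "ip H f (hop x (insert a S) f) = ip H f (hop x S f) + x * ip H f (hop x S g)"
    by (simp add: ip_lincomb)
  moreover have "x * ip H f (hop x S g) \<ge> - ip H f (hop x S f)"
  proof (cases "ip H f (hop x S g) \<ge> 0")
    case True
    then show ?thesis using 1 2 assms by (smt (verit) mult_nonneg_nonneg)
  next
    case False
    then have "x * ip H f (hop x S g) \<ge> 1 * ip H f (hop x S g)"
      using assms by (intro mult_right_mono_neg) auto
    then show ?thesis using 1 by simp
  qed
  ultimately show ?case by simp
qed

text \<open>Stated for a bare quadratic, as it has to yield Cauchy-Schwarz both for
  \<open>ip\<close> and for the semidefinite form given by the transfer matrix.\<close>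

lemma quadratic_discriminant_le:
  fixes a b c :: real
  assumes "\<And>s. a + 2 * b * s + c * s * s \<ge> 0"
  shows "b * b \<le> a * c"
proof (cases "c = 0")
  case True
  have "b = 0"
  proof (rule ccontr)
    assume "b \<noteq> 0"
    then show False using assms[of "- (a + 1) / (2 * b)"] True by (simp add: field_simps)
  qed
  then show ?thesis using True by simp
next
  case False
  have "c \<ge> 0"
  proof (rule ccontr)
    assume "\<not> c \<ge> 0"
    then have c: "c < 0" by simp
    define s where "s = (\<bar>a\<bar> + 2 * \<bar>b\<bar> + 1) / (- c) + 1"
    have s1: "s \<ge> 1" using c by (auto simp: s_def divide_le_0_iff)
    have "(- c) * s \<ge> \<bar>a\<bar> + 2 * \<bar>b\<bar> + 1" using c by (simp add: s_def field_simps)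
    then have "(- c) * s * s \<ge> (\<bar>a\<bar> + 2 * \<bar>b\<bar> + 1) * s" using s1 by (intro mult_right_mono) auto
    then have "\<bar>a\<bar> * s + 2 * \<bar>b\<bar> * s + s + c * s * s \<le> 0" by (simp add: algebra_simps)
    moreover have "\<bar>a\<bar> * s \<ge> a" using s1 mult_left_mono[of 1 s "\<bar>a\<bar>"] by simp
    moreover have "2 * \<bar>b\<bar> * s \<ge> 2 * b * s" using s1 by (intro mult_right_mono) auto
    ultimately show False using assms[of s] s1 by linarith
  qed
  then have c: "c > 0" using False by simp
  have "0 \<le> c * (a + 2 * b * (- b / c) + c * (- b / c) * (- b / c))"
    using assms[of "- b / c"] c by simp
  also have "\<dots> = a * c - b * b" using c by (simp add: field_simps)
  finally show ?thesis by simp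
qed

lemma ip_Cauchy_Schwarz: "ip H f g * ip H f g \<le> ip H f f * ip H g g"
proof (rule quadratic_discriminant_le)
  fix s
  show "0 \<le> ip H f f + 2 * ip H f g * s + ip H g g * s * s"
    using ip_nonneg[of H "lincomb 1 f s g"] ip_commute[of H g f] by (simp add: ip_lincomb algebra_simps)
qed

text \<open>For i < j, flipping rows i + 1 to j exchanges the two strings and reverses the spin in
  row \<open>Suc i\<close> but not that in row \<open>Suc j\<close>, so the summands cancel in
  pairs.\<close>

lemma ip_maj_a_maj_a:
  assumes "i \<le> H" "j \<le> H"
  shows "ip H (maj_a i f) (maj_a j f) = (if i = j then ip H f f else 0)"
proof -
  have *: "ip H (maj_a i f) (maj_a j f) = 0" if ij: "i < j" "j \<le> H" for i j
  proof -
    define d where "d = sd {..i} {..j}"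
    define h where "h = (\<lambda>c. maj_a i f c * maj_a j f c)"
    have d: "d \<subseteq> {..Suc H}" using ij by (auto simp: d_def)
    have 1: "sd (sd c d) {..i} = sd c {..j}" "sd (sd c d) {..j} = sd c {..i}" for c
      by (auto simp: d_def)
    have 2: "zs (Suc i) (sd c d) = - zs (Suc i) c" "zs (Suc j) (sd c d) = zs (Suc j) c" for c
      using ij by (auto simp: d_def zs_def)
    have "h (sd c d) = - h c" for c by (simp add: h_def maj_a_def 1 2)
    then have "(\<Sum>c\<in>Pow {..Suc H}. h c) = - (\<Sum>c\<in>Pow {..Suc H}. h c)"
      using sum_Pow_sd[OF d, of h] by (simp add: sum_negf)
    then show ?thesis by (simp add: ip_def h_def)
  qed
  have "ip H (maj_a i f) (maj_a i f) = ip H f f"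
  proof -
    have "ip H (maj_a i f) (maj_a i f) = ip H (\<lambda>c. f (sd c {..i})) (\<lambda>c. f (sd c {..i}))"
      unfolding ip_def maj_a_def by (intro sum.cong) (simp_all add: zs_def)
    then show ?thesis using assms by (simp add: ip_translate subset_eq)
  qed
  then show ?thesis using *[of i j] *[of j i] assms ip_commute
    by (metis linorder_neqE_nat)
qed

section \<open>Matrix entries: column sums, FKG, Perron eigenvalues\<close>

context ising_transfer
begin

definition outer :: "nat set \<Rightarrow> nat set" where "outer c = c - {1..H}"

(* Since \<open>T\<close> preserves the boundary rows \<open>outer a\<close>, it is block diagonal with one positive block per
   boundary condition; \<open>kern\<close> is the weight of a step. *)
definition kern :: "nat set \<Rightarrow> nat set \<Rightarrow> real" where
  "kern a e = y ^ walls H a * (y\<^sup>2) ^ card (sd (a \<inter> {1..H}) e) * y ^ walls H (outer a \<union> e)"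

definition entry :: "nat \<Rightarrow> nat set \<Rightarrow> nat set \<Rightarrow> real" where
  "entry n a b = (T ^^ n) (\<lambda>c. of_bool (c = b)) a"

lemma outer_Un: "e \<subseteq> {1..H} \<Longrightarrow> outer (outer a \<union> e) = outer a" "e \<subseteq> {1..H} \<Longrightarrow> (outer a \<union> e) \<inter> {1..H} = e"
  "outer a \<union> (a \<inter> {1..H}) = a"
  by (auto simp: outer_def)

lemma tm_kern: "T f a = (\<Sum>e\<in>Pow {1..H}. kern a e * f (outer a \<union> e))"
proof -
  have "T f a = (\<Sum>d\<in>Pow {1..H}. y ^ walls H a * (y\<^sup>2) ^ card d * y ^ walls H (sd a d) * f (sd a d))"
    unfolding tm_def diag_op_def hop_def sum_distrib_left by (simp add: mult_ac)
  also have "\<dots> = (\<Sum>e\<in>Pow {1..H}. kern a e * f (outer a \<union> e))"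
  proof (rule sum.reindex_bij_witness[where i = "\<lambda>e. sd (a \<inter> {1..H}) e" and j = "\<lambda>d. sd (a \<inter> {1..H}) d"])
    fix d assume "d \<in> Pow {1..H}"
    then have "sd a d = outer a \<union> sd (a \<inter> {1..H}) d" by (auto simp: outer_def)
    moreover have "sd (a \<inter> {1..H}) (sd (a \<inter> {1..H}) d) = d" by auto
    ultimately show "kern a (sd (a \<inter> {1..H}) d) * f (outer a \<union> sd (a \<inter> {1..H}) d)
        = y ^ walls H a * (y\<^sup>2) ^ card d * y ^ walls H (sd a d) * f (sd a d)"
      by (simp add: kern_def)
  qed auto
  finally show ?thesis .
qed

lemma card_sd_submodular:
  assumes "p \<subseteq> V" "p' \<subseteq> V" "e \<subseteq> V" "e' \<subseteq> V" "finite V"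
  shows "card (sd (p \<union> p') (e \<union> e')) + card (sd (p \<inter> p') (e \<inter> e')) \<le> card (sd p e) + card (sd p' e')"
proof -
  have c: "card (sd p e) = (\<Sum>i\<in>V. of_bool ((i \<in> p) \<noteq> (i \<in> e)))" if "p \<subseteq> V" "e \<subseteq> V" for p e
  proof -
    have "sd p e = V \<inter> {i. (i \<in> p) \<noteq> (i \<in> e)}" using that by auto
    then show ?thesis using assms(5) by (simp add: sum_of_bool_eq)
  qed
  have "card (sd (p \<union> p') (e \<union> e')) = (\<Sum>i\<in>V. of_bool ((i \<in> p \<union> p') \<noteq> (i \<in> e \<union> e')))"
    "card (sd (p \<inter> p') (e \<inter> e')) = (\<Sum>i\<in>V. of_bool ((i \<in> p \<inter> p') \<noteq> (i \<in> e \<inter> e')))"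
    by (rule c; use assms in auto)+
  then show ?thesis
    unfolding c[OF assms(1,3)] c[OF assms(2,4)]
    by (simp only: sum.distrib[symmetric]) (rule sum_mono, auto)
qed

lemma pow_walls_submodular:
  "y ^ walls H a * y ^ walls H b \<le> y ^ walls H (a \<union> b) * y ^ walls H (a \<inter> b)"
  unfolding walls_def by (rule power_cut_submodular) (use y0 y1 in auto)

lemma kern_pos: "kern a e > 0"
  unfolding kern_def using y0 by simp

lemma kern_submodular:
  assumes "e \<subseteq> {1..H}" "e' \<subseteq> {1..H}"
  shows "kern a e * kern a' e' \<le> kern (a \<union> a') (e \<union> e') * kern (a \<inter> a') (e \<inter> e')"
proof -
  let ?I = "{1..H}"
  have 1: "(y\<^sup>2) ^ card (sd (a \<inter> ?I) e) * (y\<^sup>2) ^ card (sd (a' \<inter> ?I) e')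
    \<le> (y\<^sup>2) ^ card (sd ((a \<union> a') \<inter> ?I) (e \<union> e')) * (y\<^sup>2) ^ card (sd ((a \<inter> a') \<inter> ?I) (e \<inter> e'))"
  proof -
    have "card (sd ((a \<union> a') \<inter> ?I) (e \<union> e')) + card (sd ((a \<inter> a') \<inter> ?I) (e \<inter> e'))
      \<le> card (sd (a \<inter> ?I) e) + card (sd (a' \<inter> ?I) e')"
      using card_sd_submodular[of "a \<inter> ?I" ?I "a' \<inter> ?I" e e'] assms
      by (simp add: Int_Un_distrib2 Int_ac)
    then show ?thesis
      unfolding power_add[symmetric] by (rule power_decreasing) (use x01 in auto)
  qed
  have b: "outer (a \<union> a') \<union> (e \<union> e') = (outer a \<union> e) \<union> (outer a' \<union> e')"
    "outer (a \<inter> a') \<union> (e \<inter> e') = (outer a \<union> e) \<inter> (outer a' \<union> e')"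
    using assms by (auto simp: outer_def)
  have "kern a e * kern a' e' =
      (y ^ walls H a * y ^ walls H a') * ((y\<^sup>2) ^ card (sd (a \<inter> ?I) e) * (y\<^sup>2) ^ card (sd (a' \<inter> ?I) e'))
        * (y ^ walls H (outer a \<union> e) * y ^ walls H (outer a' \<union> e'))"
    unfolding kern_def by (simp only: mult_ac)
  also have "\<dots> \<le> (y ^ walls H (a \<union> a') * y ^ walls H (a \<inter> a'))
      * ((y\<^sup>2) ^ card (sd ((a \<union> a') \<inter> ?I) (e \<union> e')) * (y\<^sup>2) ^ card (sd ((a \<inter> a') \<inter> ?I) (e \<inter> e')))
        * (y ^ walls H (outer (a \<union> a') \<union> (e \<union> e')) * y ^ walls H (outer (a \<inter> a') \<union> (e \<inter> e')))"
    unfolding b using y0 by (intro mult_mono pow_walls_submodular 1 mult_nonneg_nonneg zero_le_power) auto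
  also have "\<dots> = kern (a \<union> a') (e \<union> e') * kern (a \<inter> a') (e \<inter> e')"
    unfolding kern_def by (simp only: mult_ac)
  finally show ?thesis .
qed

lemma tm_pow_nonneg: "(\<And>c. f c \<ge> 0) \<Longrightarrow> (T ^^ n) f c \<ge> 0"
proof (induction n arbitrary: c)
  case (Suc n)
  then show ?case
    by (auto simp: tm_kern intro!: sum_nonneg mult_nonneg_nonneg less_imp_le[OF kern_pos])
qed simp

lemma entry_nonneg: "entry n a b \<ge> 0"
  unfolding entry_def by (rule tm_pow_nonneg) auto

lemma entry_0: "entry 0 a b = of_bool (a = b)"
  by (simp add: entry_def)

lemma entry_Suc: "entry (Suc n) a b = (\<Sum>e\<in>Pow {1..H}. kern a e * entry n (outer a \<union> e) b)"
  by (simp add: entry_def tm_kern)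

text \<open>The column next to \<open>a\<close> is summed out by \<open>four_functions\<close>; the
  lattice condition it asks for combines \<open>kern_submodular\<close> with the induction
  hypothesis for the remaining columns.\<close>

lemma entry_submodular:
  "entry n a b * entry n a' b' \<le> entry n (a \<union> a') (b \<union> b') * entry n (a \<inter> a') (b \<inter> b')"
proof (induction n arbitrary: a a')
  case 0
  then show ?case by (auto simp: entry_0)
next
  case (Suc n)
  show ?case unfolding entry_Suc
  proof (rule four_functions)
    fix e e' assume e: "e \<subseteq> {1..H}" "e' \<subseteq> {1..H}"
    have u: "outer (a \<union> a') \<union> (e \<union> e') = (outer a \<union> e) \<union> (outer a' \<union> e')"
      "outer (a \<inter> a') \<union> (e \<inter> e') = (outer a \<union> e) \<inter> (outer a' \<union> e')"
      using e by (auto simp: outer_def)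
    have "(kern a e * kern a' e') * (entry n (outer a \<union> e) b * entry n (outer a' \<union> e') b')
      \<le> (kern (a \<union> a') (e \<union> e') * kern (a \<inter> a') (e \<inter> e')) *
        (entry n ((outer a \<union> e) \<union> (outer a' \<union> e')) (b \<union> b') * entry n ((outer a \<union> e) \<inter> (outer a' \<union> e')) (b \<inter> b'))"
      by (intro mult_mono kern_submodular Suc.IH e mult_nonneg_nonneg entry_nonneg less_imp_le[OF kern_pos])
    then show "kern a e * entry n (outer a \<union> e) b * (kern a' e' * entry n (outer a' \<union> e') b')
      \<le> kern (a \<union> a') (e \<union> e') * entry n (outer (a \<union> a') \<union> (e \<union> e')) (b \<union> b') *
        (kern (a \<inter> a') (e \<inter> e') * entry n (outer (a \<inter> a') \<union> (e \<inter> e')) (b \<inter> b'))"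
      unfolding u by (simp only: mult_ac)
  qed (auto intro!: mult_nonneg_nonneg entry_nonneg less_imp_le[OF kern_pos])
qed

lemma tm_pow_eq: "(T ^^ m) f a = (\<Sum>e\<in>Pow {1..H}. entry m a (outer a \<union> e) * f (outer a \<union> e))"
proof (induction m arbitrary: a)
  case 0
  have "(\<Sum>e\<in>Pow {1..H}. entry 0 a (outer a \<union> e) * f (outer a \<union> e))
    = (\<Sum>e\<in>Pow {1..H}. if e = a \<inter> {1..H} then f a else 0)"
    by (intro sum.cong) (auto simp: entry_0 outer_def)
  then show ?case by (simp add: sum.delta)
next
  case (Suc m)
  have "(T ^^ Suc m) f a = (\<Sum>e\<in>Pow {1..H}. kern a e * (T ^^ m) f (outer a \<union> e))"
    by (simp add: tm_kern)
  also have "\<dots> = (\<Sum>e\<in>Pow {1..H}. \<Sum>e'\<in>Pow {1..H}. kern a e * (entry m (outer a \<union> e) (outer a \<union> e') * f (outer a \<union> e')))"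
    unfolding sum_distrib_left[symmetric] using Suc by (intro sum.cong) (simp_all add: outer_Un)
  also have "\<dots> = (\<Sum>e'\<in>Pow {1..H}. entry (Suc m) a (outer a \<union> e') * f (outer a \<union> e'))"
    unfolding entry_Suc by (subst sum.swap) (simp add: sum_distrib_left sum_distrib_right mult_ac)
  finally show ?case .
qed

lemma entry_add: "entry (m + n) a b = (\<Sum>e\<in>Pow {1..H}. entry m a (outer a \<union> e) * entry n (outer a \<union> e) b)"
proof -
  have "entry (m + n) a b = (T ^^ m) ((T ^^ n) (\<lambda>c. of_bool (c = b))) a"
    by (simp add: entry_def funpow_add)
  also have "\<dots> = (\<Sum>e\<in>Pow {1..H}. entry m a (outer a \<union> e) * (T ^^ n) (\<lambda>c. of_bool (c = b)) (outer a \<union> e))"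
    by (rule tm_pow_eq)
  finally show ?thesis unfolding entry_def[of n] .
qed

lemma ip_tm_pow: "ip H f ((T ^^ n) g) = ip H ((T ^^ n) f) g"
proof (induction n arbitrary: g)
  case (Suc n)
  have "ip H f ((T ^^ Suc n) g) = ip H f ((T ^^ n) (T g))" by (simp add: funpow_swap1)
  then show ?case by (simp add: Suc ip_tm)
qed simp

lemma entry_flip: "entry n (sd a {..Suc H}) (sd b {..Suc H}) = entry n a b"
proof -
  let ?F = "\<lambda>f :: nat set \<Rightarrow> real. \<lambda>c. f (sd c {..Suc H})"
  have bn: "walls H (sd c {..Suc H}) = walls H c" for c
    unfolding walls_eq by (rule sum.cong) auto
  have T: "T (?F f) = ?F (T f)" for f
    unfolding tm_def diag_op_def hop_def by (auto simp: fun_eq_iff bn sd_left)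
  have P: "(T ^^ n) (?F f) = ?F ((T ^^ n) f)" for f
    by (induction n) (simp_all add: T)
  have i: "sd c {..Suc H} = sd b {..Suc H} \<longleftrightarrow> c = b" for c
    by (metis sd_sd)
  show ?thesis
    using fun_cong[OF P[of "\<lambda>c. of_bool (c = sd b {..Suc H})"], of a] by (simp add: entry_def i)
qed

lemma outer_0 [simp]: "outer {0} = {0}" "outer {} = {}"
  by (auto simp: outer_def)

text \<open>The boundary state \<open>{0}\<close> and its global flip \<open>?q\<close> have the
  all-minus state as union and the all-plus state as intersection. By flip symmetry, submodularity
  becomes an inequality between squares.\<close>

lemma entry_le_1: "entry n {0} {0} \<le> entry n {} {}"
proof -
  let ?F = "{..Suc H}" and ?q = "sd {0} {..Suc H}"
  have u: "{0} \<union> ?q = ?F" "{0} \<inter> ?q = {}" "sd ?F ?F = {}" by auto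
  have "entry n {0} {0} * entry n ?q ?q \<le> entry n ?F ?F * entry n {} {}"
    using entry_submodular[of n "{0}" "{0}" ?q ?q] u by simp
  then have "entry n {0} {0} * entry n {0} {0} \<le> entry n {} {} * entry n {} {}"
    using entry_flip[of n ?F ?F] u by (simp add: entry_flip)
  then show ?thesis using entry_nonneg[of n "{}" "{}"]
    by (metis power2_eq_square power2_le_imp_le)
qed

text \<open>Supermultiplicativity under doubling of the quotient of the \<open>{0}\<close> entry by
  the \<open>{}\<close> entry. Both long entries are split at the middle column, and on each half
  \<open>entry_submodular\<close> compares \<open>e\<close> with
  \<open>{0} \<union> e\<close>.\<close>

lemma entry_double:
  "entry (n + n) {} {} * (entry n {0} {0} * entry n {0} {0}) \<le> entry (n + n) {0} {0} * (entry n {} {} * entry n {} {})"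
proof -
  have "entry n {} e * entry n e {} * (entry n {0} {0} * entry n {0} {0})
    \<le> entry n {0} ({0} \<union> e) * entry n ({0} \<union> e) {0} * (entry n {} {} * entry n {} {})" if "e \<in> Pow {1..H}" for e
  proof -
    have i: "{0} \<inter> e = {}" using that by auto
    have "entry n {0} {0} * entry n {} e \<le> entry n {0} ({0} \<union> e) * entry n {} {}"
      using entry_submodular[of n "{0}" "{0}" "{}" e] i by simp
    moreover have "entry n {0} {0} * entry n e {} \<le> entry n ({0} \<union> e) {0} * entry n {} {}"
      using entry_submodular[of n "{0}" "{0}" e "{}"] i by simp
    ultimately have "(entry n {0} {0} * entry n {} e) * (entry n {0} {0} * entry n e {})
      \<le> (entry n {0} ({0} \<union> e) * entry n {} {}) * (entry n ({0} \<union> e) {0} * entry n {} {})"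
      by (rule mult_mono) (intro mult_nonneg_nonneg entry_nonneg)+
    then show ?thesis by (simp only: mult_ac)
  qed
  then have "(\<Sum>e\<in>Pow {1..H}. entry n {} e * entry n e {} * (entry n {0} {0} * entry n {0} {0}))
    \<le> (\<Sum>e\<in>Pow {1..H}. entry n {0} ({0} \<union> e) * entry n ({0} \<union> e) {0} * (entry n {} {} * entry n {} {}))"
    by (rule sum_mono)
  then show ?thesis
    unfolding entry_add[of n n "{}" "{}"] entry_add[of n n "{0}" "{0}"] sum_distrib_right outer_0 Un_empty_left .
qed

text \<open>The Perron vector of the block with boundary rows \<open>a0\<close>, extended by 0 to
  all columns. Its support is part of the conclusion because later signs and overlaps are read off
  from it.\<close>

lemma sector_eigenvector:
  assumes a0: "a0 \<inter> {1..H} = {}"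
  obtains \<psi> \<Lambda> where "\<Lambda> > 0" "\<And>c. \<psi> c \<ge> 0" "\<And>c. \<psi> c > 0 \<longleftrightarrow> outer c = a0" "T \<psi> = (\<lambda>c. \<Lambda> * \<psi> c)"
proof -
  define K where "K = (\<lambda>e e'. y ^ walls H (a0 \<union> e) * (y\<^sup>2) ^ card (sd e e') * y ^ walls H (a0 \<union> e'))"
  obtain \<phi> \<Lambda> where \<phi>: "\<Lambda> > 0" "\<And>e. e \<in> Pow {1..H} \<Longrightarrow> \<phi> e > 0" "\<And>e. e \<notin> Pow {1..H} \<Longrightarrow> \<phi> e = 0"
    "\<And>e. e \<in> Pow {1..H} \<Longrightarrow> (\<Sum>e'\<in>Pow {1..H}. K e e' * \<phi> e') = \<Lambda> * \<phi> e"
  proof (rule symmetric_positive_eigenvector[of "Pow {1..H}" K])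
    show "K i j = K j i" for i j by (simp add: K_def sd_commute mult_ac)
    show "K i j > 0" for i j using y0 by (simp add: K_def)
  qed (auto intro: that)
  define \<psi> where "\<psi> = (\<lambda>c. if outer c = a0 then \<phi> (c \<inter> {1..H}) else 0)"
  show ?thesis
  proof (rule that)
    show "\<Lambda> > 0" by (rule \<phi>)
    show "\<psi> c \<ge> 0" for c using \<phi>(2)[of "c \<inter> {1..H}"] by (auto simp: \<psi>_def)
    show "\<psi> c > 0 \<longleftrightarrow> outer c = a0" for c using \<phi>(2)[of "c \<inter> {1..H}"] by (auto simp: \<psi>_def)
    show "T \<psi> = (\<lambda>c. \<Lambda> * \<psi> c)"
    proof
      fix c
      show "T \<psi> c = \<Lambda> * \<psi> c"
      proof (cases "outer c = a0")
        case True
        have c: "a0 \<union> (c \<inter> {1..H}) = c" using outer_Un(3)[of c] True by simp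
        have "T \<psi> c = (\<Sum>e\<in>Pow {1..H}. K (c \<inter> {1..H}) e * \<phi> e)"
          unfolding tm_kern
        proof (rule sum.cong)
          fix e assume "e \<in> Pow {1..H}"
          then have "e \<subseteq> {1..H}" by auto
          note b = outer_Un(1,2)[OF this, of c]
          show "kern c e * \<psi> (outer c \<union> e) = K (c \<inter> {1..H}) e * \<phi> e"
            unfolding \<psi>_def b using True c by (simp add: kern_def K_def)
        qed simp
        then show ?thesis using \<phi>(4) True by (simp add: \<psi>_def)
      next
        case False
        have "\<psi> (outer c \<union> e) = 0" if "e \<in> Pow {1..H}" for e
          using that False outer_Un(1)[of e c] by (simp add: \<psi>_def)
        then show ?thesis unfolding tm_kern using False by (simp add: \<psi>_def)
      qed
    qed
  qed
qed

lemma tm_pow_eigen: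
  assumes "T \<psi> = (\<lambda>c. \<Lambda> * \<psi> c)"
  shows "(T ^^ n) \<psi> c = \<Lambda> ^ n * \<psi> c"
proof (induction n arbitrary: c)
  case (Suc n)
  have "T (\<lambda>c. \<Lambda> ^ n * \<psi> c) c = \<Lambda> ^ n * T \<psi> c"
    unfolding tm_kern sum_distrib_left by (simp add: mult_ac)
  moreover have "(T ^^ n) \<psi> = (\<lambda>c. \<Lambda> ^ n * \<psi> c)" using Suc by auto
  ultimately show ?case using assms by simp
qed simp

text \<open>All terms of the eigenvalue equation for the n-th power are nonnegative; one of them is
  kept.\<close>

lemma entry_le_eigenvalue:
  assumes "\<Lambda> > 0" "\<And>c. \<psi> c \<ge> 0" "\<psi> a0 > 0" "T \<psi> = (\<lambda>c. \<Lambda> * \<psi> c)" "a0 \<inter> {1..H} = {}"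
  shows "entry n a0 a0 \<le> \<Lambda> ^ n"
proof -
  have b: "outer a0 = a0" using assms(5) by (auto simp: outer_def)
  have "entry n a0 a0 * \<psi> a0 = entry n a0 (outer a0 \<union> {}) * \<psi> (outer a0 \<union> {})" by (simp add: b)
  also have "\<dots> \<le> (\<Sum>e\<in>Pow {1..H}. entry n a0 (outer a0 \<union> e) * \<psi> (outer a0 \<union> e))"
    by (rule member_le_sum) (auto intro: mult_nonneg_nonneg entry_nonneg assms)
  also have "\<dots> = \<Lambda> ^ n * \<psi> a0"
    unfolding tm_pow_eq[symmetric] by (rule tm_pow_eigen[OF assms(4)])
  finally show ?thesis using assms(3) by simp
qed

text \<open>A lower bound for the weight of one step: each of the two columns has at most
  \<open>Suc H\<close> walls, and at most \<open>H\<close> rows differ, at \<open>y\<^sup>2\<close>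
  each.\<close>

definition \<tau> :: real where "\<tau> = y ^ (4 * H + 2)"

lemma \<tau>_pos: "\<tau> > 0"
  using y0 by (simp add: \<tau>_def)

lemma walls_le: "walls H c \<le> Suc H"
  unfolding walls_def cut_def
  by (rule order.trans[OF card_mono[of "(\<lambda>j. (j, Suc j)) ` {..H}"]]) (auto intro: order.trans[OF card_image_le])

lemma kern_bounds:
  assumes "e \<subseteq> {1..H}"
  shows "\<tau> \<le> kern a e" "kern a e \<le> 1"
proof -
  have s: "sd (a \<inter> {1..H}) e \<subseteq> {1..H}" using assms by auto
  have "card (sd (a \<inter> {1..H}) e) \<le> H" using card_mono[OF _ s] by simp
  then have "walls H a + 2 * card (sd (a \<inter> {1..H}) e) + walls H (outer a \<union> e) \<le> 4 * H + 2"
    using walls_le[of a] walls_le[of "outer a \<union> e"] by linarith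
  then have "\<tau> \<le> y ^ (walls H a + 2 * card (sd (a \<inter> {1..H}) e) + walls H (outer a \<union> e))"
    unfolding \<tau>_def using y0 y1 by (intro power_decreasing) auto
  then show "\<tau> \<le> kern a e" by (simp add: kern_def power_add power_mult)
  show "kern a e \<le> 1" unfolding kern_def using y0 y1
    by (intro mult_le_one power_le_one mult_nonneg_nonneg zero_le_power) auto
qed

lemma entry_1_ge:
  assumes "outer a = outer b"
  shows "\<tau> \<le> entry 1 a b"
proof -
  have b: "outer a \<union> (b \<inter> {1..H}) = b" using assms outer_Un(3)[of b] by simp
  have "\<tau> \<le> kern a (b \<inter> {1..H}) * entry 0 (outer a \<union> (b \<inter> {1..H})) b"
    unfolding b using kern_bounds(1)[of "b \<inter> {1..H}" a] by (simp add: entry_0)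
  also have "\<dots> \<le> (\<Sum>e\<in>Pow {1..H}. kern a e * entry 0 (outer a \<union> e) b)"
    by (rule member_le_sum) (auto intro!: mult_nonneg_nonneg entry_nonneg less_imp_le[OF kern_pos])
  finally show ?thesis unfolding entry_Suc[symmetric] by simp
qed

lemma entry_ge_mult:
  assumes "outer a = outer b"
  shows "entry m a b * entry n b c \<le> entry (m + n) a c"
proof -
  have b: "outer a \<union> (b \<inter> {1..H}) = b" using assms outer_Un(3)[of b] by simp
  have "entry m a b * entry n b c = entry m a (outer a \<union> (b \<inter> {1..H})) * entry n (outer a \<union> (b \<inter> {1..H})) c"
    unfolding b ..
  also have "\<dots> \<le> (\<Sum>e\<in>Pow {1..H}. entry m a (outer a \<union> e) * entry n (outer a \<union> e) c)"
    by (rule member_le_sum) (auto intro!: mult_nonneg_nonneg entry_nonneg)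
  finally show ?thesis unfolding entry_add[symmetric] .
qed

text \<open>The eigenvalue equation sums over all final columns of the block. One more step brings
  each of them back to \<open>a0\<close> with weight at least \<open>\<tau>\<close>, hence
  \<open>Suc n\<close>.\<close>

lemma entry_ge_eigenvalue:
  assumes "\<Lambda> > 0" "\<And>c. \<psi> c > 0 \<longleftrightarrow> outer c = a0" "T \<psi> = (\<lambda>c. \<Lambda> * \<psi> c)" "a0 \<inter> {1..H} = {}"
  obtains \<kappa> where "\<kappa> > 0" "\<And>n. \<kappa> * \<Lambda> ^ n \<le> entry (Suc n) a0 a0"
proof -
  have b: "outer a0 = a0" using assms(4) by (auto simp: outer_def)
  have pos: "\<psi> (a0 \<union> e) > 0" if "e \<in> Pow {1..H}" for e
    using outer_Un(1)[of e a0] that b assms(2) by simp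
  define M where "M = (\<Sum>e\<in>Pow {1..H}. \<psi> (a0 \<union> e))"
  have M: "M > 0" unfolding M_def by (rule sum_pos) (use pos in auto)
  have "\<tau> * \<psi> a0 / M * \<Lambda> ^ n \<le> entry (Suc n) a0 a0" for n
  proof -
    have "\<Lambda> ^ n * \<psi> a0 = (\<Sum>e\<in>Pow {1..H}. entry n a0 (a0 \<union> e) * \<psi> (a0 \<union> e))"
      using tm_pow_eq[of n \<psi> a0] tm_pow_eigen[OF assms(3), of n a0] b by simp
    also have "\<tau> * \<dots> \<le> (\<Sum>e\<in>Pow {1..H}. entry (Suc n) a0 a0 * \<psi> (a0 \<union> e))"
      unfolding sum_distrib_left
    proof (rule sum_mono)
      fix e assume e: "e \<in> Pow {1..H}"
      have bse: "outer (a0 \<union> e) = a0" using outer_Un(1)[of e a0] e b by simp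
      have "entry n a0 (a0 \<union> e) * \<tau> \<le> entry n a0 (a0 \<union> e) * entry 1 (a0 \<union> e) a0"
        by (intro mult_left_mono entry_1_ge entry_nonneg) (simp add: bse b)
      also have "\<dots> \<le> entry (Suc n) a0 a0"
        using entry_ge_mult[of a0 "a0 \<union> e" n 1 a0] bse b by simp
      finally have "entry n a0 (a0 \<union> e) * \<tau> \<le> entry (Suc n) a0 a0" .
      from mult_right_mono[OF this less_imp_le[OF pos[OF e]]]
      show "\<tau> * (entry n a0 (a0 \<union> e) * \<psi> (a0 \<union> e)) \<le> entry (Suc n) a0 a0 * \<psi> (a0 \<union> e)"
        by (simp add: mult_ac)
    qed
    also have "\<dots> = entry (Suc n) a0 a0 * M" by (simp add: M_def sum_distrib_left)
    finally show ?thesis using M by (simp add: field_simps)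
  qed
  moreover have "\<tau> * \<psi> a0 / M > 0" using M \<tau>_pos assms(2) b by simp
  ultimately show ?thesis using that by blast
qed

text \<open>The eigenvalue equation is summed over the \<open>2 ^ H\<close> columns of the block,
  every step having weight at most 1.\<close>

lemma eigenvalue_le:
  assumes "\<And>c. \<psi> c \<ge> 0" "\<psi> a0 > 0" "T \<psi> = (\<lambda>c. \<Lambda> * \<psi> c)" "a0 \<inter> {1..H} = {}"
  shows "\<Lambda> \<le> 2 ^ H"
proof -
  have b: "outer a0 = a0" using assms(4) by (auto simp: outer_def)
  define M where "M = (\<Sum>e\<in>Pow {1..H}. \<psi> (a0 \<union> e))"
  have "M \<ge> \<psi> (a0 \<union> {})" unfolding M_def by (rule member_le_sum) (use assms(1) in auto)
  then have M: "M > 0" using assms(2) by simp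
  have "\<Lambda> * M = (\<Sum>e\<in>Pow {1..H}. T \<psi> (a0 \<union> e))"
    unfolding M_def sum_distrib_left assms(3) ..
  also have "\<dots> \<le> (\<Sum>e\<in>Pow {1..H}. M)"
  proof (rule sum_mono)
    fix e assume e: "e \<in> Pow {1..H}"
    have bse: "outer (a0 \<union> e) = a0" using outer_Un(1)[of e a0] e b by simp
    show "T \<psi> (a0 \<union> e) \<le> M"
      unfolding tm_kern bse M_def
    proof (rule sum_mono)
      fix e' assume "e' \<in> Pow {1..H}"
      then show "kern (a0 \<union> e) e' * \<psi> (a0 \<union> e') \<le> \<psi> (a0 \<union> e')"
        using kern_bounds(2)[of e' "a0 \<union> e"] assms(1) by (simp add: mult_left_le_one_le less_imp_le[OF kern_pos])
    qed
  qed
  also have "\<dots> = 2 ^ H * M" by (simp add: card_Pow)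
  finally show ?thesis using M by simp
qed

section \<open>Decay rate of the entry ratio\<close>

text \<open>For \<open>y\<close> = exp (- beta) this is exp (- 2 beta) coth beta, the exponential of
  minus Onsager's surface tension of a horizontal interface.\<close>

definition \<theta> :: real where "\<theta> = y\<^sup>2 * (1 + y\<^sup>2) / (1 - y\<^sup>2)"

definition Lc :: "(nat \<Rightarrow> real) \<Rightarrow> nat \<Rightarrow> real" where
  "Lc l j = dg j * l j - sa j * C * S * l (Suc j) - sb j * C * S * l (j - 1)"

text \<open>The off-diagonal entries of \<open>Lc\<close> are -1/2 at every temperature. With
  \<open>dg_bulk\<close> this makes the rows of \<open>Lc\<close> away from the ends a constant plus
  half of the nonnegative discrete Laplacian.\<close>

lemma s0CS: "s0 * C * S = 1 / 2"
proof -
  have "C * S = (1 - (y\<^sup>2)\<^sup>2) / (4 * y\<^sup>2)"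
    unfolding C_def S_def using y0 by (simp add: field_simps power2_eq_square)
  then have "s0 * (C * S) = 1 / 2"
    unfolding s0_def using x01 by (simp add: field_simps)
  then show ?thesis by (simp add: mult.assoc)
qed

lemma dg_bulk: "c0 * (C\<^sup>2 + S\<^sup>2) = (\<theta> + 1 / \<theta>) / 2 + 1"
proof -
  define x where "x = y\<^sup>2"
  have x: "0 < x" "x < 1" "x \<noteq> 0" using x01 by (auto simp: x_def)
  have "1 - x\<^sup>2 \<noteq> 0" using x01(3) by (simp add: x_def)
  with x have x2: "1 - x \<noteq> 0" "1 + x \<noteq> 0" "1 - x\<^sup>2 \<noteq> 0" by auto
  have "C\<^sup>2 + S\<^sup>2 = (1 / y\<^sup>2 + y\<^sup>2) / 2"
    unfolding C_def S_def using y0 by (simp add: field_simps power2_eq_square)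
  then have 1: "C\<^sup>2 + S\<^sup>2 = (1 + x\<^sup>2) / (2 * x)" using x by (simp add: x_def field_simps power2_eq_square)
  have d: "(1 - x\<^sup>2) = (1 - x) * (1 + x)" by (simp add: power2_eq_square algebra_simps)
  have "c0 * (C\<^sup>2 + S\<^sup>2) = (1 + x\<^sup>2)\<^sup>2 / (2 * x * ((1 - x) * (1 + x)))"
    unfolding 1 c0_def x_def[symmetric] d by (simp add: power2_eq_square)
  also have "(1 + x\<^sup>2)\<^sup>2 = (x * (1 + x))\<^sup>2 + (1 - x)\<^sup>2 + 2 * x * ((1 - x) * (1 + x))"
    by (simp add: power2_eq_square algebra_simps)
  also have "\<dots> / (2 * x * ((1 - x) * (1 + x))) = (\<theta> + 1 / \<theta>) / 2 + 1"
    unfolding \<theta>_def x_def[symmetric] using x x2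
    by (simp add: add_divide_distrib power2_eq_square mult.commute)
  finally show ?thesis .
qed

lemma \<theta>_pos: "\<theta> > 0"
  unfolding \<theta>_def using x01 by (auto intro!: divide_pos_pos mult_pos_pos add_pos_pos)

text \<open>The amount by which the diagonal entry at \<open>j = H\<close> falls short of its bulk
  value, because \<open>ca H\<close> is 1. For \<open>\<theta> \<le> 1\<close> it is at most 1/2,
  which is what the end saves by having one neighbour less.\<close>

lemma boundary_term: "C\<^sup>2 * (c0 - 1) = \<theta> / 2"
proof -
  define x where "x = y\<^sup>2"
  have x: "0 < x" "x < 1" "x \<noteq> 0" using x01 by (auto simp: x_def)
  have "1 - x\<^sup>2 \<noteq> 0" using x01(3) by (simp add: x_def)
  with x have x2: "1 - x \<noteq> 0" "1 + x \<noteq> 0" "1 - x\<^sup>2 \<noteq> 0" by auto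
  have 1: "C\<^sup>2 = (1 + x)\<^sup>2 / (4 * x)"
    unfolding C_def x_def using y0 by (simp add: field_simps power2_eq_square)
  have d: "(1 - x\<^sup>2) = (1 - x) * (1 + x)" by (simp add: power2_eq_square algebra_simps)
  have "c0 - 1 = 2 * x\<^sup>2 / (1 - x\<^sup>2)"
    unfolding c0_def x_def[symmetric] using x2 by (simp add: field_simps)
  then show ?thesis unfolding 1 \<theta>_def x_def[symmetric] d using x x2
    by (simp add: power2_eq_square)
qed

lemma Lc_quadratic: "(\<Sum>j\<le>H. l j * Lc l j) = (\<Sum>j\<le>H. dg j * (l j)\<^sup>2) - (\<Sum>j<H. l j * l (Suc j))"
proof -
  have "(\<Sum>j\<le>H. l j * Lc l j) = (\<Sum>j\<le>H. dg j * (l j)\<^sup>2)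
      - (\<Sum>j\<le>H. sa j * C * S * (l j * l (Suc j))) - (\<Sum>j\<le>H. sb j * C * S * (l j * l (j - 1)))"
    unfolding Lc_def by (simp add: algebra_simps sum.distrib sum_subtractf power2_eq_square)
  also have "(\<Sum>j\<le>H. sa j * C * S * (l j * l (Suc j))) = (\<Sum>j<H. l j * l (Suc j)) / 2"
  proof -
    have "(\<Sum>j\<le>H. sa j * C * S * (l j * l (Suc j))) = (\<Sum>j<H. sa j * C * S * (l j * l (Suc j)))"
      by (rule sum.mono_neutral_right) (auto simp: sa_def)
    also have "\<dots> = (\<Sum>j<H. l j * l (Suc j) / 2)"
      by (rule sum.cong) (auto simp: sa_def s0CS)
    finally show ?thesis by (simp add: sum_divide_distrib)
  qed
  also have "(\<Sum>j\<le>H. sb j * C * S * (l j * l (j - 1))) = (\<Sum>j<H. l j * l (Suc j)) / 2"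
  proof -
    have "(\<Sum>j\<le>H. sb j * C * S * (l j * l (j - 1))) = (\<Sum>j\<in>Suc ` {..<H}. sb j * C * S * (l j * l (j - 1)))"
      by (rule sum.mono_neutral_right) (auto simp: sb_def image_Suc_lessThan)
    also have "\<dots> = (\<Sum>j<H. l j * l (Suc j) / 2)"
      by (subst sum.reindex) (auto simp: sb_def s0CS intro!: sum.cong)
    finally show ?thesis by (simp add: sum_divide_distrib)
  qed
  finally show ?thesis by simp
qed

lemma Lc_lower:
  assumes "\<theta> \<le> 1"
  shows "(\<theta> + 1 / \<theta>) / 2 * (\<Sum>j\<le>H. (l j)\<^sup>2) \<le> (\<Sum>j\<le>H. l j * Lc l j)"
proof -
  \<comment> \<open>Half the number of neighbours of \<open>j\<close> among 0 to \<open>H\<close>: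
    what the bound of the off-diagonal products by squares takes from the diagonal.\<close>
  define w where "w = (\<lambda>j. (of_bool (j < H) + of_bool (0 < j)) / 2 :: real)"
  have "(\<Sum>j<H. l j * l (Suc j)) \<le> (\<Sum>j<H. (l j)\<^sup>2 / 2 + (l (Suc j))\<^sup>2 / 2)"
  proof (rule sum_mono)
    fix j
    have "0 \<le> (l j - l (Suc j))\<^sup>2" by simp
    then show "l j * l (Suc j) \<le> (l j)\<^sup>2 / 2 + (l (Suc j))\<^sup>2 / 2"
      unfolding power2_diff by simp
  qed
  also have "\<dots> = (\<Sum>j\<le>H. of_bool (j < H) / 2 * (l j)\<^sup>2) + (\<Sum>j\<le>H. of_bool (0 < j) / 2 * (l j)\<^sup>2)"
  proof -
    have "(\<Sum>j\<le>H. of_bool (j < H) / 2 * (l j)\<^sup>2) = (\<Sum>j<H. (l j)\<^sup>2 / 2)"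
      by (rule sum.mono_neutral_cong_right) auto
    moreover have "(\<Sum>j\<le>H. of_bool (0 < j) / 2 * (l j)\<^sup>2) = (\<Sum>j\<in>Suc ` {..<H}. (l j)\<^sup>2 / 2)"
      by (rule sum.mono_neutral_cong_right) (auto simp: image_Suc_lessThan)
    moreover have "\<dots> = (\<Sum>j<H. (l (Suc j))\<^sup>2 / 2)"
      by (subst sum.reindex) auto
    ultimately show ?thesis by (simp add: sum.distrib)
  qed
  also have "\<dots> = (\<Sum>j\<le>H. w j * (l j)\<^sup>2)"
    unfolding w_def sum.distrib[symmetric] by (rule sum.cong) (auto simp: algebra_simps)
  finally have 1: "(\<Sum>j<H. l j * l (Suc j)) \<le> (\<Sum>j\<le>H. w j * (l j)\<^sup>2)" .
  have dw: "(\<theta> + 1 / \<theta>) / 2 \<le> dg j - w j" if "j \<le> H" for j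
  proof -
    have c: "c0 - 1 \<ge> 0" unfolding c0_def using x01 by (simp add: field_simps)
    have b1: "C\<^sup>2 * (c0 - 1) \<le> 1 / 2" using boundary_term assms by simp
    have b2: "S\<^sup>2 * (c0 - 1) \<le> 1 / 2"
      using b1 CS c mult_right_mono[of "S\<^sup>2" "C\<^sup>2" "c0 - 1"] by linarith
    have b: "c0 * C\<^sup>2 + c0 * S\<^sup>2 = (\<theta> + 1 / \<theta>) / 2 + 1" using dg_bulk by (simp add: algebra_simps)
    consider "j = 0" | "j = H" "j \<noteq> 0" | "0 < j" "j < H" using \<open>j \<le> H\<close> by linarith
    then show ?thesis
    proof cases
      case 1
      then show ?thesis using H1 b b2 by (simp add: dg_def w_def ca_def cb_def algebra_simps)
    next
      case 2
      then show ?thesis using b b1 by (simp add: dg_def w_def ca_def cb_def algebra_simps)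
    next
      case 3
      then show ?thesis using b by (simp add: dg_def w_def ca_def cb_def algebra_simps)
    qed
  qed
  have "(\<theta> + 1 / \<theta>) / 2 * (\<Sum>j\<le>H. (l j)\<^sup>2) \<le> (\<Sum>j\<le>H. (dg j - w j) * (l j)\<^sup>2)"
    unfolding sum_distrib_left by (intro sum_mono mult_right_mono dw) auto
  also have "\<dots> = (\<Sum>j\<le>H. dg j * (l j)\<^sup>2) - (\<Sum>j\<le>H. w j * (l j)\<^sup>2)"
    by (simp add: left_diff_distrib sum_subtractf)
  finally show ?thesis using 1 unfolding Lc_quadratic by linarith
qed

lemma lop_scale: "lop j (\<lambda>c. k * f c) c = k * lop j f c" "bop j (\<lambda>c. k * f c) c = k * bop j f c"
  by (simp_all add: lop_def bop_def maj_a_def maj_b_def algebra_simps)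

lemma ip_scale: "ip H f (\<lambda>c. k * g c) = k * ip H f g"
  by (simp add: ip_def sum_distrib_left mult_ac)

lemma ip_lop: "ip H f (lop j g) = Lc (\<lambda>j. ip H f (maj_a j g)) j"
  by (simp add: ip_def lop_def Lc_def sum_distrib_left sum_subtractf right_diff_distrib mult_ac)

(* The overlaps of the odd Perron vector with the vectors \<open>maj_a j \<psi>e\<close> form an eigenvector of \<open>Lc\<close>
   with eigenvalue (r + 1 / r) / 2, r being the ratio of the Perron eigenvalues. *)
lemma eigenvalue_ratio:
  assumes \<theta>1: "\<theta> \<le> 1"
    and e: "\<Lambda>e > 0" "T \<psi>e = (\<lambda>c. \<Lambda>e * \<psi>e c)" "\<And>c. \<psi>e c \<ge> 0" "\<And>c. \<psi>e c > 0 \<longleftrightarrow> outer c = {}"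
    and o: "\<Lambda>o > 0" "T \<psi>o = (\<lambda>c. \<Lambda>o * \<psi>o c)" "\<And>c. \<psi>o c \<ge> 0" "\<And>c. \<psi>o c > 0 \<longleftrightarrow> outer c = {0}"
  shows "\<theta> + 1 / \<theta> \<le> \<Lambda>o / \<Lambda>e + \<Lambda>e / \<Lambda>o"
proof -
  define l where "l = (\<lambda>j. ip H \<psi>o (maj_a j \<psi>e))"
  define r where "r = \<Lambda>o / \<Lambda>e"
  have r: "r > 0" using e o by (simp add: r_def)
  have lj: "(r + 1 / r) * l j = 2 * Lc l j" if "j \<le> H" for j
  proof -
    \<comment> \<open>The unwanted \<open>maj_b\<close> overlap. Evaluating the overlaps of
      \<open>\<psi>o\<close> with \<open>T (maj_a j \<psi>e)\<close> and with
      \<open>maj_a j (T \<psi>e)\<close> in two ways each gives \<open>r * l j\<close> and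
      \<open>1 / r * l j\<close> as \<open>Lc l j\<close> plus and minus \<open>m\<close>; the sum
      is free of \<open>m\<close>.\<close>
    define m where "m = ip H \<psi>o (bop j \<psi>e)"
    have "ip H \<psi>o (T (maj_a j \<psi>e)) = \<Lambda>o * l j"
      by (simp add: ip_tm o(2) l_def ip_commute[of H "\<lambda>c. \<Lambda>o * \<psi>o c"] ip_scale ip_commute[of H "maj_a j \<psi>e"])
    moreover have "ip H \<psi>o (T (maj_a j \<psi>e)) = \<Lambda>e * (Lc l j + m)"
    proof -
      have "T (maj_a j \<psi>e) = (\<lambda>c. \<Lambda>e * lincomb 1 (lop j \<psi>e) 1 (bop j \<psi>e) c)"
        unfolding tm_maj_a[OF that] e(2) by (rule ext) (simp add: lincomb_def lop_scale algebra_simps)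
      then show ?thesis by (simp add: ip_scale ip_lincomb ip_lop m_def l_def)
    qed
    ultimately have 1: "r * l j = Lc l j + m" using e by (simp add: r_def field_simps)
    have "ip H \<psi>o (maj_a j (T \<psi>e)) = \<Lambda>e * l j"
    proof -
      have "maj_a j (T \<psi>e) = (\<lambda>c. \<Lambda>e * maj_a j \<psi>e c)" by (auto simp: e(2) maj_a_def)
      then show ?thesis by (simp add: ip_scale l_def)
    qed
    moreover have "ip H \<psi>o (maj_a j (T \<psi>e)) = \<Lambda>o * (Lc l j - m)"
      unfolding maj_a_tm[OF that]
      by (simp add: ip_tm o(2) ip_lincomb ip_commute[of H "\<lambda>c. \<Lambda>o * \<psi>o c"] ip_scale)
        (simp add: ip_commute[of H _ \<psi>o] ip_lop m_def l_def algebra_simps)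
    ultimately have 2: "1 / r * l j = Lc l j - m" using o by (simp add: r_def field_simps)
    show ?thesis using 1 2 by (simp add: algebra_simps)
  qed
  have "l H > 0"
  proof -
    have nn: "\<psi>o c * maj_a H \<psi>e c \<ge> 0" for c
    proof (cases "outer c = {0}")
      case True
      then have "Suc H \<notin> outer c" by simp
      then have "Suc H \<notin> c" by (simp add: outer_def)
      then show ?thesis using e(3) o(3) by (simp add: maj_a_def zs_def)
    next
      case False
      then have "\<psi>o c = 0" using o(3)[of c] o(4)[of c] by (simp add: le_less)
      then show ?thesis by simp
    qed
    have "sd {0} {..H} = {1..H}" by auto
    then have "outer (sd {0} {..H}) = {}" by (simp add: outer_def)
    then have "\<psi>o {0} > 0" "\<psi>e (sd {0} {..H}) > 0" using e(4) o(4) by simp_all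
    then have "0 < \<psi>o {0} * maj_a H \<psi>e {0}" by (simp add: maj_a_def zs_def)
    also have "\<dots> \<le> l H" unfolding l_def ip_def by (rule member_le_sum) (use nn in auto)
    finally show ?thesis .
  qed
  have half: "a \<le> b" if "a / 2 \<le> b / 2" for a b :: real
    using that by simp
  from \<open>l H > 0\<close> have N: "(\<Sum>j\<le>H. (l j)\<^sup>2) > 0" by (intro sum_pos2[of _ H]) auto
  have "(\<theta> + 1 / \<theta>) / 2 * (\<Sum>j\<le>H. (l j)\<^sup>2) \<le> (\<Sum>j\<le>H. l j * Lc l j)" by (rule Lc_lower[OF \<theta>1])
  also have "\<dots> = (\<Sum>j\<le>H. (r + 1 / r) / 2 * (l j)\<^sup>2)"
  proof (intro sum.cong refl)
    fix j assume "j \<in> {..H}"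
    then have "Lc l j = (r + 1 / r) * l j / 2" using lj by simp
    then show "l j * Lc l j = (r + 1 / r) / 2 * (l j)\<^sup>2" by (simp add: power2_eq_square)
  qed
  also have "\<dots> = (r + 1 / r) / 2 * (\<Sum>j\<le>H. (l j)\<^sup>2)" by (simp add: sum_distrib_left)
  finally have "(\<theta> + 1 / \<theta>) / 2 \<le> (r + 1 / r) / 2" using N by (simp add: mult_le_cancel_right)
  from half[OF this] have "\<theta> + 1 / \<theta> \<le> r + 1 / r" .
  then show ?thesis by (simp add: r_def)
qed

text \<open>The map t + 1 / t is strictly decreasing on (0, 1].\<close>

lemma ratio_bound:
  fixes r t :: real
  assumes "0 < r" "r \<le> 1" "0 < t" "t < 1" "t + 1 / t \<le> r + 1 / r"
  shows "r \<le> t"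
proof (rule ccontr)
  assume "\<not> r \<le> t"
  then have rt: "r > t" by simp
  have "(r - t) * (1 - r * t) > 0" using rt assms mult_strict_mono'[of r 1 t 1] mult_le_one[of r t]
    by (intro mult_pos_pos) (auto intro: le_less_trans[OF mult_right_mono[of r 1 t]])
  also have "(r - t) * (1 - r * t) = r * t * ((t + 1 / t) * (- 1) + (r + 1 / r)) * (- 1)"
    using assms by (simp add: field_simps)
  also have "\<dots> \<le> 0" using assms by (auto simp: mult_nonneg_nonneg)
  finally show False by simp
qed

lemma pow2_bounded_le_1:
  fixes q :: real
  assumes "q \<ge> 0" "\<And>k. q ^ (2 ^ k) \<le> B"
  shows "q \<le> 1"
proof (rule ccontr)
  assume "\<not> q \<le> 1"
  then have "q > 1" by simp
  then obtain n where n: "B < q ^ n" using real_arch_pow by blast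
  have "q ^ n \<le> q ^ (2 ^ n)" using \<open>q > 1\<close> by (intro power_increasing) (auto intro: less_imp_le less_exp)
  then show False using n assms(2)[of n] by linarith
qed

(* The eigenvalues bound the entry ratio only up to a factor; doubling n repeatedly (\<open>entry_double\<close>)
   removes it. *)
theorem entry_upper:
  assumes \<theta>1: "\<theta> < 1"
  shows "entry n {0} {0} \<le> \<theta> ^ n * entry n {} {}"
proof (cases "n = 0")
  case True
  then show ?thesis by (simp add: entry_0)
next
  case False
  have 0: "{} \<inter> {1..H} = {}" "{0} \<inter> {1..H} = {}" by auto
  obtain \<psi>e \<Lambda>e where e: "\<Lambda>e > 0" "\<And>c. \<psi>e c \<ge> 0" "\<And>c. \<psi>e c > 0 \<longleftrightarrow> outer c = {}" "T \<psi>e = (\<lambda>c. \<Lambda>e * \<psi>e c)"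
    by (rule sector_eigenvector[OF 0(1)]) (rule that)
  obtain \<psi>o \<Lambda>o where o: "\<Lambda>o > 0" "\<And>c. \<psi>o c \<ge> 0" "\<And>c. \<psi>o c > 0 \<longleftrightarrow> outer c = {0}" "T \<psi>o = (\<lambda>c. \<Lambda>o * \<psi>o c)"
    by (rule sector_eigenvector[OF 0(2)]) (rule that)
  obtain \<kappa>e where \<kappa>e: "\<kappa>e > 0" "\<And>n. \<kappa>e * \<Lambda>e ^ n \<le> entry (Suc n) {} {}"
    by (rule entry_ge_eigenvalue[OF e(1,3,4) 0(1)]) (rule that)
  obtain \<kappa>o where \<kappa>o: "\<kappa>o > 0" "\<And>n. \<kappa>o * \<Lambda>o ^ n \<le> entry (Suc n) {0} {0}"
    by (rule entry_ge_eigenvalue[OF o(1,3,4) 0(2)]) (rule that)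
  have upo: "entry n {0} {0} \<le> \<Lambda>o ^ n" for n
    by (rule entry_le_eigenvalue[OF o(1,2) _ o(4) 0(2)]) (simp add: o)
  have upe: "entry n {} {} \<le> \<Lambda>e ^ n" for n
    by (rule entry_le_eigenvalue[OF e(1,2) _ e(4) 0(1)]) (simp add: e)
  define r where "r = \<Lambda>o / \<Lambda>e"
  have r: "r > 0" using e o by (simp add: r_def)
  \<comment> \<open>\<open>r + 1 / r\<close> does not distinguish \<open>r\<close> from its inverse;
    \<open>entry_le_1\<close> selects the root in (0, 1].\<close>
  have "r \<le> 1"
  proof (rule pow2_bounded_le_1)
    fix k :: nat
    define m where "m = (2::nat) ^ k"
    have "\<kappa>o * \<Lambda>o ^ m \<le> \<Lambda>e ^ Suc m"
      using \<kappa>o(2)[of m] entry_le_1[of "Suc m"] upe[of "Suc m"] by linarith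
    then have "(\<Lambda>o / \<Lambda>e) ^ m \<le> \<Lambda>e / \<kappa>o" using e \<kappa>o by (simp add: power_divide field_simps)
    then show "r ^ 2 ^ k \<le> \<Lambda>e / \<kappa>o" by (simp add: r_def m_def)
  qed (use r in simp)
  moreover have "\<theta> + 1 / \<theta> \<le> r + 1 / r"
    using eigenvalue_ratio[OF less_imp_le[OF \<theta>1] e(1,4,2,3) o(1,4,2,3)] by (simp add: r_def)
  ultimately have r\<theta>: "r \<le> \<theta>" using ratio_bound[OF r _ \<theta>_pos \<theta>1] by simp
  have e_pos: "entry n {} {} > 0" if "n > 0" for n
  proof -
    have "0 < \<kappa>e * \<Lambda>e ^ (n - 1)" using \<kappa>e(1) e(1) by simp
    then show ?thesis using \<kappa>e(2)[of "n - 1"] that by simp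
  qed
  define \<rho> where "\<rho> = (\<lambda>n. entry n {0} {0} / entry n {} {})"
  have \<rho>0: "\<rho> n \<ge> 0" for n by (simp add: \<rho>_def entry_nonneg)
  have dbl: "(\<rho> n)\<^sup>2 \<le> \<rho> (n + n)" if "n > 0" for n
    using entry_double[of n] e_pos[OF that] e_pos[of "n + n"] that
    by (simp add: \<rho>_def field_simps power2_eq_square)
  have pw: "\<rho> n ^ (2 ^ k) \<le> \<rho> (2 ^ k * n)" for k
  proof (induction k)
    case (Suc k)
    have "\<rho> n ^ (2 ^ Suc k) = (\<rho> n ^ (2 ^ k))\<^sup>2" by (simp add: power_mult[symmetric] mult.commute)
    also have "\<dots> \<le> (\<rho> (2 ^ k * n))\<^sup>2" using Suc \<rho>0 by (intro power_mono) auto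
    also have "\<dots> \<le> \<rho> (2 ^ k * n + 2 ^ k * n)" using False by (intro dbl) auto
    also have "2 ^ k * n + 2 ^ k * n = 2 ^ Suc k * n" by simp
    finally show ?case .
  qed simp
  have "\<rho> n / r ^ n \<le> 1"
  proof (rule pow2_bounded_le_1)
    show "\<rho> n / r ^ n \<ge> 0" using \<rho>0 r by simp
    fix k :: nat
    define m where "m = 2 ^ k * n"
    have m: "m > 0" using False by (simp add: m_def)
    have "\<rho> m * (\<kappa>e * \<Lambda>e ^ (m - 1)) \<le> \<rho> m * entry m {} {}"
      using \<kappa>e(2)[of "m - 1"] m \<rho>0 by (intro mult_left_mono) auto
    also have "\<dots> = entry m {0} {0}" using e_pos[OF m] by (simp add: \<rho>_def)
    also have "\<dots> \<le> \<Lambda>o ^ m" by (rule upo)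
    also have "\<dots> = r ^ m * (\<Lambda>e * \<Lambda>e ^ (m - 1))"
    proof -
      obtain m' where "m = Suc m'" using m gr0_implies_Suc by blast
      moreover have "\<Lambda>o = r * \<Lambda>e" using e by (simp add: r_def)
      ultimately show ?thesis by (simp add: power_mult_distrib)
    qed
    finally have "\<rho> m * \<kappa>e * \<Lambda>e ^ (m - 1) \<le> r ^ m * \<Lambda>e * \<Lambda>e ^ (m - 1)" by (simp add: mult_ac)
    then have "\<rho> m * \<kappa>e \<le> r ^ m * \<Lambda>e" using e by simp
    then have "\<rho> m / r ^ m \<le> \<Lambda>e / \<kappa>e" using \<kappa>e r by (simp add: field_simps)
    moreover have "(\<rho> n / r ^ n) ^ 2 ^ k \<le> \<rho> m / r ^ m"
    proof -
      have "(\<rho> n / r ^ n) ^ 2 ^ k = \<rho> n ^ 2 ^ k / r ^ m"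
        unfolding power_divide power_mult[symmetric] m_def by (simp only: mult.commute)
      then show ?thesis using pw[of k] r by (simp add: m_def divide_right_mono)
    qed
    ultimately show "(\<rho> n / r ^ n) ^ 2 ^ k \<le> \<Lambda>e / \<kappa>e" by linarith
  qed
  then have "\<rho> n \<le> r ^ n" using r by simp
  also have "\<dots> \<le> \<theta> ^ n" using r r\<theta> by (intro power_mono) auto
  finally show ?thesis using e_pos[of n] False by (simp add: \<rho>_def field_simps)
qed

section \<open>Lower bound for the entry ratio by a trial vector\<close>

lemma tm_sum: "T (\<lambda>c. \<Sum>j\<in>J. g j c) = (\<lambda>c. \<Sum>j\<in>J. T (g j) c)"
  by (rule ext, unfold tm_kern sum_distrib_left, rule sum.swap)

lemma tm_scale: "T (\<lambda>c. k * g c) = (\<lambda>c. k * T g c)"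
  by (rule ext, unfold tm_kern sum_distrib_left) (simp add: mult_ac)

lemma ip_tm_Cauchy_Schwarz: "ip H f (T g) * ip H f (T g) \<le> ip H f (T f) * ip H g (T g)"
proof (rule quadratic_discriminant_le)
  fix s
  have "ip H (lincomb 1 f s g) (T (lincomb 1 f s g)) = ip H (diag_op y H (lincomb 1 f s g)) (hop (y\<^sup>2) {1..H} (diag_op y H (lincomb 1 f s g)))"
    by (simp add: tm_def ip_diag_op)
  also have "\<dots> \<ge> 0" by (rule ip_hop_nonneg) (use x01 in auto)
  finally show "0 \<le> ip H f (T f) + 2 * ip H f (T g) * s + ip H g (T g) * s * s"
    using ip_tm[of H f y g] ip_commute[of H "T f" g] by (simp add: lincomb_linear ip_lincomb algebra_simps)
qed

text \<open>Moments of a positive operator are log-convex. For even \<open>n\<close> the powers of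
  \<open>T\<close> split evenly and Cauchy-Schwarz for \<open>ip\<close> applies; for odd
  \<open>n\<close> one factor \<open>T\<close> stays in the middle, and its positivity is used
  instead.\<close>

lemma moment_log_convex:
  "(ip H v ((T ^^ Suc n) v))\<^sup>2 \<le> ip H v ((T ^^ n) v) * ip H v ((T ^^ Suc (Suc n)) v)"
proof -
  have sh: "ip H ((T ^^ i) v) ((T ^^ j) v) = ip H v ((T ^^ (i + j)) v)" for i j
    by (simp add: ip_tm_pow[symmetric] funpow_add)
  have shT: "ip H ((T ^^ i) v) (T ((T ^^ j) v)) = ip H v ((T ^^ (i + Suc j)) v)" for i j
    using sh[of i "Suc j"] by simp
  show ?thesis
  proof (cases "even n")
    case True
    then obtain k where n: "n = k + k" by (metis evenE mult_2)
    show ?thesis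
      using ip_Cauchy_Schwarz[of H "(T ^^ k) v" "(T ^^ Suc k) v"]
      unfolding sh n power2_eq_square by simp
  next
    case False
    then obtain k where n: "n = Suc (k + k)" by (metis oddE mult_2 Suc_eq_plus1)
    show ?thesis
      using ip_tm_Cauchy_Schwarz[of "(T ^^ k) v" "(T ^^ Suc k) v"]
      unfolding shT n power2_eq_square by simp
  qed
qed

text \<open>By log-convexity the quotients of successive moments increase, so a bound on the first
  quotient propagates.\<close>

lemma moment_lower:
  assumes "ip H v v > 0" "p > 0" "ip H v (T v) \<ge> p * ip H v v"
  shows "ip H v ((T ^^ n) v) \<ge> p ^ n * ip H v v"
proof -
  define a where "a = (\<lambda>n. ip H v ((T ^^ n) v))"
  have "a n > 0 \<and> a (Suc n) \<ge> p * a n" for n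
  proof (induction n)
    case 0
    then show ?case using assms by (simp add: a_def)
  next
    case (Suc n)
    then have an: "a n > 0" "a (Suc n) \<ge> p * a n" by auto
    then have pos: "a (Suc n) > 0" using assms(2) by (smt (verit) mult_pos_pos)
    have "a (Suc n) * (p * a n) \<le> a (Suc n) * a (Suc n)"
      using an pos by (intro mult_left_mono) auto
    also have "\<dots> \<le> a n * a (Suc (Suc n))"
      using moment_log_convex[of v n] by (simp add: a_def power2_eq_square)
    finally have "a n * (p * a (Suc n)) \<le> a n * a (Suc (Suc n))" by (simp only: mult_ac)
    then show ?case using an(1) pos by simp
  qed
  then have step: "a (Suc n) \<ge> p * a n" for n by blast
  have "a n \<ge> p ^ n * a 0"
  proof (induction n)
    case (Suc n)
    have "p ^ Suc n * a 0 = p * (p ^ n * a 0)" by simp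
    also have "\<dots> \<le> p * a n" using Suc assms(2) by (intro mult_left_mono) auto
    also have "\<dots> \<le> a (Suc n)" by (rule step)
    finally show ?case .
  qed simp
  then show ?thesis by (simp add: a_def)
qed

lemma ip_maj_a_lop:
  assumes "i \<le> H" "j \<le> H"
  shows "ip H (maj_a i f) (lop j f) = ip H f f * Lc (\<lambda>j. of_bool (i = j)) j"
proof -
  have 1: "sa j * C * S * ip H (maj_a i f) (maj_a (Suc j) f) = sa j * C * S * (ip H f f * of_bool (i = Suc j))"
    using assms by (cases "j < H") (auto simp: ip_maj_a_maj_a sa_def)
  have 2: "ip H (maj_a i f) (maj_a j f) = ip H f f * of_bool (i = j)"
    "ip H (maj_a i f) (maj_a (j - 1) f) = ip H f f * of_bool (i = j - 1)"
    using assms by (simp_all add: ip_maj_a_maj_a)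
  show ?thesis
    unfolding ip_lop Lc_def 1 2 by (simp only: right_diff_distrib mult_ac)
qed

lemma sum_Lc_delta:
  assumes "j \<le> H"
  shows "(\<Sum>i\<le>H. f i * Lc (\<lambda>j. of_bool (i = j)) j) = Lc f j"
proof -
  have d: "(\<Sum>i\<le>H. f i * of_bool (i = k)) = f k" if "k \<le> H" for k
  proof -
    have "(\<Sum>i\<le>H. f i * of_bool (i = k)) = (\<Sum>i\<le>H. if i = k then f k else 0)"
      by (intro sum.cong) auto
    then show ?thesis using that by (simp add: sum.delta)
  qed
  have 1: "sa j * (\<Sum>i\<le>H. f i * of_bool (i = Suc j)) = sa j * f (Suc j)"
    by (cases "j < H") (simp_all only: d Suc_leI sa_def, simp_all)
  have "(\<Sum>i\<le>H. f i * Lc (\<lambda>j. of_bool (i = j)) j) =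
    dg j * (\<Sum>i\<le>H. f i * of_bool (i = j)) - C * S * (sa j * (\<Sum>i\<le>H. f i * of_bool (i = Suc j)))
      - C * S * sb j * (\<Sum>i\<le>H. f i * of_bool (i = j - 1))"
    unfolding Lc_def sum_distrib_left sum_subtractf[symmetric]
    by (intro sum.cong refl) (simp only: right_diff_distrib mult_ac)
  also have "\<dots> = Lc f j"
    unfolding 1 using assms by (simp add: d Lc_def)
  finally show ?thesis .
qed

text \<open>The sine vanishes at 0 and \<open>H\<close>, the only places where \<open>Lc\<close>
  deviates from its bulk form; in between it is an eigenvector of the discrete Laplacian.\<close>

lemma Lc_sin:
  defines "f \<equiv> \<lambda>j. sin (pi * real j / real H)"
  shows "(\<Sum>j\<le>H. f j * Lc f j) = ((\<theta> + 1 / \<theta>) / 2 + 1 - cos (pi / real H)) * (\<Sum>j\<le>H. (f j)\<^sup>2)"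
  unfolding sum_distrib_left
proof (rule sum.cong)
  fix j assume "j \<in> {..H}"
  then consider "f j = 0" | "0 < j" "j < H"
    using H1 by (cases "j = 0"; cases "j = H") (auto simp: f_def)
  then show "f j * Lc f j = ((\<theta> + 1 / \<theta>) / 2 + 1 - cos (pi / real H)) * (f j)\<^sup>2"
  proof cases
    case 2
    define a b where "a = pi * real j / real H" and "b = pi / real H"
    have "f (Suc j) = sin (a + b)" "f (j - 1) = sin (a - b)" "f j = sin a"
      using 2 by (simp_all add: f_def a_def b_def of_nat_diff algebra_simps add_divide_distrib diff_divide_distrib)
    then have s: "f (Suc j) + f (j - 1) = 2 * cos b * f j"
      by (simp add: sin_add sin_diff)
    have e: "sa j * C * S = 1 / 2" "sb j * C * S = 1 / 2" "dg j = c0 * (C\<^sup>2 + S\<^sup>2)"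
      using 2 s0CS by (simp_all add: dg_def ca_def cb_def sa_def sb_def distrib_left mult.commute)
    have "Lc f j = c0 * (C\<^sup>2 + S\<^sup>2) * f j - (f (Suc j) + f (j - 1)) / 2"
      unfolding Lc_def e by (simp add: add_divide_distrib)
    then have "Lc f j = ((\<theta> + 1 / \<theta>) / 2 + 1 - cos (pi / real H)) * f j"
      unfolding s dg_bulk b_def by (simp add: left_diff_distrib)
    then show ?thesis by (simp only: power2_eq_square mult_ac)
  qed simp
qed simp

text \<open>A quantitative converse of \<open>ratio_bound\<close>. The map t + 1 / t has slope - (1
  - t^2) / t^2, so an excess \<open>\<delta>\<close> lowers the root by a relative amount of about
  \<open>\<delta> * t / (1 - t\<^sup>2)\<close>.\<close>

lemma gap_bound:
  fixes p :: real
  assumes "0 < p" "0 < t" "t < 1" "0 \<le> \<delta>" "p + 1 / p \<le> t + 1 / t + \<delta>"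
  shows "p \<ge> t * exp (- \<delta> * t / (1 - t\<^sup>2))"
proof -
  have t2: "1 - t\<^sup>2 > 0" using assms by (simp add: power_less_one_iff)
  have "t / p \<le> 1 + \<delta> * t / (1 - t\<^sup>2)"
  proof (cases "p \<ge> t")
    case True
    then have "t / p \<le> 1" using assms by simp
    moreover have "\<delta> * t / (1 - t\<^sup>2) \<ge> 0" using assms t2 by simp
    ultimately show ?thesis by linarith
  next
    case False
    have "(t / p - 1) * (1 - t\<^sup>2) \<le> (t / p - 1) * (1 - p * t)"
      using False assms by (intro mult_left_mono) (auto simp: power2_eq_square field_simps)
    also have "\<dots> = t * (p + 1 / p - t - 1 / t)" using assms by (simp add: field_simps)
    also have "\<dots> \<le> t * \<delta>" using assms by (intro mult_left_mono) auto
    finally have "t / p - 1 \<le> t * \<delta> / (1 - t\<^sup>2)" using t2 by (simp only: pos_le_divide_eq)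
    then show ?thesis by (simp add: mult.commute)
  qed
  also have "\<dots> \<le> exp (\<delta> * t / (1 - t\<^sup>2))" by (rule exp_ge_add_one_self)
  finally have "t / p \<le> exp (\<delta> * t / (1 - t\<^sup>2))" .
  then have "t * exp (- (\<delta> * t / (1 - t\<^sup>2))) \<le> p" using assms by (simp add: exp_minus field_simps)
  then show ?thesis by simp
qed

text \<open>Let p and q be the normalised expectations of \<open>T\<close> and of its inverse in the
  trial vector. Their sum is known from \<open>Lc_sin\<close> and their product is at least 1 by
  Cauchy-Schwarz, so p + 1 / p is bounded and p cannot be far below \<open>\<theta>\<close>.
  Log-convexity of the moments carries this to all powers.\<close>

theorem entry_lower:
  assumes \<theta>1: "\<theta> < 1" and H2: "2 \<le> H"
  shows "entry (n + 2) {0} {0} \<ge> \<tau>\<^sup>2 / 8 ^ H * (\<theta> * exp (- (pi\<^sup>2 * \<theta> / (1 - \<theta>\<^sup>2)) / (real H)\<^sup>2)) ^ n * entry (n + 2) {} {}"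
proof -
  have 0: "{} \<inter> {1..H} = {}" by auto
  obtain \<psi> \<Lambda> where e: "\<Lambda> > 0" "\<And>c. \<psi> c \<ge> 0" "\<And>c. \<psi> c > 0 \<longleftrightarrow> outer c = {}" "T \<psi> = (\<lambda>c. \<Lambda> * \<psi> c)"
    by (rule sector_eigenvector[OF 0]) (rule that)
  have up: "entry n {} {} \<le> \<Lambda> ^ n" for n
    by (rule entry_le_eigenvalue[OF e(1,2) _ e(4) 0]) (simp add: e)
  have L2: "\<Lambda> \<le> 2 ^ H" by (rule eigenvalue_le[OF e(2) _ e(4) 0]) (simp add: e)
  define f where "f = (\<lambda>j. sin (pi * real j / real H))"
  define F where "F = (\<Sum>j\<le>H. (f j)\<^sup>2)"
  define v where "v = (\<lambda>c. \<Sum>j\<le>H. f j * maj_a j \<psi> c)"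
  define u where "u = (\<lambda>c. \<Sum>j\<le>H. f j * lop j \<psi> c)"
  define b where "b = (\<lambda>c. \<Sum>j\<le>H. f j * bop j \<psi> c)"
  \<comment> \<open>The preimage of \<open>v\<close> under \<open>T\<close>, read off from
    \<open>maj_a_tm\<close>.\<close>
  define w where "w = (\<lambda>c. 1 / \<Lambda> * lincomb 1 u (- 1) b c)"
  define N where "N = ip H \<psi> \<psi>"
  have N: "N > 0"
  proof -
    have "0 < \<psi> {} * \<psi> {}" using e(3)[of "{}"] by simp
    also have "\<dots> \<le> N" unfolding N_def ip_def by (rule member_le_sum) auto
    finally show ?thesis .
  qed
  have F: "F > 0"
  proof -
    have "sin (pi / real H) > 0"
    proof (rule sin_gt_zero)
      show "0 < pi / real H" using H1 by simp
      have "pi / real H < pi / 1" using H2 by (intro divide_strict_left_mono) auto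
      then show "pi / real H < pi" by simp
    qed
    then show ?thesis unfolding F_def using H1 by (intro sum_pos2[of _ 1]) (auto simp: f_def)
  qed
  have Tv: "T v = lincomb \<Lambda> u \<Lambda> b"
  proof
    fix c
    have "T v c = (\<Sum>j\<le>H. f j * T (maj_a j \<psi>) c)" unfolding v_def tm_sum tm_scale ..
    also have "\<dots> = (\<Sum>j\<le>H. f j * (\<Lambda> * lop j \<psi> c + \<Lambda> * bop j \<psi> c))"
      by (intro sum.cong) (auto simp: tm_maj_a e(4) lincomb_def lop_scale)
    finally show "T v c = lincomb \<Lambda> u \<Lambda> b c"
      by (simp add: u_def b_def lincomb_def sum.distrib sum_distrib_left algebra_simps)
  qed
  have Tw: "T w = v"
  proof
    fix c
    have "lincomb 1 u (- 1) b = (\<lambda>c. \<Sum>j\<le>H. f j * lincomb 1 (lop j \<psi>) (- 1) (bop j \<psi>) c)"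
      by (auto simp: u_def b_def lincomb_def algebra_simps sum_subtractf)
    then have "T w c = 1 / \<Lambda> * (\<Sum>j\<le>H. f j * T (lincomb 1 (lop j \<psi>) (- 1) (bop j \<psi>)) c)"
      unfolding w_def tm_scale by (simp only: tm_sum tm_scale)
    also have "\<dots> = 1 / \<Lambda> * (\<Sum>j\<le>H. f j * (\<Lambda> * maj_a j \<psi> c))"
    proof -
      have "T (lincomb 1 (lop j \<psi>) (- 1) (bop j \<psi>)) c = \<Lambda> * maj_a j \<psi> c" if "j \<le> H" for j
        using fun_cong[OF maj_a_tm[OF that, of \<psi>], of c] by (simp add: e(4) maj_a_def mult_ac)
      then show ?thesis by simp
    qed
    also have "\<dots> = v c" using e(1) by (simp add: v_def sum_distrib_left)
    finally show "T w c = v c" .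
  qed
  have ip_sum: "ip H v (\<lambda>c. \<Sum>j\<le>H. f j * g j c) = (\<Sum>j\<le>H. f j * ip H v (g j))"
    "ip H (\<lambda>c. \<Sum>j\<le>H. f j * g j c) v = (\<Sum>j\<le>H. f j * ip H (g j) v)" for g v
  proof -
    show "ip H v (\<lambda>c. \<Sum>j\<le>H. f j * g j c) = (\<Sum>j\<le>H. f j * ip H v (g j))" for v
      unfolding ip_def sum_distrib_left by (subst sum.swap) (simp add: mult_ac)
    then show "ip H (\<lambda>c. \<Sum>j\<le>H. f j * g j c) v = (\<Sum>j\<le>H. f j * ip H (g j) v)"
      by (simp only: ip_commute[of H _ v])
  qed
  have vv: "ip H v v = N * F"
  proof -
    have "ip H v v = (\<Sum>i\<le>H. f i * (\<Sum>j\<le>H. f j * ip H (maj_a i \<psi>) (maj_a j \<psi>)))"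
      unfolding v_def by (simp only: ip_sum(2)) (simp only: ip_sum(1))
    also have "\<dots> = (\<Sum>i\<le>H. f i * (\<Sum>j\<le>H. if j = i then f i * N else 0))"
      by (intro sum.cong refl arg_cong2[where f = "(*)"]) (auto simp: ip_maj_a_maj_a N_def)
    also have "\<dots> = N * F" by (simp add: F_def sum_distrib_left power2_eq_square mult_ac)
    finally show ?thesis .
  qed
  define \<kappa> where "\<kappa> = (\<theta> + 1 / \<theta>) / 2 + 1 - cos (pi / real H)"
  have vu: "ip H v u = \<kappa> * (N * F)"
  proof -
    have "ip H v u = (\<Sum>j\<le>H. f j * (\<Sum>i\<le>H. f i * ip H (maj_a i \<psi>) (lop j \<psi>)))"
      unfolding v_def u_def by (simp only: ip_sum(1)) (simp only: ip_sum(2))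
    also have "\<dots> = (\<Sum>j\<le>H. f j * (\<Sum>i\<le>H. N * (f i * Lc (\<lambda>j. of_bool (i = j)) j)))"
      by (rule sum.cong[OF refl], rule arg_cong2[where f = "(*)", OF refl], rule sum.cong[OF refl])
        (simp add: ip_maj_a_lop N_def)
    also have "\<dots> = N * (\<Sum>j\<le>H. f j * Lc f j)"
      unfolding sum_distrib_left[symmetric] by (simp add: sum_Lc_delta sum_distrib_left mult_ac)
    also have "\<dots> = \<kappa> * (N * F)" unfolding f_def Lc_sin \<kappa>_def F_def by simp
    finally show ?thesis .
  qed
  define p where "p = ip H v (T v) / (\<Lambda> * ip H v v)"
  define q where "q = \<Lambda> * ip H v w / ip H v v"
  have vpos: "ip H v v > 0" using N F vv by simp
  have pq: "p + q = 2 * \<kappa>"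
  proof -
    have "\<Lambda> * ip H v w = ip H v u - ip H v b"
      unfolding w_def ip_scale using e(1) by (simp add: ip_lincomb)
    then have "p + q = ((ip H v u + ip H v b) + (ip H v u - ip H v b)) / ip H v v"
      unfolding p_def q_def Tv using e(1) vpos by (simp add: ip_lincomb add_divide_distrib diff_divide_distrib)
    also have "\<dots> = 2 * \<kappa>" using N F by (simp add: vu vv)
    finally show ?thesis .
  qed
  have "ip H v v * ip H v v \<le> ip H v (T v) * ip H w v"
    using ip_tm_Cauchy_Schwarz[of v w] by (simp add: Tw)
  then have pq1: "p * q \<ge> 1"
    unfolding p_def q_def using e(1) vpos by (simp add: ip_commute[of H w v] field_simps)
  have Tvpos: "ip H v (T v) \<ge> 0"
    using ip_hop_nonneg[of "{1..H}" H "y\<^sup>2" "diag_op y H v"] x01 by (simp add: tm_def ip_diag_op)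
  have p: "p > 0"
  proof -
    have "p \<ge> 0" using Tvpos e(1) vpos by (simp add: p_def)
    moreover have "p \<noteq> 0" using pq1 by auto
    ultimately show ?thesis by simp
  qed
  define \<delta> where "\<delta> = pi\<^sup>2 / (real H)\<^sup>2"
  have "p + 1 / p \<le> \<theta> + 1 / \<theta> + \<delta>"
  proof -
    have "1 / p \<le> q" using pq1 p by (simp add: field_simps)
    moreover have "2 * (1 - cos (pi / real H)) \<le> \<delta>"
    proof -
      have "1 - cos (pi / real H) = 2 * (sin (pi / real H / 2))\<^sup>2"
        using cos_double_sin[of "pi / real H / 2"] by simp
      also have "(sin (pi / real H / 2))\<^sup>2 \<le> (pi / real H / 2)\<^sup>2"
        using abs_sin_x_le_abs_x[of "pi / real H / 2"] by (simp only: abs_le_square_iff)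
      finally show ?thesis by (simp add: \<delta>_def power_divide)
    qed
    moreover have "2 * \<kappa> = (\<theta> + 1 / \<theta>) + 2 * (1 - cos (pi / real H))"
      unfolding \<kappa>_def by (simp only: distrib_left right_diff_distrib) simp
    ultimately show ?thesis using pq by linarith
  qed
  then have pl: "p \<ge> \<theta> * exp (- \<delta> * \<theta> / (1 - \<theta>\<^sup>2))"
    by (intro gap_bound p \<theta>_pos \<theta>1) (simp_all add: \<delta>_def)
  define q0 where "q0 = \<theta> * exp (- (pi\<^sup>2 * \<theta> / (1 - \<theta>\<^sup>2)) / (real H)\<^sup>2)"
  have q0: "q0 \<le> p" "q0 > 0" using pl \<theta>_pos by (simp_all add: q0_def \<delta>_def mult.commute)
  have "ip H v (T v) = p * \<Lambda> * ip H v v" using vpos e(1) by (simp add: p_def)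
  then have low: "ip H v ((T ^^ n) v) \<ge> (p * \<Lambda>) ^ n * ip H v v"
    using p e(1) vpos by (intro moment_lower) auto
  \<comment> \<open>The strings in \<open>v\<close> flip row 0 but never row \<open>Suc H\<close>,
    so they carry the all-plus block, where \<open>\<psi>\<close> lives, to the block of
    \<open>{0}\<close>.\<close>
  have v0: "v c = 0" if "outer c \<noteq> {0}" "c \<subseteq> {..Suc H}" for c
  proof -
    have "maj_a j \<psi> c = 0" if j: "j \<le> H" for j
    proof -
      have "outer (sd c {..j}) \<noteq> {}"
      proof
        assume "outer (sd c {..j}) = {}"
        then have *: "i \<in> {1..H}" if "(i \<in> c) \<noteq> (i \<le> j)" for i using that by (auto simp: outer_def)
        have "0 \<in> c" using *[of 0] by auto
        moreover have "Suc H \<notin> c" using *[of "Suc H"] j by auto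
        ultimately have "outer c = {0}" using \<open>c \<subseteq> {..Suc H}\<close>
          by (auto simp: outer_def subset_iff) (metis le_SucE Suc_leI not_gr0)
        then show False using \<open>outer c \<noteq> {0}\<close> by simp
      qed
      then have "\<psi> (sd c {..j}) = 0" using e(2)[of "sd c {..j}"] e(3)[of "sd c {..j}"] by (simp add: le_less)
      then show ?thesis by (simp add: maj_a_def)
    qed
    then show ?thesis by (simp add: v_def)
  qed
  define J where "J = (\<lambda>e. insert 0 e) ` Pow {1..H}"
  have Jc: "J = {c \<in> Pow {..Suc H}. outer c = {0}}"
  proof -
    have "c \<in> J" if "c \<in> Pow {..Suc H}" "outer c = {0}" for c
    proof -
      have "c = insert 0 (c \<inter> {1..H})" using outer_Un(3)[of c] that(2) by simp
      then show ?thesis unfolding J_def by blast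
    qed
    moreover have "outer (insert 0 e) = {0}" if "e \<subseteq> {1..H}" for e
      using outer_Un(1)[OF that, of "{0}"] by simp
    ultimately show ?thesis unfolding J_def by (auto simp: subset_iff)
  qed
  have inj: "inj_on (insert 0) (Pow {1..H})"
    by (rule inj_on_inverseI[where g = "\<lambda>c. c \<inter> {1..H}"]) auto
  have cJ: "card J = 2 ^ H" "finite J" unfolding J_def using inj by (simp_all add: card_image card_Pow)
  have ipJ: "ip H v g = (\<Sum>c\<in>J. v c * g c)" for g
    unfolding ip_def Jc by (rule sum.mono_neutral_right) (auto simp: v0)
  \<comment> \<open>A step from \<open>{0}\<close> to any column of the block and a step back cost a
    factor \<open>\<tau>\<close> each, whence \<open>n + 2\<close>. Bounding the double sum by
    squares leaves the number \<open>2 ^ H\<close> of columns.\<close>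
  have upper: "ip H v ((T ^^ n) v) \<le> entry (n + 2) {0} {0} / \<tau>\<^sup>2 * (2 ^ H * ip H v v)"
  proof -
    have Tn: "(T ^^ n) v c = (\<Sum>d\<in>J. entry n c d * v d)" if "c \<in> J" for c
    proof -
      have "outer c = {0}" using that Jc by auto
      then show ?thesis unfolding tm_pow_eq J_def by (subst sum.reindex[OF inj]) simp
    qed
    define E where "E = entry (n + 2) {0} {0} / \<tau>\<^sup>2"
    have E: "E \<ge> 0" using entry_nonneg[of "n + 2"] by (simp add: E_def)
    have entE: "entry n c d \<le> E" if "c \<in> J" "d \<in> J" for c d
    proof -
      have bc: "outer c = {0}" "outer d = {0}" using that Jc by auto
      have "\<tau> * entry n c d \<le> entry 1 {0} c * entry n c d"
        using entry_1_ge[of "{0}" c] bc by (intro mult_right_mono entry_nonneg) auto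
      also have "\<dots> \<le> entry (1 + n) {0} d" using bc by (intro entry_ge_mult) simp
      finally have 1: "\<tau> * entry n c d \<le> entry (1 + n) {0} d" .
      have "\<tau> * (\<tau> * entry n c d) \<le> \<tau> * entry (1 + n) {0} d"
        by (rule mult_left_mono[OF 1]) (use \<tau>_pos in simp)
      also have "\<dots> = entry (1 + n) {0} d * \<tau>" by simp
      also have "\<dots> \<le> entry (1 + n) {0} d * entry 1 d {0}"
        using entry_1_ge[of d "{0}"] bc by (intro mult_left_mono entry_nonneg) auto
      also have "\<dots> \<le> entry (1 + n + 1) {0} {0}" using bc by (intro entry_ge_mult) simp
      finally have "\<tau> * (\<tau> * entry n c d) \<le> entry (n + 2) {0} {0}" by simp
      then show ?thesis using \<tau>_pos by (simp add: E_def field_simps power2_eq_square)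
    qed
    have "ip H v ((T ^^ n) v) = (\<Sum>c\<in>J. \<Sum>d\<in>J. v c * (entry n c d * v d))"
      unfolding ipJ by (intro sum.cong refl) (simp add: Tn sum_distrib_left)
    also have "\<dots> \<le> (\<Sum>c\<in>J. \<Sum>d\<in>J. E * ((v c)\<^sup>2 / 2 + (v d)\<^sup>2 / 2))"
    proof (intro sum_mono)
      fix c d assume cd: "c \<in> J" "d \<in> J"
      have "0 \<le> (\<bar>v c\<bar> - \<bar>v d\<bar>)\<^sup>2" by simp
      then have a: "\<bar>v c\<bar> * \<bar>v d\<bar> \<le> (v c)\<^sup>2 / 2 + (v d)\<^sup>2 / 2" unfolding power2_diff by simp
      have "v c * (entry n c d * v d) \<le> \<bar>v c * (entry n c d * v d)\<bar>" by simp
      also have "\<dots> = entry n c d * (\<bar>v c\<bar> * \<bar>v d\<bar>)" by (simp add: abs_mult entry_nonneg)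
      also have "\<dots> \<le> E * ((v c)\<^sup>2 / 2 + (v d)\<^sup>2 / 2)"
        using a entE[OF cd] E by (intro mult_mono) auto
      finally show "v c * (entry n c d * v d) \<le> E * ((v c)\<^sup>2 / 2 + (v d)\<^sup>2 / 2)" .
    qed
    also have "\<dots> = E * (2 ^ H * ip H v v)"
      unfolding ipJ by (simp add: sum.distrib sum_distrib_left[symmetric] cJ sum_divide_distrib[symmetric] power2_eq_square)
    finally show ?thesis by (simp add: E_def)
  qed
  have "(p * \<Lambda>) ^ n * ip H v v \<le> entry (n + 2) {0} {0} / \<tau>\<^sup>2 * 2 ^ H * ip H v v"
    using low upper by (simp only: mult.assoc)
  from mult_right_le_imp_le[OF this vpos]
  have 1: "(p * \<Lambda>) ^ n \<le> entry (n + 2) {0} {0} / \<tau>\<^sup>2 * 2 ^ H" .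
  \<comment> \<open>\<open>8 ^ H\<close> is the \<open>2 ^ H\<close> of \<open>upper\<close> times
    \<open>4 ^ H\<close> for the two additional steps of the plus entry, since
    \<open>\<Lambda> \<le> 2 ^ H\<close>.\<close>
  have "\<tau>\<^sup>2 / 8 ^ H * q0 ^ n * entry (n + 2) {} {} \<le> \<tau>\<^sup>2 / 8 ^ H * p ^ n * (\<Lambda> ^ n * 4 ^ H)"
  proof (intro mult_mono)
    have "entry (n + 2) {} {} \<le> \<Lambda> ^ n * \<Lambda>\<^sup>2" using up[of "n + 2"] by (simp only: power_add)
    also have "\<Lambda>\<^sup>2 \<le> (2 ^ H)\<^sup>2" using L2 e(1) by (intro power_mono) auto
    also have "((2::real) ^ H)\<^sup>2 = 4 ^ H" by (simp add: power_mult[symmetric] mult.commute power2_eq_square power_mult_distrib[symmetric])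
    finally show "entry (n + 2) {} {} \<le> \<Lambda> ^ n * 4 ^ H" using e(1) by simp
    show "q0 ^ n \<le> p ^ n" using q0 by (intro power_mono) auto
  qed (use q0 p entry_nonneg in auto)
  also have "\<dots> = \<tau>\<^sup>2 * (4 ^ H / 8 ^ H) * (p * \<Lambda>) ^ n" by (simp add: power_mult_distrib)
  also have "\<dots> \<le> \<tau>\<^sup>2 * (4 ^ H / 8 ^ H) * (entry (n + 2) {0} {0} / \<tau>\<^sup>2 * 2 ^ H)"
    using 1 by (intro mult_left_mono) auto
  also have "\<dots> = entry (n + 2) {0} {0}"
  proof -
    have "(4::real) ^ H * 2 ^ H = 8 ^ H" by (simp add: power_mult_distrib[symmetric])
    then show ?thesis using \<tau>_pos by (simp add: field_simps)
  qed
  finally show ?thesis by (simp add: q0_def)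
qed

end

section \<open>Strip partition functions as transfer matrix entries\<close>

lemma sum_Pow_Un:
  assumes "A \<inter> B = {}"
  shows "(\<Sum>m\<in>Pow (A \<union> B). f m) = (\<Sum>a\<in>Pow A. \<Sum>b\<in>Pow B. f (a \<union> b))"
proof -
  have "(\<Sum>a\<in>Pow A. \<Sum>b\<in>Pow B. f (a \<union> b)) = (\<Sum>(a, b)\<in>Pow A \<times> Pow B. f (a \<union> b))"
    by (rule sum.cartesian_product)
  also have "\<dots> = (\<Sum>m\<in>Pow (A \<union> B). f m)"
    by (rule sum.reindex_bij_witness[where j = "\<lambda>(a, b). a \<union> b" and i = "\<lambda>m. (m \<inter> A, m \<inter> B)"])
      (use assms in auto)
  finally show ?thesis ..
qed

definition low :: "site set" where "low = {v. snd v < 0}"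

definition gcol :: "int \<Rightarrow> nat set \<Rightarrow> site set" where
  "gcol i c = {(a, b). a = i \<and> (\<exists>j\<in>c. b = int j - 1)}"

definition vedges :: "nat \<Rightarrow> int \<Rightarrow> (site \<times> site) set" where
  "vedges h i = (\<lambda>j. ((i, int j - 1), (i, int j))) ` {..h}"

definition hedges :: "nat \<Rightarrow> int \<Rightarrow> (site \<times> site) set" where
  "hedges h i = (\<lambda>j. ((i - 1, int j - 1), (i, int j - 1))) ` {1..h}"

definition redges :: "nat \<Rightarrow> nat \<Rightarrow> (site \<times> site) set" where
  "redges h L = (\<Union>i<L. vedges h (int i)) \<union> (\<Union>i\<le>L. hedges h (int i))"

definition rect :: "nat \<Rightarrow> nat \<Rightarrow> site set" where
  "rect h L = {0..<int L} \<times> {0..<int h}"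

lemma finite_edges: "finite (vedges h i)" "finite (hedges h i)" "finite (redges h L)"
  by (auto simp: vedges_def hedges_def redges_def)

lemma in_gcol: "(a, b) \<in> gcol i c \<longleftrightarrow> a = i \<and> (\<exists>j\<in>c. b = int j - 1)"
  by (simp add: gcol_def)

lemma in_gcol': "(a, int j - 1) \<in> gcol i c \<longleftrightarrow> a = i \<and> j \<in> c"
  by (auto simp: gcol_def)

lemma cut_vedges:
  assumes "\<And>j. j \<le> Suc h \<Longrightarrow> (i, int j - 1) \<in> P \<longleftrightarrow> j \<in> c"
  shows "cut (vedges h i) P = walls h c"
proof -
  have "cut (vedges h i) P = (\<Sum>j\<le>h. of_bool (((i, int j - 1) \<in> P) \<noteq> ((i, int j) \<in> P)))"
    unfolding cut_eq_sum[OF finite_edges(1)] unfolding vedges_def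
    by (subst sum.reindex) (auto simp: inj_on_def simp del: sum_of_bool_eq)
  also have "\<dots> = (\<Sum>j\<le>h. of_bool ((j \<in> c) \<noteq> (Suc j \<in> c)))"
  proof (rule sum.cong)
    fix j assume "j \<in> {..h}"
    then have "(i, int j - 1) \<in> P \<longleftrightarrow> j \<in> c" "(i, int (Suc j) - 1) \<in> P \<longleftrightarrow> Suc j \<in> c"
      by (intro assms; simp)+
    then show "of_bool (((i, int j - 1) \<in> P) \<noteq> ((i, int j) \<in> P)) = (of_bool ((j \<in> c) \<noteq> (Suc j \<in> c)) :: nat)"
      by simp
  qed simp
  finally show ?thesis by (simp add: walls_eq)
qed

lemma cut_hedges:
  assumes "\<And>j. j \<in> {1..h} \<Longrightarrow> (i - 1, int j - 1) \<in> P \<longleftrightarrow> j \<in> c"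
    "\<And>j. j \<in> {1..h} \<Longrightarrow> (i, int j - 1) \<in> P \<longleftrightarrow> j \<in> d" "c \<subseteq> {1..h}" "d \<subseteq> {1..h}"
  shows "cut (hedges h i) P = card (sd d c)"
proof -
  have "cut (hedges h i) P = (\<Sum>j\<in>{1..h}. of_bool (((i - 1, int j - 1) \<in> P) \<noteq> ((i, int j - 1) \<in> P)))"
    unfolding cut_eq_sum[OF finite_edges(2)] unfolding hedges_def
    by (subst sum.reindex) (auto simp: inj_on_def simp del: sum_of_bool_eq)
  also have "\<dots> = (\<Sum>j\<in>{1..h}. of_bool ((j \<in> c) \<noteq> (j \<in> d)))"
    by (rule sum.cong) (use assms in auto)
  also have "\<dots> = card ({1..h} \<inter> {j. (j \<in> c) \<noteq> (j \<in> d)})" by (simp add: sum_of_bool_eq)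
  also have "{1..h} \<inter> {j. (j \<in> c) \<noteq> (j \<in> d)} = sd d c"
    using assms(3,4) unfolding subset_iff by auto
  finally show ?thesis .
qed

locale strip = ising_transfer +
  fixes e :: "nat set" and D :: "site set"
  assumes eD: "e = {} \<and> D = {} \<or> e = {0} \<and> D = low"
begin

text \<open>Columns 0 to \<open>L - 1\<close> are summed out and column \<open>L\<close> is held at
  \<open>c\<close>. The walls of column \<open>L\<close> itself are not yet counted.\<close>

definition column_sum :: "nat \<Rightarrow> nat set \<Rightarrow> real" where
  "column_sum L c = (\<Sum>m\<in>Pow (rect H L). (y\<^sup>2) ^ cut (redges H L) (m \<union> D \<union> gcol (int L) c))"

lemma in_D: "(a, b) \<in> D \<longleftrightarrow> 0 \<in> e \<and> b < 0"
  using eD by (auto simp: low_def)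

lemma e_01: "e \<subseteq> {0}"
  using eD by auto

lemma column_L:
  assumes "m \<subseteq> rect H L" "j \<le> Suc H" "c \<subseteq> {1..H}"
  shows "(int L, int j - 1) \<in> m \<union> D \<union> gcol (int L) c \<longleftrightarrow> j \<in> e \<union> c"
proof -
  have "(int L, int j - 1) \<notin> m" using assms(1) by (auto simp: rect_def)
  moreover have "(int L, int j - 1) \<in> D \<longleftrightarrow> j \<in> e" using e_01 by (auto simp: in_D subset_iff)
  ultimately show ?thesis by (simp add: in_gcol')
qed

lemma column_sum_0:
  assumes "c \<subseteq> {1..H}"
  shows "column_sum 0 c = (y\<^sup>2) ^ card c"
proof -
  have r: "rect H 0 = {}" "redges H 0 = hedges H 0" by (auto simp: rect_def redges_def)
  have "cut (hedges H 0) (D \<union> gcol 0 c) = card (sd c {})"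
  proof (rule cut_hedges)
    fix j assume "j \<in> {1..H}"
    then show "((0::int) - 1, int j - 1) \<in> D \<union> gcol 0 c \<longleftrightarrow> j \<in> {}"
      "((0::int), int j - 1) \<in> D \<union> gcol 0 c \<longleftrightarrow> j \<in> c"
      by (auto simp: in_D in_gcol)
  qed (use assms in auto)
  then show ?thesis by (simp add: column_sum_def r)
qed

lemma column_sum_Suc:
  assumes c: "c \<subseteq> {1..H}"
  shows "column_sum (Suc L) c = (\<Sum>c'\<in>Pow {1..H}. (y\<^sup>2) ^ card (sd c c') * (y\<^sup>2) ^ walls H (e \<union> c') * column_sum L c')"
proof -
  have r: "rect H (Suc L) = rect H L \<union> gcol (int L) {1..H}"
  proof -
    have "b \<in> {0..<int H} \<longleftrightarrow> (\<exists>j\<in>{1..H}. b = int j - 1)" for b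
    proof
      assume "b \<in> {0..<int H}"
      then have "nat (b + 1) \<in> {1..H}" "b = int (nat (b + 1)) - 1" by auto
      then show "\<exists>j\<in>{1..H}. b = int j - 1" by blast
    qed auto
    then show ?thesis by (auto simp: rect_def gcol_def)
  qed
  have disj: "rect H L \<inter> gcol (int L) {1..H} = {}" by (auto simp: rect_def gcol_def)
  have P: "Pow (gcol (int L) {1..H}) = gcol (int L) ` Pow {1..H}"
  proof -
    have "s \<in> gcol (int L) ` Pow {1..H}" if "s \<subseteq> gcol (int L) {1..H}" for s
    proof (rule image_eqI)
      show "s = gcol (int L) {j \<in> {1..H}. (int L, int j - 1) \<in> s}" using that by (auto simp: gcol_def)
    qed auto
    then show ?thesis by (auto simp: gcol_def)
  qed
  have inj: "inj_on (gcol (int L)) (Pow {1..H})"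
  proof (rule inj_on_inverseI)
    fix s assume "s \<in> Pow {1..H}"
    show "{j. (int L, int j - 1) \<in> gcol (int L) s} = s" by (simp add: in_gcol')
  qed
  have E: "redges H (Suc L) = redges H L \<union> (vedges H (int L) \<union> hedges H (int (Suc L)))"
    by (auto simp: redges_def lessThan_Suc atMost_Suc)
  have Ed: "redges H L \<inter> (vedges H (int L) \<union> hedges H (int (Suc L))) = {}"
    "vedges H (int L) \<inter> hedges H (int (Suc L)) = {}"
    by (auto simp: redges_def vedges_def hedges_def)
  have step: "(y\<^sup>2) ^ cut (redges H (Suc L)) (m \<union> gcol (int L) c' \<union> D \<union> gcol (int (Suc L)) c)
      = (y\<^sup>2) ^ card (sd c c') * (y\<^sup>2) ^ walls H (e \<union> c') * (y\<^sup>2) ^ cut (redges H L) (m \<union> D \<union> gcol (int L) c')"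
    if m: "m \<subseteq> rect H L" and c': "c' \<subseteq> {1..H}" for m c'
  proof -
    let ?P = "m \<union> gcol (int L) c' \<union> D \<union> gcol (int (Suc L)) c"
    have 0: "cut (redges H L) ?P = cut (redges H L) (m \<union> D \<union> gcol (int L) c')"
      by (rule cut_cong) (auto simp: redges_def vedges_def hedges_def in_gcol)
    have "(int L, int j - 1) \<in> ?P \<longleftrightarrow> j \<in> e \<union> c'" if "j \<le> Suc H" for j
      using column_L[OF m that c'] by (auto simp: in_gcol)
    then have 1: "cut (vedges H (int L)) ?P = walls H (e \<union> c')" by (rule cut_vedges)
    have 2: "cut (hedges H (int (Suc L))) ?P = card (sd c c')"
    proof (rule cut_hedges)
      fix j assume j: "j \<in> {1..H}"
      show "(int (Suc L) - 1, int j - 1) \<in> ?P \<longleftrightarrow> j \<in> c'"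
        using column_L[OF m _ c', of j] j e_01 by (auto simp: in_gcol)
      have "(int (Suc L), int j - 1) \<notin> m" using m by (auto simp: rect_def)
      then show "(int (Suc L), int j - 1) \<in> ?P \<longleftrightarrow> j \<in> c"
        using j by (auto simp: in_gcol in_D)
    qed (use c c' in auto)
    have "cut (redges H (Suc L)) ?P = cut (redges H L) ?P + (cut (vedges H (int L)) ?P + cut (hedges H (int (Suc L))) ?P)"
      unfolding E cut_Un_disjoint[OF finite_edges(3) finite_UnI[OF finite_edges(1,2)] Ed(1)]
        cut_Un_disjoint[OF finite_edges(1,2) Ed(2)] ..
    then show ?thesis unfolding 0 1 2 by (simp only: power_add mult_ac)
  qed
  have "column_sum (Suc L) c = (\<Sum>m\<in>Pow (rect H L). \<Sum>s\<in>gcol (int L) ` Pow {1..H}.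
      (y\<^sup>2) ^ cut (redges H (Suc L)) (m \<union> s \<union> D \<union> gcol (int (Suc L)) c))"
    unfolding column_sum_def r sum_Pow_Un[OF disj] P ..
  also have "\<dots> = (\<Sum>m\<in>Pow (rect H L). \<Sum>c'\<in>Pow {1..H}.
      (y\<^sup>2) ^ cut (redges H (Suc L)) (m \<union> gcol (int L) c' \<union> D \<union> gcol (int (Suc L)) c))"
    by (subst sum.reindex[OF inj]) simp
  also have "\<dots> = (\<Sum>m\<in>Pow (rect H L). \<Sum>c'\<in>Pow {1..H}.
      (y\<^sup>2) ^ card (sd c c') * (y\<^sup>2) ^ walls H (e \<union> c') * (y\<^sup>2) ^ cut (redges H L) (m \<union> D \<union> gcol (int L) c'))"
    by (intro sum.cong refl step) auto
  also have "\<dots> = (\<Sum>c'\<in>Pow {1..H}. (y\<^sup>2) ^ card (sd c c') * (y\<^sup>2) ^ walls H (e \<union> c') * column_sum L c')"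
    unfolding column_sum_def sum_distrib_left by (rule sum.swap)
  finally show ?thesis .
qed

text \<open>An entry carries the square root of the wall weight at both of its end columns,
  \<open>column_sum\<close> at neither; apart from this, both obey the same recursion.\<close>

lemma entry_column_sum:
  assumes "c \<subseteq> {1..H}"
  shows "entry (Suc L) (e \<union> c) e = y ^ walls H (e \<union> c) * column_sum L c * y ^ walls H e"
  using assms
proof (induction L arbitrary: c)
  case 0
  have b: "outer (e \<union> c) = e" "(e \<union> c) \<inter> {1..H} = c" using 0 e_01 by (auto simp: outer_def)
  have "entry (Suc 0) (e \<union> c) e = (\<Sum>d\<in>Pow {1..H}. kern (e \<union> c) d * of_bool (e \<union> d = e))"
    by (simp add: entry_Suc entry_0 b)
  also have "\<dots> = (\<Sum>d\<in>Pow {1..H}. if d = {} then kern (e \<union> c) {} else 0)"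
  proof (rule sum.cong)
    fix d assume "d \<in> Pow {1..H}"
    then have "d \<inter> e = {}" using e_01 by (auto simp: subset_iff)
    then have "e \<union> d = e \<longleftrightarrow> d = {}" by blast
    then show "kern (e \<union> c) d * of_bool (e \<union> d = e) = (if d = {} then kern (e \<union> c) {} else 0)" by simp
  qed simp
  also have "\<dots> = kern (e \<union> c) {}" by (simp add: sum.delta)
  finally show ?case unfolding kern_def b column_sum_0[OF 0] by simp
next
  case (Suc L)
  have b: "outer (e \<union> c) = e" "(e \<union> c) \<inter> {1..H} = c" using Suc.prems e_01 by (auto simp: outer_def)
  have "entry (Suc (Suc L)) (e \<union> c) e = (\<Sum>c'\<in>Pow {1..H}. kern (e \<union> c) c' * entry (Suc L) (e \<union> c') e)"
    by (subst entry_Suc) (simp add: b)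
  also have "\<dots> = (\<Sum>c'\<in>Pow {1..H}. y ^ walls H (e \<union> c) *
      ((y\<^sup>2) ^ card (sd c c') * (y\<^sup>2) ^ walls H (e \<union> c') * column_sum L c') * y ^ walls H e)"
  proof (rule sum.cong)
    fix c' assume "c' \<in> Pow {1..H}"
    then have c': "c' \<subseteq> {1..H}" by auto
    have y2: "(y\<^sup>2) ^ k = y ^ k * y ^ k" for k by (simp add: power2_eq_square power_mult_distrib)
    show "kern (e \<union> c) c' * entry (Suc L) (e \<union> c') e =
      y ^ walls H (e \<union> c) * ((y\<^sup>2) ^ card (sd c c') * (y\<^sup>2) ^ walls H (e \<union> c') * column_sum L c') * y ^ walls H e"
      unfolding Suc.IH[OF c'] kern_def b y2[of "walls H (e \<union> c')"] by (simp only: mult_ac)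
  qed simp
  also have "\<dots> = y ^ walls H (e \<union> c) * column_sum (Suc L) c * y ^ walls H e"
    unfolding column_sum_Suc[OF Suc.prems] sum_distrib_left sum_distrib_right ..
  finally show ?case .
qed

text \<open>With all minus sites below height \<open>H\<close>, no edge above the strip is cut, so
  the edges of the box may be exchanged for those of the strip.\<close>

lemma cut_pedges:
  assumes "m \<subseteq> rect H (Suc N)" "H \<le> Suc N"
  shows "cut (pedges N) (m \<union> D) = cut (redges H (Suc N)) (m \<union> D)"
proof -
  have P: "(a, b) \<in> m \<union> D \<Longrightarrow> b < int H" for a b
    using assms(1) e_01 by (auto simp: rect_def in_D)
  have nn: "(a, b) \<in> m \<union> D \<longleftrightarrow> 0 \<in> e" if "b < 0" for a b
    using assms(1) that by (auto simp: rect_def in_D)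
  have 1: "ed \<in> redges H (Suc N)" if ed: "ed \<in> pedges N" "(fst ed \<in> m \<union> D) \<noteq> (snd ed \<in> m \<union> D)" for ed
  proof -
    obtain a b a' b' where [simp]: "ed = ((a, b), (a', b'))" by (metis surj_pair)
    consider "a' = a + 1" "b' = b" | "a' = a" "b' = b + 1" using ed(1) by (auto simp: pedges_def)
    then show ?thesis
    proof cases
      case 1
      then have ab: "0 \<le> a + 1" "a \<le> int N" "0 \<le> b" using ed(1) by (auto simp: pedges_def Lam_def)
      have "b < int H" using ed(2) P 1 by auto
      then have "ed \<in> hedges H (int (nat (a + 1)))" unfolding hedges_def
        using ab 1 by (intro image_eqI[of _ _ "nat (b + 1)"]) auto
      moreover have "nat (a + 1) \<le> Suc N" using ab by auto
      ultimately show ?thesis unfolding redges_def by blast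
    next
      case 2
      then have ab: "0 \<le> a" "a \<le> int N" "-1 \<le> b" using ed(1) by (auto simp: pedges_def Lam_def)
      have "b < int H" using ed(2) P[of a b] P[of a "b + 1"] 2 by auto
      then have "ed \<in> vedges H (int (nat a))" unfolding vedges_def
        using ab 2 by (intro image_eqI[of _ _ "nat (b + 1)"]) auto
      moreover have "nat a < Suc N" using ab by auto
      ultimately show ?thesis unfolding redges_def by blast
    qed
  qed
  have 2: "ed \<in> pedges N" if "ed \<in> redges H (Suc N)" "(fst ed \<in> m \<union> D) \<noteq> (snd ed \<in> m \<union> D)" for ed
    using that assms(2) by (auto simp: redges_def vedges_def hedges_def pedges_def Lam_def)
  show ?thesis unfolding cut_def by (rule arg_cong[where f = card]) (use 1 2 in auto)
qed

theorem strip_partition: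
  assumes "H \<le> Suc N"
  shows "entry (N + 2) e e = (y\<^sup>2) ^ card e * (\<Sum>m\<in>Pow (rect H (Suc N)). (y\<^sup>2) ^ cut (pedges N) (m \<union> D))"
proof -
  have g: "gcol i {} = {}" for i by (auto simp: gcol_def)
  have b: "walls H e = card e" using eD H1 by (auto simp: walls_eq sum_of_bool_eq)
  have "column_sum (Suc N) {} = (\<Sum>m\<in>Pow (rect H (Suc N)). (y\<^sup>2) ^ cut (pedges N) (m \<union> D))"
    unfolding column_sum_def g by (rule sum.cong) (auto simp: cut_pedges[OF _ assms])
  then show ?thesis
    using entry_column_sum[of "{}" "Suc N"] by (simp add: b power2_eq_square power_mult_distrib)
qed

end

section \<open>Partition functions in a field and their comparison\<close>

lemma finite_Lam: "finite (Lam N)"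
  by (simp add: Lam_def)

lemma finite_pedges: "finite (pedges N)"
proof (rule finite_subset)
  show "pedges N \<subseteq> ({-1..int N + 1} \<times> {-1..int N + 1}) \<times> ({-1..int N + 1} \<times> {-1..int N + 1})"
    by (auto simp: pedges_def Lam_def)
qed simp

(* D is the set of minus sites outside the box: \<open>low\<close> is the Dobrushin and \<open>{}\<close> the plus boundary
   condition. The field c corresponds to l = 2 c, up to the factor \<open>exp (c * card (Lam N))\<close>. *)
definition pf :: "real \<Rightarrow> nat \<Rightarrow> site set \<Rightarrow> real \<Rightarrow> (site set \<Rightarrow> bool) \<Rightarrow> real" where
  "pf x N D l A = (\<Sum>m\<in>Pow (Lam N). of_bool (A m) * (x ^ cut (pedges N) (m \<union> D) * exp (- l * real (card m))))"

lemma pf_nonneg: "0 \<le> x \<Longrightarrow> pf x N D l A \<ge> 0"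
  unfolding pf_def by (intro sum_nonneg mult_nonneg_nonneg) auto

text \<open>The form in which FKG is used below. The larger boundary set goes with the union, the
  smaller with the intersection, and the condition on \<open>l1\<close> to \<open>l4\<close> permits
  moving the stronger field to the intersection.\<close>

lemma pf_four:
  assumes x: "0 \<le> x" "x \<le> 1" and D: "D' \<subseteq> D" "D \<inter> Lam N = {}"
    and A: "\<And>a b. a \<subseteq> Lam N \<Longrightarrow> b \<subseteq> Lam N \<Longrightarrow> A a \<Longrightarrow> B b \<Longrightarrow> A' (a \<union> b) \<and> B' (a \<inter> b)"
    and l: "\<And>a b. a \<subseteq> Lam N \<Longrightarrow> b \<subseteq> Lam N \<Longrightarrow>
      l3 * real (card (a \<union> b)) + l4 * real (card (a \<inter> b)) \<le> l1 * real (card a) + l2 * real (card b)"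
  shows "pf x N D l1 A * pf x N D' l2 B \<le> pf x N D l3 A' * pf x N D' l4 B'"
  unfolding pf_def
proof (rule four_functions[OF finite_Lam])
  fix a b assume ab: "a \<subseteq> Lam N" "b \<subseteq> Lam N"
  have u: "(a \<union> b) \<union> D = (a \<union> D) \<union> (b \<union> D')" "(a \<inter> b) \<union> D' = (a \<union> D) \<inter> (b \<union> D')"
    using ab D by auto
  show "of_bool (A a) * (x ^ cut (pedges N) (a \<union> D) * exp (- l1 * real (card a))) *
       (of_bool (B b) * (x ^ cut (pedges N) (b \<union> D') * exp (- l2 * real (card b))))
       \<le> of_bool (A' (a \<union> b)) * (x ^ cut (pedges N) (a \<union> b \<union> D) * exp (- l3 * real (card (a \<union> b)))) *
          (of_bool (B' (a \<inter> b)) * (x ^ cut (pedges N) (a \<inter> b \<union> D') * exp (- l4 * real (card (a \<inter> b)))))"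
  proof (cases "A a \<and> B b")
    case True
    then have "A' (a \<union> b)" "B' (a \<inter> b)" using A[OF ab] by auto
    moreover have "(x ^ cut (pedges N) (a \<union> D) * x ^ cut (pedges N) (b \<union> D')) *
        (exp (- l1 * real (card a)) * exp (- l2 * real (card b)))
      \<le> (x ^ cut (pedges N) (a \<union> b \<union> D) * x ^ cut (pedges N) (a \<inter> b \<union> D')) *
        (exp (- l3 * real (card (a \<union> b))) * exp (- l4 * real (card (a \<inter> b))))"
      unfolding u exp_add[symmetric]
      using l[OF ab] x by (intro mult_mono power_cut_submodular finite_pedges) auto
    ultimately show ?thesis using True by (simp add: mult_ac)
  next
    case False
    then show ?thesis using x by (auto intro!: mult_nonneg_nonneg)
  qed
qed (use x in auto)

lemma low_Lam: "low \<inter> Lam N = {}"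
  by (auto simp: low_def Lam_def)

definition decay_rate :: "real \<Rightarrow> real" where
  "decay_rate x = x * (1 + x) / (1 - x)"

theorem partition_ratio:
  fixes b l :: real and N h :: nat
  defines "x \<equiv> exp (- 2 * b)"
  assumes x5: "x < 1 / 5" and l: "l \<ge> 0" and h: "2 \<le> h" "h \<le> Suc N"
  shows "pf x N low 0 (\<lambda>_. True) * pf x N {} l (\<lambda>_. True)
    \<le> exp (b * (8 * real h + 4) + ln 8 * real h + pi\<^sup>2 * decay_rate x / (1 - (decay_rate x)\<^sup>2) * real N / (real h)\<^sup>2 + l * (real h * (real N + 1)))
      * (pf x N low l (\<lambda>_. True) * pf x N {} 0 (\<lambda>_. True))"
proof -
  define y where "y = exp (- b)"
  have yx: "y\<^sup>2 = x" by (simp add: y_def x_def power2_eq_square exp_add[symmetric])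
  have x0: "0 < x" by (simp add: x_def)
  have y: "0 < y" "y < 1"
  proof -
    show "0 < y" by (simp add: y_def)
    have "y\<^sup>2 < 1" using x5 yx by simp
    then show "y < 1" using \<open>0 < y\<close> by (simp add: power_less_one_iff)
  qed
  interpret B0: strip y "Suc N" "{}" "{}" by unfold_locales (use y in auto)
  interpret B1: strip y "Suc N" "{0}" low by unfold_locales (use y in auto)
  interpret S0: strip y h "{}" "{}" by unfold_locales (use y h in auto)
  interpret S1: strip y h "{0}" low by unfold_locales (use y h in auto)
  define t where "t = decay_rate x"
  have th: "B0.\<theta> = t" "S0.\<theta> = t" by (simp_all add: B0.\<theta>_def S0.\<theta>_def t_def decay_rate_def yx)
  have t0: "0 < t" using B0.\<theta>_pos th by simp
  have t1: "t < 1"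
  proof -
    have "x * (1 + x) < 1 / 5 * (6 / 5)" using x5 x0 by (intro mult_strict_mono) auto
    also have "\<dots> < 1 - x" using x5 by simp
    finally show ?thesis using x5 by (simp add: t_def decay_rate_def)
  qed
  define Zs where "Zs = (\<lambda>k D. \<Sum>m\<in>Pow (rect k (Suc N)). x ^ cut (pedges N) (m \<union> D))"
  have rL: "rect (Suc N) (Suc N) = Lam N" by (auto simp: rect_def Lam_def)
  \<comment> \<open>The factor \<open>x\<close> is the boundary wall weight of
    \<open>strip_partition\<close> for \<open>e = {0}\<close>; it occurs in both estimates and
    cancels in the end.\<close>
  have box: "x * Zs (Suc N) low \<le> t ^ (N + 2) * Zs (Suc N) {}"
    using B0.entry_upper[of "N + 2"] t1 B0.strip_partition[of N] B1.strip_partition[of N]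
    by (simp add: th Zs_def yx)
  define \<kappa> where "\<kappa> = pi\<^sup>2 * t / (1 - t\<^sup>2)"
  have strip: "S0.\<tau>\<^sup>2 / 8 ^ h * (t * exp (- \<kappa> / (real h)\<^sup>2)) ^ N * Zs h {} \<le> x * Zs h low"
    using S0.entry_lower[of N] t1 h S0.strip_partition[of N] S1.strip_partition[of N]
    by (simp add: th Zs_def yx \<kappa>_def)
  let ?S = "rect h (Suc N)" and ?T = "\<lambda>_ :: site set. True"
  have SL: "?S \<subseteq> Lam N" using h by (auto simp: rect_def Lam_def)
  have cS: "real (card ?S) = real h * (real N + 1)" by (simp add: rect_def card_cartesian_product mult.commute)
  have pfS: "pf x N D l (\<lambda>m. m \<subseteq> ?S) = (\<Sum>m\<in>Pow ?S. x ^ cut (pedges N) (m \<union> D) * exp (- l * real (card m)))" for D l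
    unfolding pf_def by (rule sum.mono_neutral_cong_right) (use SL finite_Lam in auto)
  have pfZ: "pf x N D 0 ?T = Zs (Suc N) D" for D
    by (simp add: pf_def Zs_def rL)
  \<comment> \<open>Confinement to the strip is a decreasing event in the minus set, hence at least
    as likely under plus as under Dobrushin boundary conditions.\<close>
  have fkg: "pf x N low l (\<lambda>m. m \<subseteq> ?S) * pf x N {} l ?T \<le> pf x N low l ?T * pf x N {} l (\<lambda>m. m \<subseteq> ?S)"
  proof (rule pf_four)
    fix a b assume ab: "a \<subseteq> Lam N" "b \<subseteq> Lam N"
    have "card (a \<union> b) + card (a \<inter> b) = card a + card b"
      using card_Un_Int[of a b] ab finite_subset[OF _ finite_Lam] by auto
    then show "l * real (card (a \<union> b)) + l * real (card (a \<inter> b)) \<le> l * real (card a) + l * real (card b)"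
      by (simp add: distrib_left[symmetric] of_nat_add[symmetric] del: of_nat_add)
  qed (use x0 x5 low_Lam in auto)
  have fin: "finite m" if "m \<subseteq> ?S" for m using that finite_subset[OF _ finite_Lam] SL by blast
  have finS: "finite ?S" using fin by blast
  have lo: "exp (- l * (real h * (real N + 1))) * Zs h low \<le> pf x N low l (\<lambda>m. m \<subseteq> ?S)"
    unfolding pfS Zs_def sum_distrib_left
  proof (rule sum_mono)
    fix m assume m: "m \<in> Pow ?S"
    then have "real (card m) \<le> real h * (real N + 1)"
      using card_mono[OF finS, of m] by (simp flip: cS)
    then have "l * real (card m) \<le> l * (real h * (real N + 1))" using l by (rule mult_left_mono)
    then have "exp (- l * (real h * (real N + 1))) \<le> exp (- l * real (card m))" by simp
    from mult_left_mono[OF this, of "x ^ cut (pedges N) (m \<union> low)"] x0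
    show "exp (- l * (real h * (real N + 1))) * x ^ cut (pedges N) (m \<union> low)
      \<le> x ^ cut (pedges N) (m \<union> low) * exp (- l * real (card m))" by (simp add: mult.commute)
  qed
  have up: "pf x N {} l (\<lambda>m. m \<subseteq> ?S) \<le> Zs h {}"
    unfolding pfS Zs_def
  proof (rule sum_mono)
    fix m :: "site set"
    have "exp (- l * real (card m)) \<le> 1" using l by simp
    from mult_left_mono[OF this, of "x ^ cut (pedges N) (m \<union> {})"] x0
    show "x ^ cut (pedges N) (m \<union> {}) * exp (- l * real (card m)) \<le> x ^ cut (pedges N) (m \<union> {})" by simp
  qed
  have Zpos: "Zs h {} > 0"
    unfolding Zs_def by (rule sum_pos) (use x0 finS in auto)
  define P where "P = pf x N {} l ?T"
  define Q where "Q = pf x N low l ?T"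
  have PQ: "P \<ge> 0" "Q \<ge> 0" unfolding P_def Q_def using x0 by (auto intro: pf_nonneg)
  define k where "k = S0.\<tau>\<^sup>2 / 8 ^ h"
  have kpos: "k > 0" using S0.\<tau>_pos by (simp add: k_def)
  define E where "E = exp (- l * (real h * (real N + 1)))"
  define G where "G = exp (- \<kappa> / (real h)\<^sup>2) ^ N"
  have "E * (k * (t ^ N * G) * Zs h {}) * P \<le> E * (x * Zs h low) * P"
    using strip PQ unfolding k_def E_def G_def power_mult_distrib by (intro mult_right_mono mult_left_mono) auto
  also have "\<dots> = x * (E * Zs h low * P)" by simp
  also have "\<dots> \<le> x * (Q * Zs h {})"
  proof (rule mult_left_mono)
    have "E * Zs h low * P \<le> pf x N low l (\<lambda>m. m \<subseteq> ?S) * P"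
      using lo PQ unfolding E_def by (intro mult_right_mono) auto
    also have "\<dots> \<le> Q * pf x N {} l (\<lambda>m. m \<subseteq> ?S)" using fkg by (simp add: P_def Q_def)
    also have "\<dots> \<le> Q * Zs h {}" using up PQ by (intro mult_left_mono) auto
    finally show "E * Zs h low * P \<le> Q * Zs h {}" .
  qed (use x0 in simp)
  finally have "(E * k * (t ^ N * G) * P) * Zs h {} \<le> (x * Q) * Zs h {}" by (simp only: mult_ac)
  then have 1: "E * k * (t ^ N * G) * P \<le> x * Q" using Zpos by simp
  have EkG: "E * k * G > 0" using kpos by (simp add: E_def G_def)
  have "x * (Zs (Suc N) low * P) * (E * k * G) = (x * Zs (Suc N) low) * (P * (E * k * G))" by (simp only: mult_ac)
  also have "\<dots> \<le> (t ^ (N + 2) * Zs (Suc N) {}) * (P * (E * k * G))"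
    using PQ EkG by (intro mult_right_mono box) auto
  also have "\<dots> = (E * k * (t ^ N * G) * P) * (t\<^sup>2 * Zs (Suc N) {})" by (simp only: power_add mult_ac)
  also have "\<dots> \<le> (x * Q) * (1 * Zs (Suc N) {})"
  proof (rule mult_mono[OF 1])
    have Z: "0 \<le> Zs (Suc N) {}" unfolding Zs_def by (rule sum_nonneg) (use x0 in auto)
    show "t\<^sup>2 * Zs (Suc N) {} \<le> 1 * Zs (Suc N) {}"
      using t0 t1 Z by (intro mult_right_mono) (simp_all add: power_le_one)
    show "0 \<le> t\<^sup>2 * Zs (Suc N) {}" using Z by simp
  qed (use x0 PQ in auto)
  finally have "x * (Zs (Suc N) low * P * (E * k * G)) \<le> x * (Q * Zs (Suc N) {})" by (simp only: mult_ac mult_1_left)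
  then have "Zs (Suc N) low * P * (E * k * G) \<le> Q * Zs (Suc N) {}" using x0 by simp
  then have "Zs (Suc N) low * P \<le> inverse (E * k * G) * (Q * Zs (Suc N) {})"
    using EkG by (simp add: field_simps)
  also have "inverse (E * k * G) = exp (b * (8 * real h + 4) + ln 8 * real h + \<kappa> * real N / (real h)\<^sup>2 + l * (real h * (real N + 1)))"
  proof -
    have "k = exp (- b * (8 * real h + 4)) * exp (- ln 8 * real h)"
    proof -
      have "S0.\<tau> = exp (- b * (4 * real h + 2))"
        unfolding S0.\<tau>_def unfolding y_def
        by (simp only: exp_of_nat_mult[symmetric]) (simp add: algebra_simps)
      then have "S0.\<tau>\<^sup>2 = exp (- b * (8 * real h + 4))"
        by (simp add: power2_eq_square exp_add[symmetric] algebra_simps)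
      moreover have "8 ^ h = exp (ln 8 * real h)"
        by (simp add: exp_of_nat2_mult)
      ultimately show ?thesis by (simp add: k_def exp_minus divide_inverse)
    qed
    moreover have "G = exp (- \<kappa> * real N / (real h)\<^sup>2)"
      by (simp add: G_def exp_of_nat_mult[symmetric] mult.commute)
    ultimately show ?thesis
      by (simp add: E_def exp_minus exp_add mult_ac)
  qed
  finally show ?thesis unfolding pfZ P_def Q_def \<kappa>_def t_def .
qed

section \<open>Dual edges, parity and enclosed sites\<close>

definition hE :: "int \<Rightarrow> int \<Rightarrow> dedge" where "hE a b = ((a, b), (a + 1, b))"
definition vE :: "int \<Rightarrow> int \<Rightarrow> dedge" where "vE a b = ((a, b), (a, b + 1))"

lemma sep_E: "sep (hE a b) = ((a, b - 1), (a, b))" "sep (vE a b) = ((a - 1, b), (a, b))"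
  by (auto simp: sep_def hE_def vE_def)

lemma E_eq [simp]: "hE a b = hE c d \<longleftrightarrow> a = c \<and> b = d" "vE a b = vE c d \<longleftrightarrow> a = c \<and> b = d"
  "hE a b \<noteq> vE c d" "vE c d \<noteq> hE a b"
  by (auto simp: hE_def vE_def)

lemma is_dedge_iff: "is_dedge e \<longleftrightarrow> (\<exists>a b. e = hE a b \<or> e = vE a b)"
proof
  assume e: "is_dedge e"
  obtain a b q where "e = ((a, b), q)" by (metis surj_pair)
  with e have "e = hE a b \<or> e = vE a b" by (auto simp: is_dedge_def hE_def vE_def)
  then show "\<exists>a b. e = hE a b \<or> e = vE a b" by blast
qed (auto simp: is_dedge_def hE_def vE_def)

lemma is_dedge_E [simp]: "is_dedge (hE a b)" "is_dedge (vE a b)"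
  by (auto simp: is_dedge_iff)

lemma incident_E: "incident (a, b) (hE c d) \<longleftrightarrow> b = d \<and> (a = c \<or> a = c + 1)"
  "incident (a, b) (vE c d) \<longleftrightarrow> a = c \<and> (b = d \<or> b = d + 1)"
  by (auto simp: incident_def hE_def vE_def)

lemma dedges_E: "hE a b \<in> dedges N \<longleftrightarrow> (a, b - 1) \<in> Lam N \<or> (a, b) \<in> Lam N"
  "vE a b \<in> dedges N \<longleftrightarrow> (a - 1, b) \<in> Lam N \<or> (a, b) \<in> Lam N"
  by (auto simp: dedges_def sep_E)

lemma dedges_is_dedge: "e \<in> dedges N \<Longrightarrow> is_dedge e"
  by (simp add: dedges_def)

lemma sep_bij: "bij_betw sep (dedges N) (pedges N)"
  unfolding bij_betw_def
proof
  show "inj_on sep (dedges N)"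
  proof (rule inj_onI)
    fix e f assume "e \<in> dedges N" "f \<in> dedges N" and s: "sep e = sep f"
    then have "is_dedge e" "is_dedge f" by (simp_all add: dedges_is_dedge)
    then show "e = f" using s by (auto simp: is_dedge_iff sep_E)
  qed
  have "p \<in> sep ` dedges N" if p: "p \<in> pedges N" for p
  proof -
    obtain a b c d where [simp]: "p = ((a, b), (c, d))" by (metis surj_pair)
    consider "c = a + 1" "d = b" | "c = a" "d = b + 1" using p by (auto simp: pedges_def)
    then show ?thesis
    proof cases
      case 1
      then have "vE c d \<in> dedges N" "sep (vE c d) = p" using p by (auto simp: dedges_E sep_E pedges_def)
      then show ?thesis by (metis image_eqI)
    next
      case 2
      then have "hE c d \<in> dedges N" "sep (hE c d) = p" using p by (auto simp: dedges_E sep_E pedges_def)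
      then show ?thesis by (metis image_eqI)
    qed
  qed
  moreover have "sep e \<in> pedges N" if "e \<in> dedges N" for e
    using that dedges_is_dedge[OF that] by (auto simp: is_dedge_iff dedges_E sep_E pedges_def)
  ultimately show "sep ` dedges N = pedges N" by auto
qed

lemma finite_dedges: "finite (dedges N)"
  using sep_bij finite_pedges bij_betw_finite by blast

text \<open>Taken in the whole plane, so that parity holds at every dual vertex. The restriction
  \<open>contour_of\<close> loses nothing for a minus set inside the box.\<close>

definition bdry :: "site set \<Rightarrow> dedge set" where
  "bdry P = {e. is_dedge e \<and> (fst (sep e) \<in> P) \<noteq> (snd (sep e) \<in> P)}"

definition contour_of :: "nat \<Rightarrow> site set \<Rightarrow> dedge set" where
  "contour_of N P = dedges N \<inter> bdry P"

lemma bdry_E: "hE a b \<in> bdry P \<longleftrightarrow> ((a, b - 1) \<in> P) \<noteq> ((a, b) \<in> P)"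
  "vE a b \<in> bdry P \<longleftrightarrow> ((a - 1, b) \<in> P) \<noteq> ((a, b) \<in> P)"
  by (auto simp: bdry_def sep_E)

lemma finite_contour_of: "finite (contour_of N P)"
  by (simp add: contour_of_def finite_dedges)

lemma card_contour_of: "card (contour_of N P) = cut (pedges N) P"
proof -
  have "bij_betw sep (contour_of N P) {e \<in> pedges N. (fst e \<in> P) \<noteq> (snd e \<in> P)}"
  proof (rule bij_betw_subset[OF sep_bij])
    show "contour_of N P \<subseteq> dedges N" by (auto simp: contour_of_def)
    have "sep ` contour_of N P = {p \<in> sep ` dedges N. (fst p \<in> P) \<noteq> (snd p \<in> P)}"
      unfolding contour_of_def bdry_def using dedges_is_dedge by blast
    also have "sep ` dedges N = pedges N" using sep_bij by (simp add: bij_betw_def)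
    finally show "sep ` contour_of N P = {e \<in> pedges N. (fst e \<in> P) \<noteq> (snd e \<in> P)}" .
  qed
  then show ?thesis unfolding cut_def by (rule bij_betw_same_card)
qed

lemma bdry_sd: "bdry (sd P Q) = sd (bdry P) (bdry Q)"
  by (auto simp: bdry_def)

lemma contour_of_sd: "contour_of N (sd P Q) = sd (contour_of N P) (contour_of N Q)"
  unfolding contour_of_def bdry_sd by auto

lemma contour_of_eq_bdry: "m \<subseteq> Lam N \<Longrightarrow> contour_of N m = bdry m"
  unfolding contour_of_def bdry_def dedges_def by auto

text \<open>The parity of the degree as an exclusive or over the four possible edges, which makes it
  additive under \<open>sd\<close>.\<close>

definition odd_at :: "dedge set \<Rightarrow> dvert \<Rightarrow> bool" where
  "odd_at E q \<longleftrightarrow> (hE (fst q) (snd q) \<in> E) \<noteq> ((hE (fst q - 1) (snd q) \<in> E) \<noteq>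
     ((vE (fst q) (snd q) \<in> E) \<noteq> (vE (fst q) (snd q - 1) \<in> E)))"

definition even_edges :: "dedge set \<Rightarrow> bool" where
  "even_edges E \<longleftrightarrow> (\<forall>q. \<not> odd_at E q)"

lemma odd_at_sd: "odd_at (sd E F) q \<longleftrightarrow> odd_at E q \<noteq> odd_at F q"
  unfolding odd_at_def in_sd by argo

lemma odd_at_singleton: "is_dedge e \<Longrightarrow> odd_at {e} q \<longleftrightarrow> incident q e"
  by (cases q) (auto simp: odd_at_def is_dedge_iff incident_E)

lemma even_edges_bdry: "even_edges (bdry P)"
  unfolding even_edges_def odd_at_def by (auto simp: bdry_E)

lemma odd_at_imp_incident: "odd_at E q \<Longrightarrow> \<exists>e\<in>E. is_dedge e \<and> incident q e"
proof -
  obtain a b where q: "q = (a, b)" by (cases q)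
  assume "odd_at E q"
  then have "hE a b \<in> E \<or> hE (a - 1) b \<in> E \<or> vE a b \<in> E \<or> vE a (b - 1) \<in> E"
    unfolding odd_at_def q by auto
  moreover have "incident q (hE a b)" "incident q (hE (a - 1) b)" "incident q (vE a b)" "incident q (vE a (b - 1))"
    by (simp_all add: incident_E q)
  ultimately show ?thesis using is_dedge_E by blast
qed

definition ray :: "dedge set \<Rightarrow> site \<Rightarrow> int set" where
  "ray E v = {y. snd v < y \<and> hE (fst v) y \<in> E}"

(* Inside and outside are told apart by the parity of crossings of an upward ray, so that no Jordan
   curve theorem is needed. *)
definition enclosed :: "dedge set \<Rightarrow> site set" where
  "enclosed E = {v. odd (card (ray E v))}"

lemma finite_ray: "finite E \<Longrightarrow> finite (ray E v)"
proof -
  assume "finite E"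
  moreover have "hE (fst v) ` ray E v \<subseteq> E" by (auto simp: ray_def)
  ultimately have "finite (hE (fst v) ` ray E v)" by (rule finite_subset[rotated])
  then show ?thesis by (rule finite_imageD) (auto simp: inj_on_def)
qed

lemma card_sd_parity:
  assumes "finite A" "finite B"
  shows "odd (card (sd A B)) \<longleftrightarrow> odd (card A) \<noteq> odd (card B)"
proof -
  have "sd A B = (A - B) \<union> (B - A)" by auto
  then have "card (sd A B) = card (A - B) + card (B - A)"
    using assms by (simp add: card_Un_disjoint Diff_Int_distrib Int_commute inf_sup_aci(1) Int_Diff)
  moreover have "card A = card (A - B) + card (A \<inter> B)" "card B = card (B - A) + card (A \<inter> B)"
    using card_Int_Diff[OF assms(1), of B] card_Int_Diff[OF assms(2), of A] by (simp_all add: Int_commute)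
  ultimately show ?thesis by auto
qed

lemma enclosed_sd:
  assumes "finite E" "finite F"
  shows "enclosed (sd E F) = sd (enclosed E) (enclosed F)"
proof -
  have "ray (sd E F) v = sd (ray E v) (ray F v)" for v by (auto simp: ray_def)
  then show ?thesis unfolding enclosed_def by (auto simp: card_sd_parity finite_ray assms)
qed

lemma enclosed_vertical:
  assumes "finite E"
  shows "((a, b - 1) \<in> enclosed E) \<noteq> ((a, b) \<in> enclosed E) \<longleftrightarrow> hE a b \<in> E"
proof -
  have "ray E (a, b - 1) = (if hE a b \<in> E then insert b (ray E (a, b)) else ray E (a, b))"
    by (auto simp: ray_def) (smt (verit))+
  moreover have "b \<notin> ray E (a, b)" by (simp add: ray_def)
  ultimately show ?thesis by (simp add: enclosed_def finite_ray[OF assms])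
qed

lemma finite_bound:
  fixes E :: "dedge set"
  assumes "finite E"
  obtains B where "\<And>a b. hE a b \<in> E \<or> vE a b \<in> E \<Longrightarrow> b < B"
proof -
  have "finite ((\<lambda>e. snd (fst e)) ` E)" using assms by simp
  then obtain B where B: "\<And>z. z \<in> (\<lambda>e. snd (fst e)) ` E \<Longrightarrow> z \<le> B"
    by (meson bdd_above.E bdd_above_finite)
  show ?thesis
  proof (rule that[of "B + 1"])
    fix a b assume "hE a b \<in> E \<or> vE a b \<in> E"
    then have "b \<in> (\<lambda>e. snd (fst e)) ` E" by (force simp: hE_def vE_def)
    then show "b < B + 1" using B by fastforce
  qed
qed

lemma int_downward_induct:
  fixes B :: int
  assumes "\<And>b. b \<ge> B \<Longrightarrow> P b" "\<And>b. P (b + 1) \<Longrightarrow> P b"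
  shows "P b"
proof -
  have "P (B - int k)" for k
  proof (induction k)
    case (Suc k)
    then show ?case using assms(2)[of "B - int (Suc k)"] by simp
  qed (simp add: assms(1))
  from this[of "nat (B - b)"] show ?thesis using assms(1)[of b] by (cases "b \<ge> B") auto
qed

text \<open>Downward induction, starting above all edges. Going down a row, the two columns change
  by their horizontal edges, and evenness at the dual vertex \<open>(a, b + 1)\<close> matches this
  with the change in the vertical edge.\<close>

lemma enclosed_horizontal:
  assumes "finite E" "even_edges E"
  shows "((a - 1, b) \<in> enclosed E) \<noteq> ((a, b) \<in> enclosed E) \<longleftrightarrow> vE a b \<in> E"
proof -
  obtain B where B: "\<And>a b. hE a b \<in> E \<or> vE a b \<in> E \<Longrightarrow> b < B" using finite_bound[OF assms(1)] by blast
  show ?thesis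
  proof (induction b rule: int_downward_induct[where B = B])
    case (1 b)
    then have "ray E (c, b) = {}" for c using B by (force simp: ray_def)
    moreover have "vE a b \<notin> E" using B 1 by force
    ultimately show ?case by (simp add: enclosed_def)
  next
    case (2 b)
    have p: "\<not> odd_at E (a, b + 1)" using assms(2) by (simp add: even_edges_def)
    have h: "((c, b) \<in> enclosed E) \<noteq> ((c, b + 1) \<in> enclosed E) \<longleftrightarrow> hE c (b + 1) \<in> E" for c
      using enclosed_vertical[OF assms(1), of c "b + 1"] by simp
    show ?case using 2 p h[of a] h[of "a - 1"] unfolding odd_at_def by simp argo
  qed
qed

text \<open>This makes contours removable: flipping the sites of \<open>enclosed E\<close> changes a
  contour by exactly \<open>E\<close>.\<close>

lemma bdry_enclosed:
  assumes "finite E" "even_edges E" "\<And>e. e \<in> E \<Longrightarrow> is_dedge e"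
  shows "bdry (enclosed E) = E"
proof -
  have "e \<in> bdry (enclosed E) \<longleftrightarrow> e \<in> E" for e
  proof (cases "is_dedge e")
    case True
    then show ?thesis using enclosed_vertical[OF assms(1)] enclosed_horizontal[OF assms(1,2)]
      by (auto simp: is_dedge_iff bdry_E)
  next
    case False
    then show ?thesis using assms(3)[of e] by (auto simp: bdry_def)
  qed
  then show ?thesis by blast
qed

lemma enclosed_bdry:
  assumes "finite P" "finite (bdry P)"
  shows "enclosed (bdry P) = P"
proof -
  have "finite (snd ` P)" using assms by simp
  then obtain B where B: "\<And>z. z \<in> snd ` P \<Longrightarrow> z < B"
    by (metis bdd_above.E bdd_above_finite zle_add1_eq_le)
  have "(a, b) \<in> enclosed (bdry P) \<longleftrightarrow> (a, b) \<in> P" for a b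
  proof (induction b rule: int_downward_induct[where B = B])
    case (1 b)
    have n: "(a, y) \<notin> P" if "y \<ge> B" for y using B that by force
    then have "ray (bdry P) (a, b) = {}" using 1 by (auto simp: ray_def bdry_E)
    then show ?case using n[OF 1] by (simp add: enclosed_def)
  next
    case (2 b)
    then show ?case using enclosed_vertical[OF assms(2), of a "b + 1"] by (auto simp: bdry_E)
  qed
  then show ?thesis by auto
qed

lemma enclosed_row_const:
  assumes "finite E" "even_edges E" "\<And>a. vE a b \<notin> E"
  shows "(a, b) \<in> enclosed E \<longleftrightarrow> (a', b) \<in> enclosed E"
proof -
  have s: "(a, b) \<in> enclosed E \<longleftrightarrow> (a - 1, b) \<in> enclosed E" for a
    using enclosed_horizontal[OF assms(1,2), of a b] assms(3) by auto
  have "(a + int k, b) \<in> enclosed E \<longleftrightarrow> (a, b) \<in> enclosed E" for a k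
  proof (induction k)
    case (Suc k)
    then show ?case using s[of "a + int (Suc k)"] by (simp add: add.assoc)
  qed simp
  then show ?thesis by (metis add_diff_cancel_left' diff_add_cancel le_add_diff_inverse linear nat_0_le nonneg_int_cases zle_iff_zadd)
qed

lemma enclosed_box:
  assumes "finite E" "even_edges E"
    and box: "\<And>a b. hE a b \<in> E \<Longrightarrow> a0 \<le> a \<and> a \<le> a1 \<and> b \<le> b1"
      "\<And>a b. vE a b \<in> E \<Longrightarrow> b0 \<le> b"
  shows "enclosed E \<subseteq> {a0..a1} \<times> {b0..b1 - 1}"
proof
  fix v assume v: "v \<in> enclosed E"
  obtain a b where ab: "v = (a, b)" by (cases v)
  have col: "a0 \<le> a \<and> a \<le> a1 \<and> b < b1" if "(a, b) \<in> enclosed E" for a b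
  proof -
    have "ray E (a, b) \<noteq> {}" using that by (auto simp: enclosed_def)
    then obtain y where "b < y" "hE a y \<in> E" by (auto simp: ray_def)
    then show ?thesis using box(1)[of a y] by auto
  qed
  have "b0 \<le> b"
  proof (rule ccontr)
    assume "\<not> b0 \<le> b"
    then have "\<And>a. vE a b \<notin> E" using box(2) by force
    from enclosed_row_const[OF assms(1,2) this, of a "a0 - 1"] v ab have "(a0 - 1, b) \<in> enclosed E" by simp
    then show False using col by force
  qed
  then show "v \<in> {a0..a1} \<times> {b0..b1 - 1}" using col[of a b] v ab by auto
qed

lemma enclosed_Lam:
  assumes "even_edges E" "E \<subseteq> dedges N"
  shows "enclosed E \<subseteq> Lam N"
proof -
  have "enclosed E \<subseteq> {0..int N} \<times> {0..(int N + 1) - 1}"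
  proof (rule enclosed_box)
    show "finite E" using assms finite_dedges finite_subset by blast
  qed (use assms in \<open>auto simp: dedges_E Lam_def dest!: subsetD\<close>)
  then show ?thesis by (simp add: Lam_def)
qed

section \<open>Trails and loops\<close>

fun walk_edges :: "dvert list \<Rightarrow> dedge list" where
  "walk_edges (p # q # ps) = dedge_of p q # walk_edges (q # ps)"
| "walk_edges ps = []"

fun walk :: "dvert list \<Rightarrow> bool" where
  "walk (p # q # ps) = (dadj p q \<and> walk (q # ps))"
| "walk ps = True"

definition trail :: "dvert list \<Rightarrow> bool" where
  "trail ps \<longleftrightarrow> ps \<noteq> [] \<and> walk ps \<and> distinct (walk_edges ps)"

lemma dadj_cases:
  assumes "dadj (a, b) (c, d)"
  shows "c = a + 1 \<and> d = b \<or> c = a - 1 \<and> d = b \<or> c = a \<and> d = b + 1 \<or> c = a \<and> d = b - 1"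
  using assms unfolding dadj_def by auto

lemma dedge_of_dadj:
  assumes "dadj p q"
  shows "is_dedge (dedge_of p q)" "incident r (dedge_of p q) \<longleftrightarrow> r = p \<or> r = q" "p \<noteq> q"
    "dedge_of q p = dedge_of p q" "dadj q p"
  using assms dadj_cases[of "fst p" "snd p" "fst q" "snd q"]
  by (cases p; cases q; auto simp: dedge_of_def is_dedge_def incident_def dadj_def)+

lemma incident_dedge_of:
  assumes "is_dedge e" "incident p e"
  obtains q where "dadj q p" "dedge_of q p = e"
proof -
  obtain x y where p: "p = (x, y)" by (cases p)
  obtain a b where "e = hE a b \<or> e = vE a b" using assms(1) is_dedge_iff by auto
  then consider "e = hE x y" | "e = hE (x - 1) y" | "e = vE x y" | "e = vE x (y - 1)"
    using assms(2) by (auto simp: p incident_E)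
  then show ?thesis
  proof cases
    case 1 then show ?thesis by (intro that[of "(x + 1, y)"]) (auto simp: p dadj_def dedge_of_def hE_def)
  next
    case 2 then show ?thesis by (intro that[of "(x - 1, y)"]) (auto simp: p dadj_def dedge_of_def hE_def)
  next
    case 3 then show ?thesis by (intro that[of "(x, y + 1)"]) (auto simp: p dadj_def dedge_of_def vE_def)
  next
    case 4 then show ?thesis by (intro that[of "(x, y - 1)"]) (auto simp: p dadj_def dedge_of_def vE_def)
  qed
qed

lemma walk_edges_incident: "walk ps \<Longrightarrow> e \<in> set (walk_edges ps) \<Longrightarrow> incident r e \<Longrightarrow> r \<in> set ps"
  by (induction ps rule: walk_edges.induct) (auto simp: dedge_of_dadj)

lemma length_walk_edges: "length (walk_edges ps) = length ps - 1"
  by (induction ps rule: walk_edges.induct) auto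

lemma trail_par:
  "trail ps \<Longrightarrow> odd_at (set (walk_edges ps)) r \<longleftrightarrow> (r = hd ps) \<noteq> (r = last ps)"
proof (induction ps rule: walk_edges.induct)
  case (1 p q ps)
  let ?W = "set (walk_edges (q # ps))"
  have t: "trail (q # ps)" "dadj p q" "dedge_of p q \<notin> ?W" using 1(2) by (auto simp: trail_def)
  have "set (walk_edges (p # q # ps)) = sd ?W {dedge_of p q}" using t(3) by auto
  then have "odd_at (set (walk_edges (p # q # ps))) r \<longleftrightarrow> ((r = q) \<noteq> (r = last (q # ps))) \<noteq> (r = p \<or> r = q)"
    using 1(1)[OF t(1)] t(2) by (simp add: odd_at_sd odd_at_singleton dedge_of_dadj)
  then show ?case using dedge_of_dadj(3)[OF t(2)] by auto
qed (auto simp: trail_def odd_at_def)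

lemma closed_trail_exists:
  assumes fin: "finite E" and ev: "even_edges E" and dd: "\<And>e. e \<in> E \<Longrightarrow> is_dedge e" and ne: "E \<noteq> {}"
  obtains ps where "trail ps" "set (walk_edges ps) \<subseteq> E" "walk_edges ps \<noteq> []" "hd ps = last ps"
proof -
  define P where "P = (\<lambda>ps. trail ps \<and> set (walk_edges ps) \<subseteq> E \<and> walk_edges ps \<noteq> [])"
  have bound: "length (walk_edges ps) < Suc (card E)" if "P ps" for ps
  proof -
    have "length (walk_edges ps) = card (set (walk_edges ps))"
      using that by (simp add: P_def trail_def distinct_card)
    also have "\<dots> \<le> card E" using that fin by (intro card_mono) (auto simp: P_def)
    finally show ?thesis by simp
  qed
  obtain e where e: "e \<in> E" using ne by auto
  obtain p where "incident p e" unfolding incident_def by blast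
  then obtain q where q: "dadj q p" "dedge_of q p = e" using incident_dedge_of dd e by blast
  have P0: "P [q, p]" using q e by (simp add: P_def trail_def)
  obtain ps where ps: "P ps" "\<And>qs. P qs \<Longrightarrow> length (walk_edges qs) \<le> length (walk_edges ps)"
    using ex_has_greatest_nat[of P "[q, p]" "\<lambda>ps. length (walk_edges ps)" "Suc (card E)"] P0 bound
    by (metis less_imp_le)
  have "hd ps = last ps"
  proof (rule ccontr)
    assume "hd ps \<noteq> last ps"
    then have "odd_at (set (walk_edges ps)) (hd ps)" using ps(1) trail_par[of ps "hd ps"] by (simp add: P_def)
    moreover have "\<not> odd_at E (hd ps)" using ev unfolding even_edges_def by blast
    ultimately have "odd_at (sd E (set (walk_edges ps))) (hd ps)" by (simp add: odd_at_sd)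
    then obtain f where f: "f \<in> sd E (set (walk_edges ps))" "incident (hd ps) f" using odd_at_imp_incident by blast
    then have fE: "f \<in> E" "f \<notin> set (walk_edges ps)" using ps(1) by (auto simp: P_def)
    obtain r where r: "dadj r (hd ps)" "dedge_of r (hd ps) = f" using incident_dedge_of[OF dd[OF fE(1)] f(2)] .
    obtain s ss where s: "ps = s # ss" using ps(1) by (cases ps) (auto simp: P_def trail_def)
    have "P (r # ps)" using ps(1) fE r by (simp add: P_def trail_def s)
    from ps(2)[OF this] show False by (simp add: s)
  qed
  then show ?thesis using ps(1) that by (auto simp: P_def)
qed

lemma even_edges_closed: "trail ps \<Longrightarrow> hd ps = last ps \<Longrightarrow> even_edges (set (walk_edges ps))"
  by (simp add: even_edges_def trail_par)

text \<open>Closed trails are removed one after the other. Enclosure is additive modulo 2, so at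
  some stage the trail found encloses \<open>u\<close>.\<close>

lemma loop_around:
  assumes "finite E" "even_edges E" "\<And>e. e \<in> E \<Longrightarrow> is_dedge e" "u \<in> enclosed E"
  obtains ps where "trail ps" "set (walk_edges ps) \<subseteq> E" "hd ps = last ps" "u \<in> enclosed (set (walk_edges ps))"
proof -
  have "\<exists>ps. trail ps \<and> set (walk_edges ps) \<subseteq> E \<and> hd ps = last ps \<and> u \<in> enclosed (set (walk_edges ps))"
    using assms
  proof (induction "card E" arbitrary: E rule: less_induct)
    case less
    have ne: "E \<noteq> {}" using less.prems(4) by (auto simp: enclosed_def ray_def)
    obtain ps where ps: "trail ps" "set (walk_edges ps) \<subseteq> E" "walk_edges ps \<noteq> []" "hd ps = last ps"
      using closed_trail_exists[OF less.prems(1-3) ne] by blast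
    let ?W = "set (walk_edges ps)"
    show ?case
    proof (cases "u \<in> enclosed ?W")
      case True
      then show ?thesis using ps by blast
    next
      case False
      have sdE: "sd E ?W = E - ?W" using ps(2) by auto
      have "u \<in> enclosed (sd E ?W)" using False less.prems by (simp add: enclosed_sd)
      moreover have "even_edges (sd E ?W)"
        using less.prems(2) even_edges_closed[OF ps(1,4)] by (simp add: even_edges_def odd_at_sd)
      moreover have "card (sd E ?W) < card E"
      proof -
        have "hd (walk_edges ps) \<in> ?W" using ps(3) by simp
        then have "E - ?W \<subset> E" using ps(2) by blast
        then show ?thesis unfolding sdE by (rule psubset_card_mono[OF less.prems(1)])
      qed
      ultimately obtain qs where "trail qs" "set (walk_edges qs) \<subseteq> sd E ?W" "hd qs = last qs" "u \<in> enclosed (set (walk_edges qs))"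
        using less.hyps[of "sd E ?W"] less.prems(1,3) unfolding sdE by auto
      then show ?thesis unfolding sdE by blast
    qed
  qed
  then show ?thesis using that by blast
qed

lemma walk_box: "walk ps \<Longrightarrow> r \<in> set ps \<Longrightarrow>
  \<bar>fst r - fst (hd ps)\<bar> \<le> int (length (walk_edges ps)) \<and> \<bar>snd r - snd (hd ps)\<bar> \<le> int (length (walk_edges ps))"
proof (induction ps rule: walk_edges.induct)
  case (1 p q ps)
  have "\<bar>fst p - fst q\<bar> \<le> 1" "\<bar>snd p - snd q\<bar> \<le> 1" using 1(2) by (auto simp: dadj_def)
  then show ?case using 1 by auto
qed auto

lemma enclosed_trail_box:
  assumes "trail ps" "hd ps = last ps"
  defines "n \<equiv> int (length (walk_edges ps))"
  shows "enclosed (set (walk_edges ps)) \<subseteq> {fst (hd ps) - n..fst (hd ps) + n} \<times> {snd (hd ps) - n..snd (hd ps) + n - 1}"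
proof (rule enclosed_box)
  have a: "walk ps" using assms(1) by (simp add: trail_def)
  show "even_edges (set (walk_edges ps))" by (rule even_edges_closed[OF assms(1,2)])
  show "fst (hd ps) - n \<le> a \<and> a \<le> fst (hd ps) + n \<and> b \<le> snd (hd ps) + n" if "hE a b \<in> set (walk_edges ps)" for a b
    using walk_box[OF a walk_edges_incident[OF a that, of "(a, b)"]] by (auto simp: incident_E n_def)
  show "snd (hd ps) - n \<le> b" if "vE a b \<in> set (walk_edges ps)" for a b
    using walk_box[OF a walk_edges_incident[OF a that, of "(a, b)"]] by (auto simp: incident_E n_def)
qed simp

section \<open>Counting loops and Peierls bounds\<close>

definition walks :: "dvert \<Rightarrow> nat \<Rightarrow> dvert list set" where
  "walks p n = {ps. walk ps \<and> length ps = Suc n \<and> hd ps = p}"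

lemma walks_bound: "finite (walks p n) \<and> card (walks p n) \<le> 4 ^ n"
proof (induction n arbitrary: p)
  case 0
  have "walks p 0 = {[p]}" by (auto simp: walks_def length_Suc_conv)
  then show ?case by simp
next
  case (Suc n)
  define nb where "nb = {(fst p + 1, snd p), (fst p - 1, snd p), (fst p, snd p + 1), (fst p, snd p - 1)}"
  have cnb: "card nb \<le> 4" "finite nb"
    unfolding nb_def by (simp_all add: card_insert_if)
  have "walks p (Suc n) \<subseteq> (\<Union>q\<in>nb. (#) p ` walks q n)"
  proof
    fix ps assume "ps \<in> walks p (Suc n)"
    then obtain q qs where ps: "ps = p # q # qs" "dadj p q" "walk (q # qs)" "length (q # qs) = Suc n"
      by (auto simp: walks_def length_Suc_conv)
    have "q \<in> nb" using dadj_cases[of "fst p" "snd p" "fst q" "snd q"] ps(2) by (cases q) (auto simp: nb_def)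
    moreover have "q # qs \<in> walks q n" using ps by (simp add: walks_def)
    ultimately show "ps \<in> (\<Union>q\<in>nb. (#) p ` walks q n)" using ps(1) by blast
  qed
  moreover have f: "finite (\<Union>q\<in>nb. (#) p ` walks q n)" using cnb Suc by auto
  moreover have "card (\<Union>q\<in>nb. (#) p ` walks q n) \<le> (\<Sum>q\<in>nb. card ((#) p ` walks q n))"
    using cnb by (intro card_UN_le)
  moreover have "\<dots> \<le> (\<Sum>q\<in>nb. 4 ^ n)"
    using Suc by (intro sum_mono) (metis card_image_le order_trans)
  moreover have "\<dots> \<le> 4 * 4 ^ n" using cnb by simp
  ultimately show ?case using card_mono[OF f] finite_subset[OF _ f] by (smt (verit) power_Suc order_trans)
qed

text \<open>A loop of length n around a given site has at most (2 n + 1)^2 starting points and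
  encloses at most (2 n + 1)^2 sites, whence the fourth power. The ratio 4/5 bounds 4 x.\<close>

definition loop_const :: real where
  "loop_const = (\<Sum>n. (2 * real n + 1) ^ 4 * (4 / 5) ^ n)"

lemma summable_loop_const: "summable (\<lambda>n. (2 * real n + 1) ^ 4 * (4 / 5) ^ n)"
proof (rule summable_comparison_test_bigo)
  show "summable (\<lambda>n. norm (1 / real n ^ 2))"
    using inverse_power_summable[of 2, where 'a = real] by (simp add: divide_inverse)
  show "(\<lambda>n. (2 * real n + 1) ^ 4 * (4 / 5) ^ n) \<in> O(\<lambda>n. 1 / real n ^ 2)" by real_asymp
qed

definition loops :: "nat \<Rightarrow> site \<Rightarrow> dedge set set" where
  "loops N u = {W. W \<subseteq> dedges N \<and> u \<in> enclosed W \<and> (\<exists>ps. trail ps \<and> hd ps = last ps \<and> W = set (walk_edges ps))}"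

lemma finite_loops: "finite (loops N u)"
  by (rule finite_subset[of _ "Pow (dedges N)"]) (auto simp: loops_def finite_dedges)

lemma card_enclosed_loop:
  assumes "W \<in> loops N u"
  shows "finite (enclosed W)" "card (enclosed W) \<le> (2 * card W + 1)\<^sup>2"
proof -
  obtain ps where ps: "trail ps" "hd ps = last ps" "W = set (walk_edges ps)" using assms by (auto simp: loops_def)
  have l: "length (walk_edges ps) = card W" using ps by (simp add: trail_def distinct_card)
  let ?n = "int (card W)" and ?p = "hd ps"
  have s: "enclosed W \<subseteq> {fst ?p - ?n..fst ?p + ?n} \<times> {snd ?p - ?n..snd ?p + ?n - 1}"
    using enclosed_trail_box[OF ps(1,2)] unfolding l ps(3)[symmetric] .
  then show "finite (enclosed W)" by (rule finite_subset) simp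
  have "card (enclosed W) \<le> card ({fst ?p - ?n..fst ?p + ?n} \<times> {snd ?p - ?n..snd ?p + ?n - 1})"
    using s by (intro card_mono) auto
  also have "\<dots> \<le> (2 * card W + 1)\<^sup>2"
    unfolding card_cartesian_product power2_eq_square by (intro mult_mono) auto
  finally show "card (enclosed W) \<le> (2 * card W + 1)\<^sup>2" .
qed

lemma card_loops: "card {W \<in> loops N u. card W = n} \<le> (2 * n + 1)\<^sup>2 * 4 ^ n"
proof -
  let ?B = "{fst u - int n..fst u + int n} \<times> {snd u - int n + 1..snd u + int n}"
  have "{W \<in> loops N u. card W = n} \<subseteq> (\<lambda>ps. set (walk_edges ps)) ` (\<Union>p\<in>?B. walks p n)"
  proof
    fix W assume "W \<in> {W \<in> loops N u. card W = n}"
    then obtain ps where ps: "trail ps" "hd ps = last ps" "W = set (walk_edges ps)" "u \<in> enclosed W" "card W = n"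
      by (auto simp: loops_def)
    have l: "length (walk_edges ps) = n" using ps by (simp add: trail_def distinct_card)
    have "u \<in> {fst (hd ps) - int n..fst (hd ps) + int n} \<times> {snd (hd ps) - int n..snd (hd ps) + int n - 1}"
      using enclosed_trail_box[OF ps(1,2)] ps(4) unfolding l ps(3)[symmetric] by blast
    then have "hd ps \<in> ?B" by (cases u; cases "hd ps") auto
    moreover have "ps \<in> walks (hd ps) n" using ps(1) l length_walk_edges[of ps] by (cases ps) (auto simp: walks_def trail_def)
    ultimately have "ps \<in> (\<Union>p\<in>?B. walks p n)" by (rule UN_I)
    then show "W \<in> (\<lambda>ps. set (walk_edges ps)) ` (\<Union>p\<in>?B. walks p n)" unfolding ps(3) by (rule imageI)
  qed
  note sub = this
  have fin: "finite (\<Union>p\<in>?B. walks p n)" using walks_bound by (intro finite_UN_I) auto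
  have "card {W \<in> loops N u. card W = n} \<le> card ((\<lambda>ps. set (walk_edges ps)) ` (\<Union>p\<in>?B. walks p n))"
    using sub fin by (intro card_mono) auto
  also have "\<dots> \<le> card (\<Union>p\<in>?B. walks p n)" using fin by (rule card_image_le)
  also have "\<dots> \<le> (\<Sum>p\<in>?B. card (walks p n))" by (rule card_UN_le) simp
  also have "\<dots> \<le> (\<Sum>p\<in>?B. 4 ^ n)" by (intro sum_mono) (use walks_bound in blast)
  also have "\<dots> = card ?B * 4 ^ n" by simp
  also have "card ?B \<le> (2 * n + 1)\<^sup>2"
    unfolding card_cartesian_product power2_eq_square by (intro mult_mono) auto
  finally show ?thesis by simp
qed

lemma sum_loops:
  assumes "0 \<le> x" "x \<le> 1 / 5"
  shows "(\<Sum>W\<in>loops N u. (2 * real (card W) + 1)\<^sup>2 * x ^ card W) \<le> loop_const"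
proof -
  let ?g = "\<lambda>n. (2 * real n + 1)\<^sup>2 * x ^ n"
  have "(\<Sum>W\<in>loops N u. ?g (card W)) = (\<Sum>n\<in>card ` loops N u. \<Sum>W\<in>{W \<in> loops N u. card W = n}. ?g (card W))"
    by (rule sum.image_gen[OF finite_loops])
  also have "\<dots> = (\<Sum>n\<in>card ` loops N u. real (card {W \<in> loops N u. card W = n}) * ?g n)"
    by (intro sum.cong) auto
  also have "\<dots> \<le> (\<Sum>n\<in>card ` loops N u. (2 * real n + 1) ^ 4 * (4 / 5) ^ n)"
  proof (rule sum_mono)
    fix n
    have "real (card {W \<in> loops N u. card W = n}) \<le> real ((2 * n + 1)\<^sup>2 * 4 ^ n)"
      using card_loops of_nat_le_iff by blast
    then have "real (card {W \<in> loops N u. card W = n}) * ?g n \<le> real ((2 * n + 1)\<^sup>2 * 4 ^ n) * ?g n"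
      using assms by (intro mult_right_mono) auto
    also have "\<dots> = (2 * real n + 1) ^ 4 * (4 * x) ^ n"
    proof -
      have "real ((2 * n + 1)\<^sup>2 * 4 ^ n) = (2 * real n + 1)\<^sup>2 * 4 ^ n" by simp
      moreover have "(2 * real n + 1) ^ 4 = (2 * real n + 1)\<^sup>2 * (2 * real n + 1)\<^sup>2"
        by (simp flip: power_add)
      ultimately show ?thesis by (simp only: power_mult_distrib mult_ac)
    qed
    also have "\<dots> \<le> (2 * real n + 1) ^ 4 * (4 / 5) ^ n"
      using assms by (intro mult_left_mono power_mono) auto
    finally show "real (card {W \<in> loops N u. card W = n}) * ?g n \<le> (2 * real n + 1) ^ 4 * (4 / 5) ^ n" .
  qed
  also have "\<dots> \<le> loop_const"
    unfolding loop_const_def by (rule sum_le_suminf[OF summable_loop_const]) (use finite_loops in auto)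
  finally show ?thesis .
qed

text \<open>Flipping \<open>I\<close> is injective, and it erases \<open>\<gamma>\<close> from the
  contour, which lowers the energy by \<open>card \<gamma>\<close>. The right-hand side has no
  \<open>D\<close>: the flip may also absorb the boundary condition, so that loops and interfaces
  are covered together.\<close>

lemma peierls_flip:
  fixes x :: real
  assumes x: "0 \<le> x" and I: "I \<subseteq> Lam N"
    and contour_of: "\<And>m. m \<subseteq> Lam N \<Longrightarrow> contour_of N (sd m I) = sd (contour_of N (m \<union> D)) \<gamma>"
  shows "(\<Sum>m\<in>Pow (Lam N). of_bool (\<gamma> \<subseteq> contour_of N (m \<union> D)) * x ^ cut (pedges N) (m \<union> D))
    \<le> x ^ card \<gamma> * (\<Sum>m\<in>Pow (Lam N). x ^ cut (pedges N) m)"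
proof -
  have "(\<Sum>m\<in>Pow (Lam N). of_bool (\<gamma> \<subseteq> contour_of N (m \<union> D)) * x ^ cut (pedges N) (m \<union> D))
    \<le> (\<Sum>m\<in>Pow (Lam N). x ^ card \<gamma> * x ^ cut (pedges N) (sd m I))"
  proof (rule sum_mono)
    fix m assume m: "m \<in> Pow (Lam N)"
    show "of_bool (\<gamma> \<subseteq> contour_of N (m \<union> D)) * x ^ cut (pedges N) (m \<union> D) \<le> x ^ card \<gamma> * x ^ cut (pedges N) (sd m I)"
    proof (cases "\<gamma> \<subseteq> contour_of N (m \<union> D)")
      case True
      moreover have "contour_of N (sd m I) = sd (contour_of N (m \<union> D)) \<gamma>" using contour_of[of m] m by blast
      ultimately have "contour_of N (sd m I) = contour_of N (m \<union> D) - \<gamma>" by auto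
      then have "card (contour_of N (m \<union> D)) = card \<gamma> + card (contour_of N (sd m I))"
        using card_Diff_subset[OF finite_subset[OF True finite_contour_of] True] card_mono[OF finite_contour_of True] by simp
      then show ?thesis using True by (simp add: card_contour_of power_add)
    qed (use x in simp)
  qed
  also have "\<dots> = x ^ card \<gamma> * (\<Sum>m\<in>Pow (Lam N). x ^ cut (pedges N) m)"
    unfolding sum_distrib_left[symmetric] using sum_Pow_sd[OF I, of "\<lambda>m. x ^ cut (pedges N) m"] by simp
  finally show ?thesis .
qed

lemma peierls_even:
  fixes x :: real
  assumes "0 \<le> x" "even_edges W" "W \<subseteq> dedges N"
  shows "(\<Sum>m\<in>Pow (Lam N). of_bool (W \<subseteq> contour_of N m) * x ^ cut (pedges N) m)
    \<le> x ^ card W * (\<Sum>m\<in>Pow (Lam N). x ^ cut (pedges N) m)"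
proof -
  have fin: "finite W" using assms(3) finite_dedges finite_subset by blast
  have b: "bdry (enclosed W) = W"
    using assms(3) dedges_is_dedge by (intro bdry_enclosed fin assms) auto
  have "contour_of N (sd m (enclosed W)) = sd (contour_of N (m \<union> {})) W" for m
    unfolding contour_of_sd using b assms(3) by (auto simp: contour_of_def)
  from peierls_flip[OF assms(1) enclosed_Lam[OF assms(2,3)] this] show ?thesis by simp
qed

section \<open>Minus clusters\<close>

definition cluster :: "site set \<Rightarrow> site set \<Rightarrow> site set" where
  "cluster m F = {v. \<exists>u\<in>F \<inter> m. (u, v) \<in> {(a, b). a \<in> m \<and> b \<in> m \<and> dadj a b}\<^sup>*}"

definition neighbours :: "site set \<Rightarrow> site set" where
  "neighbours k = {w. \<exists>v\<in>k. dadj v w}"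

lemma cluster_subset: "cluster m F \<subseteq> m"
proof
  fix v assume "v \<in> cluster m F"
  then obtain u where "u \<in> m" "(u, v) \<in> {(a, b). a \<in> m \<and> b \<in> m \<and> dadj a b}\<^sup>*" by (auto simp: cluster_def)
  from this(2,1) show "v \<in> m" by (induction rule: rtrancl_induct) auto
qed

lemma cluster_F: "F \<inter> m \<subseteq> cluster m F"
  by (auto simp: cluster_def)

lemma cluster_step:
  assumes "v \<in> cluster m F" "dadj v w" "w \<in> m"
  shows "w \<in> cluster m F"
proof -
  have "v \<in> m" using assms(1) cluster_subset by blast
  then show ?thesis using assms unfolding cluster_def by (auto intro: rtrancl_into_rtrancl)
qed

lemma cluster_decomp:
  assumes k: "k = cluster m0 F" and m': "m' \<inter> (k \<union> neighbours k \<union> F) = {}"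
  shows "cluster (k \<union> m') F = k"
proof
  show "k \<subseteq> cluster (k \<union> m') F"
  proof
    fix v assume "v \<in> k"
    then obtain u where u: "u \<in> F \<inter> m0" and p: "(u, v) \<in> {(a, b). a \<in> m0 \<and> b \<in> m0 \<and> dadj a b}\<^sup>*"
      by (auto simp: k cluster_def)
    from p have "v \<in> k \<and> v \<in> cluster (k \<union> m') F"
    proof (induction rule: rtrancl_induct)
      case base
      then show ?case using u cluster_F[of F m0] cluster_F[of F "k \<union> m'"] k by auto
    next
      case (step w z)
      then have "z \<in> k" using cluster_step[of w m0 F z] k by auto
      then show ?case using step cluster_step[of w "k \<union> m'" F z] by auto
    qed
    then show "v \<in> cluster (k \<union> m') F" ..
  qed
  show "cluster (k \<union> m') F \<subseteq> k"
  proof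
    fix v assume "v \<in> cluster (k \<union> m') F"
    then obtain u where u: "u \<in> F \<inter> (k \<union> m')" and p: "(u, v) \<in> {(a, b). a \<in> k \<union> m' \<and> b \<in> k \<union> m' \<and> dadj a b}\<^sup>*"
      by (auto simp: cluster_def)
    from p show "v \<in> k"
    proof (induction rule: rtrancl_induct)
      case base
      then show ?case using u m' by auto
    next
      case (step w z)
      then have "z \<in> neighbours k" by (auto simp: neighbours_def)
      then show ?case using step m' by auto
    qed
  qed
qed

text \<open>A spatial Markov property: given the cluster \<open>k\<close>, the other minus sites are
  arbitrary away from \<open>k\<close>, its neighbours and \<open>F\<close>, as any minus site of
  \<open>F\<close> belongs to the cluster.\<close>

lemma cluster_fibre:
  assumes m0: "m0 \<subseteq> Lam N" and k: "k = cluster m0 F"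
  shows "{m \<in> Pow (Lam N). cluster m F = k} = (\<lambda>m'. k \<union> m') ` {m' \<in> Pow (Lam N). m' \<inter> (k \<union> neighbours k \<union> F) = {}}"
proof
  show "{m \<in> Pow (Lam N). cluster m F = k} \<subseteq> (\<lambda>m'. k \<union> m') ` {m' \<in> Pow (Lam N). m' \<inter> (k \<union> neighbours k \<union> F) = {}}"
  proof
    fix m assume m: "m \<in> {m \<in> Pow (Lam N). cluster m F = k}"
    have "(m - k) \<inter> neighbours k = {}" using m cluster_step[of _ m F] by (auto simp: neighbours_def)
    moreover have "(m - k) \<inter> F = {}" using m cluster_F[of F m] by auto
    ultimately have "(m - k) \<inter> (k \<union> neighbours k \<union> F) = {}" by blast
    then have "m - k \<in> {m' \<in> Pow (Lam N). m' \<inter> (k \<union> neighbours k \<union> F) = {}}" using m by blast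
    moreover have "m = k \<union> (m - k)" using m cluster_subset[of m F] by blast
    ultimately show "m \<in> (\<lambda>m'. k \<union> m') ` {m' \<in> Pow (Lam N). m' \<inter> (k \<union> neighbours k \<union> F) = {}}"
      by (rule image_eqI[rotated])
  qed
  have "k \<subseteq> Lam N" using m0 cluster_subset k by blast
  then show "(\<lambda>m'. k \<union> m') ` {m' \<in> Pow (Lam N). m' \<inter> (k \<union> neighbours k \<union> F) = {}} \<subseteq> {m \<in> Pow (Lam N). cluster m F = k}"
    using cluster_decomp[OF k] by auto
qed

lemma sep_dadj:
  assumes "is_dedge e" shows "dadj (fst (sep e)) (snd (sep e))"
  using assms by (auto simp: is_dedge_iff sep_E dadj_def)

lemma cut_separated:
  assumes "m' \<inter> (k \<union> neighbours k) = {}"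
  shows "cut (pedges N) (k \<union> m') = cut (pedges N) k + cut (pedges N) m'"
proof -
  have "contour_of N k \<inter> contour_of N m' = {}"
  proof (rule ccontr)
    assume "contour_of N k \<inter> contour_of N m' \<noteq> {}"
    then obtain e where e: "e \<in> contour_of N k" "e \<in> contour_of N m'" by auto
    then have "is_dedge e" using dedges_is_dedge[of e N] by (simp add: contour_of_def)
    note a = sep_dadj[OF this] dedge_of_dadj(5)[OF sep_dadj[OF this]]
    show False using e a assms by (auto simp: contour_of_def bdry_def neighbours_def)
  qed
  moreover have "contour_of N (k \<union> m') = sd (contour_of N k) (contour_of N m')"
  proof -
    have "k \<union> m' = sd k m'" using assms by auto
    then show ?thesis by (simp only: contour_of_sd)
  qed
  ultimately have "contour_of N (k \<union> m') = contour_of N k \<union> contour_of N m'" by auto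
  then show ?thesis using \<open>contour_of N k \<inter> contour_of N m' = {}\<close>
    by (simp add: card_contour_of[symmetric] card_Un_disjoint finite_contour_of)
qed

definition avoid :: "site set \<Rightarrow> site set \<Rightarrow> bool" where
  "avoid F m \<longleftrightarrow> m \<inter> F = {}"

lemma sum_cluster_fibre:
  assumes "m0 \<subseteq> Lam N" "k = cluster m0 F"
  shows "(\<Sum>m\<in>{m \<in> Pow (Lam N). cluster m F = k}. x ^ cut (pedges N) m * exp (- l * real (card m)))
    = x ^ cut (pedges N) k * exp (- l * real (card k)) * pf x N {} l (avoid (k \<union> neighbours k \<union> F))"
proof -
  let ?G = "k \<union> neighbours k \<union> F"
  have fk: "finite k" using assms cluster_subset finite_subset[OF _ finite_Lam] by (metis subset_trans)
  have "inj_on (\<lambda>m'. k \<union> m') {m' \<in> Pow (Lam N). m' \<inter> ?G = {}}" by (auto simp: inj_on_def)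
  then have "(\<Sum>m\<in>{m \<in> Pow (Lam N). cluster m F = k}. x ^ cut (pedges N) m * exp (- l * real (card m)))
    = (\<Sum>m'\<in>{m' \<in> Pow (Lam N). m' \<inter> ?G = {}}. x ^ cut (pedges N) (k \<union> m') * exp (- l * real (card (k \<union> m'))))"
    unfolding cluster_fibre[OF assms] by (simp add: sum.reindex)
  also have "\<dots> = (\<Sum>m'\<in>{m' \<in> Pow (Lam N). m' \<inter> ?G = {}}. x ^ cut (pedges N) k * exp (- l * real (card k)) *
      (x ^ cut (pedges N) m' * exp (- l * real (card m'))))"
  proof (rule sum.cong)
    fix m' assume m: "m' \<in> {m' \<in> Pow (Lam N). m' \<inter> ?G = {}}"
    then have "cut (pedges N) (k \<union> m') = cut (pedges N) k + cut (pedges N) m'"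
      by (intro cut_separated) auto
    moreover have "card (k \<union> m') = card k + card m'"
      using m fk finite_subset[OF _ finite_Lam] by (intro card_Un_disjoint) auto
    ultimately show "x ^ cut (pedges N) (k \<union> m') * exp (- l * real (card (k \<union> m'))) =
      x ^ cut (pedges N) k * exp (- l * real (card k)) * (x ^ cut (pedges N) m' * exp (- l * real (card m')))"
      by (simp add: power_add exp_diff exp_minus algebra_simps exp_add[symmetric] divide_inverse)
  qed simp
  also have "\<dots> = x ^ cut (pedges N) k * exp (- l * real (card k)) * pf x N {} l (avoid ?G)"
    unfolding pf_def sum_distrib_left
    by (rule sum.mono_neutral_cong_left) (auto simp: finite_Lam avoid_def)
  finally show ?thesis .
qed

lemma enclosed_contour_of: "m \<subseteq> Lam N \<Longrightarrow> enclosed (contour_of N m) = m"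
  using enclosed_bdry[of m] contour_of_eq_bdry[of m N] finite_contour_of[of N m] finite_subset[OF _ finite_Lam] by auto

text \<open>The contour contains a loop around each minus site of \<open>F\<close>. Its cluster
  cannot leave the loop: a crossing step would join two minus sites, while every edge of the loop
  separates unlike spins. So the enclosed area bounds the cluster.\<close>

lemma cluster_card_bound:
  assumes m: "m \<subseteq> Lam N" and F: "finite F"
  shows "real (card (cluster m F)) \<le> (\<Sum>u\<in>F. \<Sum>W\<in>loops N u. of_bool (W \<subseteq> contour_of N m) * (2 * real (card W) + 1)\<^sup>2)"
proof -
  let ?c = "\<lambda>u. cluster m {u}"
  have fin: "finite (cluster m A)" for A using m cluster_subset finite_subset[OF _ finite_Lam] by (metis subset_trans)
  have "cluster m F = (\<Union>u\<in>F. ?c u)" by (auto simp: cluster_def)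
  then have "card (cluster m F) \<le> (\<Sum>u\<in>F. card (?c u))" using card_UN_le[OF F] by simp
  then have "real (card (cluster m F)) \<le> (\<Sum>u\<in>F. real (card (?c u)))"
    by (metis of_nat_le_iff of_nat_sum)
  also have "\<dots> \<le> (\<Sum>u\<in>F. \<Sum>W\<in>loops N u. of_bool (W \<subseteq> contour_of N m) * (2 * real (card W) + 1)\<^sup>2)"
  proof (rule sum_mono)
    fix u
    show "real (card (?c u)) \<le> (\<Sum>W\<in>loops N u. of_bool (W \<subseteq> contour_of N m) * (2 * real (card W) + 1)\<^sup>2)"
    proof (cases "u \<in> m")
      case False
      then have "?c u = {}" by (auto simp: cluster_def)
      then show ?thesis by (simp add: sum_nonneg)
    next
      case True
      have ev: "even_edges (contour_of N m)" using contour_of_eq_bdry[OF m] even_edges_bdry by simp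
      obtain ps where ps: "trail ps" "set (walk_edges ps) \<subseteq> contour_of N m" "hd ps = last ps" "u \<in> enclosed (set (walk_edges ps))"
        using loop_around[OF finite_contour_of ev, of u] enclosed_contour_of[OF m] True
        by (metis (no_types, lifting) Int_iff contour_of_def dedges_is_dedge)
      define W where "W = set (walk_edges ps)"
      have W: "W \<in> loops N u" using ps by (auto simp: loops_def W_def contour_of_def)
      have Wb: "bdry (enclosed W) = W"
        unfolding W_def using ps(2) by (intro bdry_enclosed even_edges_closed[OF ps(1,3)]) (auto simp: contour_of_def dedges_is_dedge)
      have "?c u \<subseteq> enclosed W"
      proof
        fix v assume "v \<in> ?c u"
        then have "(u, v) \<in> {(a, b). a \<in> m \<and> b \<in> m \<and> dadj a b}\<^sup>*" by (auto simp: cluster_def)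
        then show "v \<in> enclosed W"
        proof (induction rule: rtrancl_induct)
          case base
          then show ?case using ps by (simp add: W_def)
        next
          case (step v w)
          then have vw: "v \<in> m" "w \<in> m" "dadj v w" by auto
          obtain a b c d where ab: "v = (a, b)" "w = (c, d)" by (metis surj_pair)
          have nb: "\<And>e. e \<in> W \<Longrightarrow> e \<in> bdry m" using ps(2) by (auto simp: W_def contour_of_def)
          have bW: "e \<in> bdry (enclosed W) \<longrightarrow> e \<in> bdry m" for e using Wb nb by simp
          show ?case
            using dadj_cases[OF vw(3)[unfolded ab]] vw(1,2) step.IH
              bW[of "vE c d"] bW[of "vE a b"] bW[of "hE c d"] bW[of "hE a b"]
            unfolding bdry_E ab by auto
        qed
      qed
      then have "card (?c u) \<le> (2 * card W + 1)\<^sup>2"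
        using card_enclosed_loop[OF W] card_mono by (metis order_trans)
      then have "real (card (?c u)) \<le> real ((2 * card W + 1)\<^sup>2)" by (rule of_nat_mono)
      also have "\<dots> = of_bool (W \<subseteq> contour_of N m) * (2 * real (card W) + 1)\<^sup>2"
        using ps(2) by (simp add: W_def)
      also have "\<dots> \<le> (\<Sum>W\<in>loops N u. of_bool (W \<subseteq> contour_of N m) * (2 * real (card W) + 1)\<^sup>2)"
        by (rule member_le_sum[OF W]) (auto simp: finite_loops)
      finally show ?thesis .
    qed
  qed
  finally show ?thesis .
qed

lemma expected_cluster:
  assumes x: "0 \<le> x" "x \<le> 1 / 5" and F: "finite F"
  shows "(\<Sum>m\<in>Pow (Lam N). x ^ cut (pedges N) m * real (card (cluster m F)))
    \<le> loop_const * real (card F) * (\<Sum>m\<in>Pow (Lam N). x ^ cut (pedges N) m)"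
proof -
  define Z where "Z = (\<Sum>m\<in>Pow (Lam N). x ^ cut (pedges N) m)"
  have Z: "Z \<ge> 0" unfolding Z_def using x by (intro sum_nonneg) auto
  have "(\<Sum>m\<in>Pow (Lam N). x ^ cut (pedges N) m * real (card (cluster m F)))
    \<le> (\<Sum>m\<in>Pow (Lam N). x ^ cut (pedges N) m * (\<Sum>u\<in>F. \<Sum>W\<in>loops N u. of_bool (W \<subseteq> contour_of N m) * (2 * real (card W) + 1)\<^sup>2))"
    using x by (intro sum_mono mult_left_mono cluster_card_bound F) auto
  also have "\<dots> = (\<Sum>m\<in>Pow (Lam N). \<Sum>u\<in>F. \<Sum>W\<in>loops N u. (2 * real (card W) + 1)\<^sup>2 * (of_bool (W \<subseteq> contour_of N m) * x ^ cut (pedges N) m))"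
    unfolding sum_distrib_left by (simp only: mult_ac)
  also have "\<dots> = (\<Sum>u\<in>F. \<Sum>m\<in>Pow (Lam N). \<Sum>W\<in>loops N u. (2 * real (card W) + 1)\<^sup>2 * (of_bool (W \<subseteq> contour_of N m) * x ^ cut (pedges N) m))"
    by (rule sum.swap)
  also have "\<dots> = (\<Sum>u\<in>F. \<Sum>W\<in>loops N u. (2 * real (card W) + 1)\<^sup>2 * (\<Sum>m\<in>Pow (Lam N). of_bool (W \<subseteq> contour_of N m) * x ^ cut (pedges N) m))"
    unfolding sum_distrib_left by (intro sum.cong refl sum.swap)
  also have "\<dots> \<le> (\<Sum>u\<in>F. \<Sum>W\<in>loops N u. (2 * real (card W) + 1)\<^sup>2 * (x ^ card W * Z))"
  proof (intro sum_mono mult_left_mono)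
    fix u W assume "W \<in> loops N u"
    then have "even_edges W" "W \<subseteq> dedges N" by (auto simp: loops_def even_edges_closed)
    then show "(\<Sum>m\<in>Pow (Lam N). of_bool (W \<subseteq> contour_of N m) * x ^ cut (pedges N) m) \<le> x ^ card W * Z"
      unfolding Z_def using x by (intro peierls_even)
  qed simp
  also have "\<dots> = (\<Sum>u\<in>F. (\<Sum>W\<in>loops N u. (2 * real (card W) + 1)\<^sup>2 * x ^ card W) * Z)"
    by (simp add: sum_distrib_right mult.assoc)
  also have "\<dots> \<le> (\<Sum>u\<in>F. loop_const * Z)"
    using Z x by (intro sum_mono mult_right_mono sum_loops) auto
  finally show ?thesis by (simp add: Z_def mult_ac)
qed

(* Given the minus cluster k of F, the rest is a plus system avoiding k, its neighbours and F, to which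
   FKG applies; the weights \<open>exp (- l * card k)\<close> are averaged by Jensen's inequality. *)
theorem pinning_cost:
  assumes x: "0 \<le> x" "x \<le> 1 / 5" and F: "finite F" and l: "0 \<le> l"
  shows "pf x N {} l (avoid F) * pf x N {} 0 (\<lambda>_. True)
    \<le> exp (l * loop_const * real (card F)) * (pf x N {} l (\<lambda>_. True) * pf x N {} 0 (avoid F))"
proof -
  define w where "w = (\<lambda>m. x ^ cut (pedges N) m)"
  define Z where "Z = (\<Sum>m\<in>Pow (Lam N). w m)"
  define K where "K = (\<lambda>m. cluster m F) ` Pow (Lam N)"
  define \<mu> where "\<mu> = l * loop_const * real (card F)"
  have w0: "w m \<ge> 0" for m using x by (simp add: w_def)
  have P0: "pf x N {} l A \<ge> 0" for l A using x by (simp add: pf_nonneg)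
  have fK: "finite K" by (simp add: K_def finite_Lam)
  have grp: "(\<Sum>m\<in>Pow (Lam N). f m) = (\<Sum>k\<in>K. \<Sum>m\<in>{m \<in> Pow (Lam N). cluster m F = k}. f m)" for f :: "site set \<Rightarrow> real"
    unfolding K_def by (rule sum.image_gen) (simp add: finite_Lam)
  have ZT: "pf x N {} 0 (\<lambda>_. True) = Z" by (simp add: pf_def Z_def w_def)
  have fib: "(\<Sum>m\<in>{m \<in> Pow (Lam N). cluster m F = k}. x ^ cut (pedges N) m * exp (- l * real (card m)))
    = x ^ cut (pedges N) k * exp (- l * real (card k)) * pf x N {} l (avoid (k \<union> neighbours k \<union> F))" if "k \<in> K" for k l
    using that sum_cluster_fibre[of _ N k F x l] by (auto simp: K_def)
  \<comment> \<open>Jensen's inequality via the tangent of exp (- t) at t = \<open>\<mu>\<close>,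
    where \<open>\<mu>\<close> bounds the mean of \<open>l * card (cluster m F)\<close> by
    \<open>expected_cluster\<close>.\<close>
  have E: "exp (- \<mu>) * Z \<le> (\<Sum>m\<in>Pow (Lam N). w m * exp (- l * real (card (cluster m F))))"
  proof -
    have "(\<Sum>m\<in>Pow (Lam N). w m * (exp (- \<mu>) * (1 + (\<mu> - l * real (card (cluster m F))))))
      \<le> (\<Sum>m\<in>Pow (Lam N). w m * exp (- l * real (card (cluster m F))))"
    proof (intro sum_mono mult_left_mono w0)
      fix m
      have "exp (- \<mu>) * (1 + (\<mu> - l * real (card (cluster m F)))) \<le> exp (- \<mu>) * exp (\<mu> - l * real (card (cluster m F)))"
        by (intro mult_left_mono exp_ge_add_one_self) simp
      also have "\<dots> = exp (- l * real (card (cluster m F)))" by (simp add: exp_add[symmetric])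
      finally show "exp (- \<mu>) * (1 + (\<mu> - l * real (card (cluster m F)))) \<le> exp (- l * real (card (cluster m F)))" .
    qed
    moreover have "(\<Sum>m\<in>Pow (Lam N). w m * (exp (- \<mu>) * (1 + (\<mu> - l * real (card (cluster m F))))))
      = exp (- \<mu>) * (Z + \<mu> * Z - l * (\<Sum>m\<in>Pow (Lam N). w m * real (card (cluster m F))))"
      unfolding Z_def sum_distrib_left right_diff_distrib sum_subtractf[symmetric] sum.distrib[symmetric]
      by (intro sum.cong refl) (simp add: algebra_simps)
    moreover have "l * (\<Sum>m\<in>Pow (Lam N). w m * real (card (cluster m F))) \<le> \<mu> * Z"
      using mult_left_mono[OF expected_cluster[OF x F, of N] l] by (simp add: w_def Z_def \<mu>_def mult_ac)
    then have "exp (- \<mu>) * Z \<le> exp (- \<mu>) * (Z + \<mu> * Z - l * (\<Sum>m\<in>Pow (Lam N). w m * real (card (cluster m F))))"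
      by (intro mult_left_mono) auto
    ultimately show ?thesis by linarith
  qed
  have "pf x N {} l (avoid F) * (exp (- \<mu>) * Z)
    \<le> pf x N {} l (avoid F) * (\<Sum>m\<in>Pow (Lam N). w m * exp (- l * real (card (cluster m F))))"
    by (intro mult_left_mono E P0)
  also have "(\<Sum>m\<in>Pow (Lam N). w m * exp (- l * real (card (cluster m F))))
    = (\<Sum>k\<in>K. exp (- l * real (card k)) * (x ^ cut (pedges N) k * pf x N {} 0 (avoid (k \<union> neighbours k \<union> F))))"
    unfolding grp
  proof (intro sum.cong refl)
    fix k assume "k \<in> K"
    have "(\<Sum>m\<in>{m \<in> Pow (Lam N). cluster m F = k}. w m * exp (- l * real (card (cluster m F))))
      = exp (- l * real (card k)) * (\<Sum>m\<in>{m \<in> Pow (Lam N). cluster m F = k}. w m)"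
      unfolding sum_distrib_left by (intro sum.cong) auto
    then show "(\<Sum>m\<in>{m \<in> Pow (Lam N). cluster m F = k}. w m * exp (- l * real (card (cluster m F))))
      = exp (- l * real (card k)) * (x ^ cut (pedges N) k * pf x N {} 0 (avoid (k \<union> neighbours k \<union> F)))"
      using fib[OF \<open>k \<in> K\<close>, of 0] by (simp add: w_def)
  qed
  also have "pf x N {} l (avoid F) * \<dots> = (\<Sum>k\<in>K. exp (- l * real (card k)) * x ^ cut (pedges N) k *
      (pf x N {} l (avoid F) * pf x N {} 0 (avoid (k \<union> neighbours k \<union> F))))"
    unfolding sum_distrib_left by (simp only: mult_ac)
  also have "\<dots> \<le> (\<Sum>k\<in>K. exp (- l * real (card k)) * x ^ cut (pedges N) k *
      (pf x N {} 0 (avoid F) * pf x N {} l (avoid (k \<union> neighbours k \<union> F))))"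
  proof (intro sum_mono mult_left_mono)
    fix k
    \<comment> \<open>Avoiding a larger set leaves fewer minus spins, so the field costs less there:
      it may be moved from the system avoiding \<open>F\<close> to the more constrained one.\<close>
    show "pf x N {} l (avoid F) * pf x N {} 0 (avoid (k \<union> neighbours k \<union> F))
      \<le> pf x N {} 0 (avoid F) * pf x N {} l (avoid (k \<union> neighbours k \<union> F))"
    proof (rule pf_four)
      fix a b assume ab: "a \<subseteq> Lam N" "b \<subseteq> Lam N"
      have "card (a \<inter> b) \<le> card a" using ab finite_subset[OF _ finite_Lam] by (intro card_mono) auto
      then show "0 * real (card (a \<union> b)) + l * real (card (a \<inter> b)) \<le> l * real (card a) + 0 * real (card b)"
        using l by (simp add: mult_left_mono)
    qed (use x in \<open>auto simp: avoid_def\<close>)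
  qed (use x in auto)
  also have "\<dots> = pf x N {} 0 (avoid F) * (\<Sum>k\<in>K. \<Sum>m\<in>{m \<in> Pow (Lam N). cluster m F = k}. w m * exp (- l * real (card m)))"
    unfolding sum_distrib_left[where r = "pf x N {} 0 (avoid F)" and A = K]
  proof (intro sum.cong refl)
    fix k assume "k \<in> K"
    from fib[OF this, of l]
    show "exp (- l * real (card k)) * x ^ cut (pedges N) k * (pf x N {} 0 (avoid F) * pf x N {} l (avoid (k \<union> neighbours k \<union> F)))
      = pf x N {} 0 (avoid F) * (\<Sum>m\<in>{m \<in> Pow (Lam N). cluster m F = k}. w m * exp (- l * real (card m)))"
      unfolding w_def by (simp only: mult_ac)
  qed
  also have "\<dots> = pf x N {} 0 (avoid F) * pf x N {} l (\<lambda>_. True)"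
    unfolding grp[symmetric] by (simp add: pf_def w_def)
  finally have "exp \<mu> * (pf x N {} l (avoid F) * (exp (- \<mu>) * Z)) \<le> exp \<mu> * (pf x N {} 0 (avoid F) * pf x N {} l (\<lambda>_. True))"
    by (rule mult_left_mono) simp
  moreover have "exp \<mu> * (pf x N {} l (avoid F) * (exp (- \<mu>) * Z)) = pf x N {} l (avoid F) * Z"
    by (simp add: exp_minus)
  ultimately show ?thesis unfolding ZT \<mu>_def by (simp only: mult_ac)
qed

section \<open>The interface\<close>

text \<open>\<open>joined\<close> hides the dual vertex at which two edges meet; following a trail
  from vertex to vertex requires it.\<close>

definition linked :: "dedge set \<Rightarrow> dvert \<Rightarrow> dedge \<Rightarrow> dedge \<Rightarrow> bool" where
  "linked S d e f \<longleftrightarrow> e \<noteq> f \<and> e \<in> S \<and> f \<in> S \<and> incident d e \<and> incident d f \<and>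
     (ddeg S d = 2 \<or> {e, f} = {vE (fst d) (snd d - 1), hE (fst d) (snd d)}
       \<or> {e, f} = {vE (fst d) (snd d), hE (fst d - 1) (snd d)})"

lemma joined_linked: "joined S e f \<longleftrightarrow> (\<exists>d. linked S d e f)"
proof -
  have "((fst d, snd d - 1), d) = vE (fst d) (snd d - 1)" "(d, (fst d + 1, snd d)) = hE (fst d) (snd d)"
    "(d, (fst d, snd d + 1)) = vE (fst d) (snd d)" "((fst d - 1, snd d), d) = hE (fst d - 1) (snd d)" for d :: dvert
    by (simp_all add: vE_def hE_def)
  then show ?thesis unfolding joined_def linked_def by auto
qed

lemma linked_sym: "linked S d e f \<Longrightarrow> linked S d f e"
  unfolding linked_def by (simp add: insert_commute eq_commute[of e f])

text \<open>At most one partner at each end of an edge: pieces can be followed without a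
  choice.\<close>

lemma linked_unique:
  assumes "finite S" "linked S d e f" "linked S d e g"
  shows "f = g"
proof (cases "ddeg S d = 2")
  case True
  show ?thesis
  proof (rule ccontr)
    assume "f \<noteq> g"
    then have "card {e, f, g} = 3" using assms(2,3) by (auto simp: linked_def)
    moreover have "card {e, f, g} \<le> card {e \<in> S. incident d e}"
      using assms by (intro card_mono) (auto simp: linked_def)
    ultimately show False using True by (simp add: ddeg_def)
  qed
next
  case False
  then show ?thesis using assms(2,3) by (auto simp: linked_def doubleton_eq_iff)
qed

lemma incident_cases:
  assumes "is_dedge e" "incident (a, b) e"
  shows "e = hE a b \<or> e = hE (a - 1) b \<or> e = vE a b \<or> e = vE a (b - 1)"
  using assms by (auto simp: is_dedge_iff incident_E)

lemma ddeg_sum: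
  assumes "\<And>e. e \<in> S \<Longrightarrow> is_dedge e"
  shows "ddeg S (a, b) = of_bool (hE a b \<in> S) + of_bool (hE (a - 1) b \<in> S) + of_bool (vE a b \<in> S) + of_bool (vE a (b - 1) \<in> S)"
proof -
  have "{e \<in> S. incident (a, b) e} = S \<inter> {hE a b, hE (a - 1) b, vE a b, vE a (b - 1)}"
  proof -
    have "incident (a, b) (hE a b)" "incident (a, b) (hE (a - 1) b)" "incident (a, b) (vE a b)" "incident (a, b) (vE a (b - 1))"
      by (simp_all add: incident_E)
    then show ?thesis using incident_cases assms by blast
  qed
  then show ?thesis by (simp add: ddeg_def Int_insert_right card_insert_if)
qed

text \<open>At a vertex of even degree that meets \<open>e\<close> the degree is 2 or 4. In the
  latter case all four edges are present, and the splitting rule names the partner.\<close>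

lemma linked_exists:
  assumes S: "\<And>e. e \<in> S \<Longrightarrow> is_dedge e" and p: "\<not> odd_at S d" and e: "e \<in> S" "incident d e"
  shows "\<exists>f. linked S d e f"
proof -
  obtain a b where d: "d = (a, b)" by (cases d)
  have i: "incident d (hE a b)" "incident d (hE (a - 1) b)" "incident d (vE a b)" "incident d (vE a (b - 1))"
    by (simp_all add: d incident_E)
  have dg: "ddeg S d = of_bool (hE a b \<in> S) + of_bool (hE (a - 1) b \<in> S) + of_bool (vE a b \<in> S) + of_bool (vE a (b - 1) \<in> S)"
    unfolding d by (rule ddeg_sum[OF S])
  have J: "linked S d e f" if "f \<in> S" "f \<noteq> e" "incident d f" "ddeg S d = 2" for f
    using that e by (simp add: linked_def)
  have ec: "e = hE a b \<or> e = hE (a - 1) b \<or> e = vE a b \<or> e = vE a (b - 1)"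
    using incident_cases S e d by blast
  show ?thesis
  proof (cases "ddeg S d = 2")
    case True
    then have "{e' \<in> S. incident d e'} \<noteq> {e}" by (auto simp: ddeg_def)
    then obtain f where "f \<in> S" "incident d f" "f \<noteq> e" using e by blast
    then show ?thesis using J True by blast
  next
    case False
    have "hE a b \<in> S \<or> hE (a - 1) b \<in> S \<or> vE a b \<in> S \<or> vE a (b - 1) \<in> S" using ec e(1) by blast
    then have all: "hE a b \<in> S \<and> hE (a - 1) b \<in> S \<and> vE a b \<in> S \<and> vE a (b - 1) \<in> S"
      using False[unfolded dg] p[unfolded odd_at_def d fst_conv snd_conv]
      by (cases "hE a b \<in> S"; cases "hE (a - 1) b \<in> S"; cases "vE a b \<in> S"; cases "vE a (b - 1) \<in> S") simp_all
    from ec show ?thesis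
    proof (elim disjE)
      assume "e = hE a b"
      then show ?thesis using all i by (intro exI[of _ "vE a (b - 1)"]) (auto simp: linked_def d)
    next
      assume "e = hE (a - 1) b"
      then show ?thesis using all i by (intro exI[of _ "vE a b"]) (auto simp: linked_def d)
    next
      assume "e = vE a b"
      then show ?thesis using all i by (intro exI[of _ "hE (a - 1) b"]) (auto simp: linked_def d)
    next
      assume "e = vE a (b - 1)"
      then show ?thesis using all i by (intro exI[of _ "hE a b"]) (auto simp: linked_def d)
    qed
  qed
qed

lemma linked_local:
  assumes "\<And>e. incident d e \<Longrightarrow> e \<in> S \<longleftrightarrow> e \<in> S'"
  shows "linked S d e f \<longleftrightarrow> linked S' d e f"
proof -
  have "ddeg S d = ddeg S' d" unfolding ddeg_def using assms by (metis (no_types, lifting))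
  then show ?thesis unfolding linked_def using assms[of e] assms[of f] by metis
qed

fun linked_walk :: "dedge set \<Rightarrow> dvert list \<Rightarrow> bool" where
  "linked_walk S (p # q # r # ps) = (linked S q (dedge_of p q) (dedge_of q r) \<and> linked_walk S (q # r # ps))"
| "linked_walk S ps = True"

lemma linked_walk_tl: "linked_walk S (p # ps) \<Longrightarrow> linked_walk S ps"
  by (cases ps; cases "tl ps") auto

text \<open>At an inner vertex of the trail the partner of an edge is its successor or predecessor,
  by \<open>linked_unique\<close>. Only the two ends of the trail are exceptional.\<close>

lemma linked_walk_closed:
  assumes "finite S"
  shows "walk ps \<Longrightarrow> linked_walk S ps \<Longrightarrow> f \<in> set (walk_edges ps) \<Longrightarrow> linked S d f g \<Longrightarrow>
    g \<in> set (walk_edges ps) \<or> d = hd ps \<and> f = hd (walk_edges ps) \<or> d = last ps"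
proof (induction ps rule: walk_edges.induct)
  case (1 p q ps)
  have t: "dadj p q" "walk (q # ps)" "linked_walk S (q # ps)" using 1(2,3) linked_walk_tl[of S p] by auto
  have inc: "incident d f" using 1(5) by (simp add: linked_def)
  show ?case
  proof (cases "f = dedge_of p q")
    case True
    then have "d = p \<or> d = q" using inc dedge_of_dadj(2)[OF t(1)] by simp
    then show ?thesis
    proof
      assume "d = p"
      then show ?thesis using True by simp
    next
      assume d: "d = q"
      show ?thesis
      proof (cases ps)
        case Nil
        then show ?thesis using d by simp
      next
        case (Cons r rs)
        then have "linked S q f (dedge_of q r)" using 1(3) True by simp
        then have "g = dedge_of q r" using linked_unique[OF assms] 1(5) d by blast
        then show ?thesis using Cons by simp
      qed
    qed
  next
    case False
    then have f: "f \<in> set (walk_edges (q # ps))" using 1(4) by simp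
    from 1(1)[OF t(2,3) f 1(5)] show ?thesis
    proof (elim disjE)
      assume h: "d = hd (q # ps) \<and> f = hd (walk_edges (q # ps))"
      obtain r rs where r: "ps = r # rs" using f by (cases ps) auto
      then have "linked S q f (dedge_of p q)" using 1(3) h linked_sym[of S q "dedge_of p q" "dedge_of q r"] by simp
      then have "g = dedge_of p q" using linked_unique[OF assms] 1(5) h by auto
      then show ?thesis by simp
    qed auto
  qed
qed auto

lemma linked_walk_reach:
  "linked_walk S ps \<Longrightarrow> f \<in> set (walk_edges ps) \<Longrightarrow> (last (walk_edges ps), f) \<in> {(x, y). joined S x y}\<^sup>*"
proof (induction ps arbitrary: f rule: walk_edges.induct)
  case (1 p q ps)
  show ?case
  proof (cases ps)
    case Nil
    then show ?thesis using 1(3) by simp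
  next
    case (Cons r rs)
    have l: "last (walk_edges (p # q # ps)) = last (walk_edges (q # ps))" using Cons by simp
    have jt: "linked_walk S (q # ps)" using 1(2) by (rule linked_walk_tl)
    show ?thesis
    proof (cases "f \<in> set (walk_edges (q # ps))")
      case True
      then show ?thesis unfolding l by (rule 1(1)[OF jt])
    next
      case False
      then have f: "f = dedge_of p q" using 1(3) by simp
      have "(last (walk_edges (q # ps)), dedge_of q r) \<in> {(x, y). joined S x y}\<^sup>*"
        by (rule 1(1)[OF jt]) (simp add: Cons)
      moreover have "joined S (dedge_of q r) f"
        unfolding joined_linked
      proof
        show "linked S q (dedge_of q r) f" using 1(2) unfolding f Cons by (simp add: linked_sym)
      qed
      ultimately show ?thesis unfolding l by (simp add: rtrancl_into_rtrancl)
    qed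
  qed
qed auto

text \<open>A longest linked trail that ends in \<open>a\<close>, extended at its head. It does not
  start in \<open>a\<close>, as a closed trail would have two edges there. At a start other than
  \<open>b\<close> the degree is even, so the first edge has a partner, which either extends the
  trail or already lies in it, against \<open>linked_walk_closed\<close>.\<close>

lemma interface_trail:
  assumes fin: "finite S" and S: "\<And>e. e \<in> S \<Longrightarrow> is_dedge e"
    and par: "\<And>q. odd_at S q \<longleftrightarrow> (q = a) \<noteq> (q = b)" and ab: "a \<noteq> b"
    and a1: "\<And>e f. e \<in> S \<Longrightarrow> f \<in> S \<Longrightarrow> incident a e \<Longrightarrow> incident a f \<Longrightarrow> e = f"
  obtains ps where "trail ps" "set (walk_edges ps) \<subseteq> S" "linked_walk S ps" "last ps = a" "hd ps = b" "walk_edges ps \<noteq> []"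
proof -
  define P where "P = (\<lambda>ps. trail ps \<and> set (walk_edges ps) \<subseteq> S \<and> linked_walk S ps \<and> last ps = a \<and> walk_edges ps \<noteq> [])"
  have bound: "length (walk_edges ps) < Suc (card S)" if "P ps" for ps
  proof -
    have "length (walk_edges ps) = card (set (walk_edges ps))"
      using that by (simp add: P_def trail_def distinct_card)
    also have "\<dots> \<le> card S" using that fin by (intro card_mono) (auto simp: P_def)
    finally show ?thesis by simp
  qed
  have "odd_at S a" using par ab by simp
  then obtain e where e: "e \<in> S" "incident a e" using odd_at_imp_incident by blast
  obtain q where q: "dadj q a" "dedge_of q a = e" using incident_dedge_of[OF S[OF e(1)] e(2)] .
  have P0: "P [q, a]" using q e by (simp add: P_def trail_def)
  obtain ps where ps: "P ps" "\<And>qs. P qs \<Longrightarrow> length (walk_edges qs) \<le> length (walk_edges ps)"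
    using ex_has_greatest_nat[of P "[q, a]" "\<lambda>ps. length (walk_edges ps)" "Suc (card S)"] P0 bound
    by (metis less_imp_le)
  obtain p0 p1 rest where pp: "ps = p0 # p1 # rest"
    using ps(1) unfolding P_def by (cases ps rule: walk_edges.cases) auto
  let ?e0 = "dedge_of p0 p1" and ?W = "set (walk_edges ps)"
  have tr: "trail ps" "?W \<subseteq> S" "linked_walk S ps" "last ps = a" using ps(1) by (auto simp: P_def)
  have t1: "dadj p0 p1" "walk (p1 # rest)" "?e0 \<notin> set (walk_edges (p1 # rest))" "?e0 \<in> S"
    using tr(1,2) by (auto simp: trail_def pp)
  have i0: "incident p0 ?e0" by (simp add: dedge_of_dadj(2)[OF t1(1)])
  have "p0 = b"
  proof (rule ccontr)
    assume nb: "p0 \<noteq> b"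
    have na: "p0 \<noteq> a"
    proof
      assume "p0 = a"
      then have "\<not> odd_at ?W a" using trail_par[OF tr(1), of a] tr(4) by (simp add: pp)
      moreover have "odd_at {?e0} a" using odd_at_singleton[of ?e0 a] dedge_of_dadj(1)[OF t1(1)] i0 \<open>p0 = a\<close> by simp
      ultimately have "odd_at (sd ?W {?e0}) a" by (simp add: odd_at_sd)
      then obtain f where "f \<in> sd ?W {?e0}" "incident a f" using odd_at_imp_incident by blast
      then have "f \<in> S" "f \<noteq> ?e0" using tr(2) by (auto simp: pp)
      then show False using a1[of f ?e0] \<open>incident a f\<close> t1(4) i0 \<open>p0 = a\<close> by simp
    qed
    have "\<not> odd_at S p0" using par na nb by simp
    from linked_exists[OF S this t1(4) i0] obtain f where f: "linked S p0 ?e0 f" by blast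
    then have fS: "f \<in> S" "incident p0 f" "f \<noteq> ?e0" by (auto simp: linked_def)
    obtain r where r: "dadj r p0" "dedge_of r p0 = f" using incident_dedge_of[OF S[OF fS(1)] fS(2)] .
    show False
    proof (cases "f \<in> ?W")
      case False
      have "P (r # ps)" using tr r linked_sym[OF f] False fS(1) by (simp add: P_def trail_def pp)
      from ps(2)[OF this] show False by (simp add: pp)
    next
      case True
      then have fW: "f \<in> set (walk_edges (p1 # rest))" using fS(3) by (simp add: pp)
      have "linked_walk S (p1 # rest)" using tr(3) linked_walk_tl unfolding pp by blast
      from linked_walk_closed[OF fin t1(2) this fW linked_sym[OF f]]
      show False using t1(3) dedge_of_dadj(3)[OF t1(1)] na tr(4) by (simp add: pp)
    qed
  qed
  then show ?thesis using that[of ps] ps(1) by (simp add: P_def pp)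
qed

lemma joined_sym: "joined S e f \<Longrightarrow> joined S f e"
  unfolding joined_linked using linked_sym by blast

text \<open>The trail is connected by \<open>linked_walk_reach\<close> and closed under joining by
  \<open>linked_walk_closed\<close>; the exceptions at its ends do not arise, since \<open>a\<close>
  and \<open>b\<close> carry only one edge each.\<close>

lemma piece_of_trail:
  assumes fin: "finite S"
    and a1: "\<And>e f. e \<in> S \<Longrightarrow> f \<in> S \<Longrightarrow> incident a e \<Longrightarrow> incident a f \<Longrightarrow> e = f"
    and b1: "\<And>e f. e \<in> S \<Longrightarrow> f \<in> S \<Longrightarrow> incident b e \<Longrightarrow> incident b f \<Longrightarrow> e = f"
    and ps: "trail ps" "set (walk_edges ps) \<subseteq> S" "linked_walk S ps" "last ps = a" "hd ps = b" "walk_edges ps \<noteq> []"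
  shows "set (walk_edges ps) \<in> pieces S"
proof -
  let ?W = "set (walk_edges ps)" and ?e = "last (walk_edges ps)"
  have eW: "?e \<in> ?W" using ps(6) by simp
  have "f \<in> ?W" if "(?e, f) \<in> {(x, y). joined S x y}\<^sup>*" for f
    using that
  proof (induction rule: rtrancl_induct)
    case base
    show ?case by (rule eW)
  next
    case (step y z)
    then obtain d where d: "linked S d y z" by (auto simp: joined_linked)
    have "walk ps" using ps(1) by (simp add: trail_def)
    from linked_walk_closed[OF fin this ps(3) step.IH d]
    show ?case using a1[of y z] b1[of y z] d unfolding ps(4,5) by (auto simp: linked_def)
  qed
  moreover have "(?e, f) \<in> {(x, y). joined S x y}\<^sup>*" if "f \<in> ?W" for f
    by (rule linked_walk_reach[OF ps(3) that])
  ultimately have "?W = {f. (?e, f) \<in> {(x, y). joined S x y}\<^sup>*}" by blast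
  then show ?thesis unfolding pieces_def using eW ps(2) by blast
qed

lemma pieces_eq:
  assumes "P \<in> pieces S" "Q \<in> pieces S" "e \<in> P" "e \<in> Q"
  shows "P = Q"
proof -
  let ?R = "{(x, y). joined S x y}"
  have "sym ?R" using joined_sym by (auto intro: symI)
  then have s: "sym (?R\<^sup>*)" by (rule sym_rtrancl)
  have *: "P = {f. (e, f) \<in> ?R\<^sup>*}" if P: "P \<in> pieces S" "e \<in> P" for P
  proof -
    obtain e0 where e0: "P = {f. (e0, f) \<in> ?R\<^sup>*}" using P(1) by (auto simp: pieces_def)
    then have "(e0, e) \<in> ?R\<^sup>*" using P(2) by simp
    moreover from this have "(e, e0) \<in> ?R\<^sup>*" using s by (meson symD)
    ultimately show ?thesis unfolding e0 by (auto intro: rtrancl_trans)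
  qed
  show ?thesis using *[OF assms(1,3)] *[OF assms(2,4)] by simp
qed

lemma pieces_subset: "P \<in> pieces S \<Longrightarrow> P \<subseteq> S"
proof
  fix f assume "P \<in> pieces S" "f \<in> P"
  then obtain e where "e \<in> S" "(e, f) \<in> {(x, y). joined S x y}\<^sup>*" by (auto simp: pieces_def)
  from this(2,1) show "f \<in> S" by (induction rule: rtrancl_induct) (auto simp: joined_def)
qed

section \<open>Paths as trails, and contours under the Dobrushin condition\<close>

lemma walk_edges_conv: "walk_edges ps = map (\<lambda>i. dedge_of (ps ! i) (ps ! Suc i)) [0..<length ps - 1]"
proof (induction ps rule: walk_edges.induct)
  case (1 p q ps)
  have "[0..<length (p # q # ps) - 1] = 0 # map Suc [0..<length (q # ps) - 1]"
    by (simp add: map_Suc_upt upt_conv_Cons del: upt_Suc)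
  then show ?case using 1 by (simp del: upt_Suc)
qed auto

lemma walk_conv: "walk ps \<longleftrightarrow> (\<forall>i < length ps - 1. dadj (ps ! i) (ps ! Suc i))"
proof (induction ps rule: walk_edges.induct)
  case (1 p q ps)
  have "(\<forall>i < length (p # q # ps) - 1. dadj ((p # q # ps) ! i) ((p # q # ps) ! Suc i)) \<longleftrightarrow>
    dadj p q \<and> (\<forall>i < length (q # ps) - 1. dadj ((q # ps) ! i) ((q # ps) ! Suc i))"
    by (simp add: All_less_Suc2)
  then show ?case using 1 by simp
qed auto

lemma is_dpath_trail:
  "is_dpath N \<gamma> a b \<longleftrightarrow> (\<exists>ps. trail ps \<and> walk_edges ps \<noteq> [] \<and> hd ps = a \<and> last ps = b \<and> \<gamma> = set (walk_edges ps) \<and> \<gamma> \<subseteq> dedges N)"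
proof -
  have "length ps \<ge> 2 \<longleftrightarrow> ps \<noteq> [] \<and> walk_edges ps \<noteq> []" for ps by (cases ps rule: walk_edges.cases) auto
  moreover have "(\<forall>i < length ps - 1. dadj (ps ! i) (ps ! Suc i) \<and> dedge_of (ps ! i) (ps ! Suc i) \<in> dedges N)
    \<longleftrightarrow> walk ps \<and> set (walk_edges ps) \<subseteq> dedges N" for ps
    unfolding walk_conv walk_edges_conv by auto
  ultimately show ?thesis
    unfolding is_dpath_def walk_edges_conv[symmetric] trail_def by auto
qed

text \<open>The flat interface. Adding it modulo 2 turns closed contours into Dobrushin contours and
  paths between the two corners into even edge sets.\<close>

definition base :: "nat \<Rightarrow> dedge set" where
  "base N = (\<lambda>a. hE a 0) ` {0..int N}"

lemma base_E [simp]: "hE a b \<in> base N \<longleftrightarrow> b = 0 \<and> 0 \<le> a \<and> a \<le> int N" "vE a b \<notin> base N"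
  by (auto simp: base_def)

lemma card_base: "card (base N) = Suc N"
  unfolding base_def by (subst card_image) (auto simp: inj_on_def)

lemma dedge_set_eqI:
  assumes "\<And>e. e \<in> A \<Longrightarrow> is_dedge e" "\<And>e. e \<in> B \<Longrightarrow> is_dedge e"
    "\<And>a b. hE a b \<in> A \<longleftrightarrow> hE a b \<in> B" "\<And>a b. vE a b \<in> A \<longleftrightarrow> vE a b \<in> B"
  shows "A = B"
proof (rule set_eqI)
  fix e
  show "e \<in> A \<longleftrightarrow> e \<in> B"
  proof (cases "is_dedge e")
    case True
    then show ?thesis using assms(3,4) unfolding is_dedge_iff by blast
  next
    case False
    then show ?thesis using assms(1,2) by blast
  qed
qed

lemma contour_of_low: "contour_of N low = base N"
proof (rule dedge_set_eqI)
  show "is_dedge e" if "e \<in> contour_of N low" for e using that dedges_is_dedge[of e N] by (simp add: contour_of_def)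
  show "is_dedge e" if "e \<in> base N" for e using that unfolding base_def by fastforce
qed (auto simp: contour_of_def dedges_E bdry_E low_def Lam_def)

lemma base_dedges: "base N \<subseteq> dedges N"
  unfolding contour_of_low[symmetric] contour_of_def by blast

lemma contour_of_Un_low:
  assumes "m \<subseteq> Lam N"
  shows "contour_of N (m \<union> low) = sd (contour_of N m) (base N)"
proof -
  have "m \<union> low = sd m low" using assms low_Lam[of N] by auto
  then show ?thesis by (simp only: contour_of_sd contour_of_low)
qed

lemma odd_at_base: "odd_at (base N) q \<longleftrightarrow> (q = dstart) \<noteq> (q = dend N)"
  by (cases q) (auto simp: odd_at_def dstart_def dend_def)

lemma odd_at_contour_of_low:
  assumes "m \<subseteq> Lam N"
  shows "odd_at (contour_of N (m \<union> low)) q \<longleftrightarrow> (q = dstart) \<noteq> (q = dend N)"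
proof -
  have "\<not> odd_at (contour_of N m) q" using even_edges_bdry[of m] unfolding contour_of_eq_bdry[OF assms] even_edges_def by blast
  then show ?thesis by (simp add: contour_of_Un_low[OF assms] odd_at_sd odd_at_base)
qed

lemma dstart_dend: "dstart \<noteq> dend N"
  by (simp add: dstart_def dend_def)

text \<open>To the south and on the outer side of either corner there is no edge of
  \<open>dedges N\<close>. Of the two edges left, an odd number is present.\<close>

lemma unique_end_edge:
  assumes m: "m \<subseteq> Lam N" and d: "d = dstart \<or> d = dend N"
    and ef: "e \<in> contour_of N (m \<union> low)" "f \<in> contour_of N (m \<union> low)" "incident d e" "incident d f"
  shows "e = f"
proof -
  let ?S = "contour_of N (m \<union> low)"
  obtain a where a: "d = (a, 0)" "a = 0 \<or> a = int N + 1" using d by (auto simp: dstart_def dend_def)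
  have "odd_at ?S d" using odd_at_contour_of_low[OF m, of d] d dstart_dend[of N] by metis
  then have p: "odd_at ?S (a, 0)" unfolding a(1) .
  have dd: "is_dedge e" "is_dedge f" using ef dedges_is_dedge[of e N] dedges_is_dedge[of f N] by (simp_all add: contour_of_def)
  have n1: "vE a (- 1) \<notin> ?S" by (auto simp: contour_of_def dedges_E Lam_def)
  have ec: "e = hE a 0 \<or> e = hE (a - 1) 0 \<or> e = vE a 0 \<or> e = vE a (0 - 1)"
    "f = hE a 0 \<or> f = hE (a - 1) 0 \<or> f = vE a 0 \<or> f = vE a (0 - 1)"
    using incident_cases[OF dd(1), of a 0] incident_cases[OF dd(2), of a 0] ef(3,4) unfolding a(1) by blast+
  from a(2) show ?thesis
  proof
    assume a0: "a = 0"
    have "hE (- 1) 0 \<notin> ?S" by (auto simp: contour_of_def dedges_E Lam_def)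
    then show ?thesis using p n1 ec ef(1,2) unfolding odd_at_def a0 by auto
  next
    assume a1: "a = int N + 1"
    have "hE (int N + 1) 0 \<notin> ?S" by (auto simp: contour_of_def dedges_E Lam_def)
    then show ?thesis using p n1 ec ef(1,2) unfolding odd_at_def a1 by auto
  qed
qed

definition spin_of :: "site set \<Rightarrow> site \<Rightarrow> int" where
  "spin_of m v = (if v \<in> m \<union> low then - 1 else 1)"

lemma contour_spin_of: "contour N (spin_of m) = contour_of N (m \<union> low)"
  by (auto simp: contour_def contour_of_def bdry_def spin_of_def dedges_def)

text \<open>Two candidates share the only edge at \<open>dstart\<close>, and pieces with a common
  edge coincide. This gives meaning to the definite description in \<open>interface\<close>.\<close>

lemma interface_ex1:
  assumes m: "m \<subseteq> Lam N"
  shows "\<exists>!P. P \<in> pieces (contour_of N (m \<union> low)) \<and> is_dpath N P dstart (dend N)"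
proof (rule ex_ex1I)
  let ?S = "contour_of N (m \<union> low)"
  have dd: "\<And>e. e \<in> ?S \<Longrightarrow> is_dedge e" using dedges_is_dedge by (auto simp: contour_of_def)
  have par: "odd_at ?S q \<longleftrightarrow> (q = dend N) \<noteq> (q = dstart)" for q using odd_at_contour_of_low[OF m] by auto
  have u: "\<And>e f. e \<in> ?S \<Longrightarrow> f \<in> ?S \<Longrightarrow> incident (dend N) e \<Longrightarrow> incident (dend N) f \<Longrightarrow> e = f"
    "\<And>e f. e \<in> ?S \<Longrightarrow> f \<in> ?S \<Longrightarrow> incident dstart e \<Longrightarrow> incident dstart f \<Longrightarrow> e = f"
    using unique_end_edge[OF m] by blast+
  obtain ps where ps: "trail ps" "set (walk_edges ps) \<subseteq> ?S" "linked_walk ?S ps" "last ps = dend N" "hd ps = dstart" "walk_edges ps \<noteq> []"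
    by (rule interface_trail[OF finite_contour_of dd par dstart_dend[symmetric] u(1)])
  have "set (walk_edges ps) \<in> pieces ?S"
    by (rule piece_of_trail[OF finite_contour_of u ps])
  moreover have "is_dpath N (set (walk_edges ps)) dstart (dend N)"
    unfolding is_dpath_trail using ps by (intro exI[of _ ps]) (auto simp: contour_of_def)
  ultimately show "\<exists>P. P \<in> pieces ?S \<and> is_dpath N P dstart (dend N)" by blast
  fix P Q assume PQ: "P \<in> pieces ?S \<and> is_dpath N P dstart (dend N)" "Q \<in> pieces ?S \<and> is_dpath N Q dstart (dend N)"
  have first: "\<exists>e\<in>P. incident dstart e" if "is_dpath N P dstart (dend N)" for P
  proof -
    obtain ps where ps: "trail ps" "walk_edges ps \<noteq> []" "hd ps = dstart" "P = set (walk_edges ps)"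
      using \<open>is_dpath N P dstart (dend N)\<close> unfolding is_dpath_trail by blast
    obtain p q r where r: "ps = p # q # r" using ps(2) by (cases ps rule: walk_edges.cases) auto
    then have "incident dstart (dedge_of p q)" using ps(1,3) dedge_of_dadj(2)[of p q] by (simp add: trail_def)
    then show ?thesis unfolding ps(4) r by auto
  qed
  obtain e f where e: "e \<in> P" "incident dstart e" and f: "f \<in> Q" "incident dstart f" using first PQ by blast
  have "e = f" using u(2)[of e f] e f pieces_subset PQ by blast
  then show "P = Q" using pieces_eq[of P ?S Q e] PQ e f by blast
qed

definition interface_of :: "nat \<Rightarrow> site set \<Rightarrow> dedge set" where
  "interface_of N m = interface N (spin_of m)"

lemma interface_of_spec:
  assumes "m \<subseteq> Lam N"
  shows "interface_of N m \<in> pieces (contour_of N (m \<union> low))" "is_dpath N (interface_of N m) dstart (dend N)"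
  using theI'[OF interface_ex1[OF assms]] unfolding interface_of_def interface_def contour_spin_of by auto

lemma interface_of_eqI:
  assumes "m \<subseteq> Lam N" "P \<in> pieces (contour_of N (m \<union> low))" "is_dpath N P dstart (dend N)"
  shows "interface_of N m = P"
  using interface_ex1[OF assms(1)] interface_of_spec[OF assms(1)] assms(2,3) by blast

text \<open>The pair (a, b) encodes the dual vertex (a - 1/2, b - 1/2), so these are the four sites
  around it.\<close>

definition sites4 :: "dvert \<Rightarrow> site set" where
  "sites4 d = {d, (fst d - 1, snd d), (fst d, snd d - 1), (fst d - 1, snd d - 1)}"

text \<open>Contains the surroundings of both end points of each edge, because the splitting at a
  vertex depends on all edges there.\<close>

definition collar :: "dedge set \<Rightarrow> site set" where
  "collar \<gamma> = (\<Union>e\<in>\<gamma>. sites4 (fst e) \<union> sites4 (snd e))"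

lemma collar_bound:
  assumes "finite \<gamma>"
  shows "finite (collar \<gamma>)" "card (collar \<gamma>) \<le> 8 * card \<gamma>"
proof -
  have f: "finite (sites4 d)" and c: "card (sites4 d) \<le> 4" for d
    unfolding sites4_def by (simp_all add: card_insert_if)
  show "finite (collar \<gamma>)" using assms f by (simp add: collar_def)
  have "card (collar \<gamma>) \<le> (\<Sum>e\<in>\<gamma>. card (sites4 (fst e) \<union> sites4 (snd e)))"
    unfolding collar_def by (rule card_UN_le[OF assms])
  also have "\<dots> \<le> (\<Sum>e\<in>\<gamma>. 8)"
  proof (rule sum_mono)
    fix e
    show "card (sites4 (fst e) \<union> sites4 (snd e)) \<le> 8"
      using card_Un_le[of "sites4 (fst e)" "sites4 (snd e)"] c[of "fst e"] c[of "snd e"] by linarith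
  qed
  finally show "card (collar \<gamma>) \<le> 8 * card \<gamma>" by simp
qed

lemma incident_sep_sites:
  assumes "is_dedge e" "incident d e"
  shows "fst (sep e) \<in> sites4 d" "snd (sep e) \<in> sites4 d"
  using assms by (cases d; auto simp: is_dedge_iff incident_E sep_E sites4_def)+

text \<open>An edge is joined to others only at its end points, where both contours agree. So the
  same edges are reached from an edge of the interface in either contour.\<close>

lemma interface_of_local:
  assumes m: "m \<subseteq> Lam N" "m' \<subseteq> Lam N" and agree: "\<And>v. v \<in> collar (interface_of N m) \<Longrightarrow> v \<in> m \<longleftrightarrow> v \<in> m'"
  shows "interface_of N m' = interface_of N m"
proof (rule interface_of_eqI[OF m(2)])
  let ?g = "interface_of N m" and ?S = "contour_of N (m \<union> low)" and ?S' = "contour_of N (m' \<union> low)"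
  show "is_dpath N ?g dstart (dend N)" by (rule interface_of_spec[OF m(1)])
  have gS: "?g \<subseteq> ?S" using interface_of_spec(1)[OF m(1)] by (rule pieces_subset)
  have edge: "e \<in> ?S \<longleftrightarrow> e \<in> ?S'" if f: "f \<in> ?g" "incident d f" and e: "incident d e" for d e f
  proof (cases "e \<in> dedges N")
    case True
    have "d = fst f \<or> d = snd f" using f(2) by (auto simp: incident_def)
    then have "sites4 d \<subseteq> collar ?g" using f(1) by (auto simp: collar_def)
    then have "fst (sep e) \<in> m \<longleftrightarrow> fst (sep e) \<in> m'" "snd (sep e) \<in> m \<longleftrightarrow> snd (sep e) \<in> m'"
      using agree incident_sep_sites[OF dedges_is_dedge[OF True] e] by blast+
    then show ?thesis by (simp add: contour_of_def bdry_def)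
  qed (simp add: contour_of_def)
  have linked: "joined ?S f g \<longleftrightarrow> joined ?S' f g" if f: "f \<in> ?g" for f g
  proof -
    have "linked ?S d f g \<longleftrightarrow> linked ?S' d f g" for d
    proof (cases "incident d f")
      case True
      show ?thesis by (rule linked_local[OF edge[OF f True]])
    qed (simp add: linked_def)
    then show ?thesis by (simp add: joined_linked)
  qed
  obtain e where e: "e \<in> ?S" "?g = {f. (e, f) \<in> {(x, y). joined ?S x y}\<^sup>*}"
    using interface_of_spec(1)[OF m(1)] by (auto simp: pieces_def)
  have eg: "e \<in> ?g" unfolding e(2) by simp
  have cl: "z \<in> ?g" if "y \<in> ?g" "joined ?S y z" for y z
    using that unfolding e(2) by (auto intro: rtrancl_into_rtrancl)
  have 1: "(e, f) \<in> {(x, y). joined ?S' x y}\<^sup>*" if "(e, f) \<in> {(x, y). joined ?S x y}\<^sup>*" for f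
  proof -
    from that have "f \<in> ?g \<and> (e, f) \<in> {(x, y). joined ?S' x y}\<^sup>*"
    proof (induction rule: rtrancl_induct)
      case base
      then show ?case using eg by simp
    next
      case (step y z)
      then have "joined ?S y z" "y \<in> ?g" by auto
      then have "z \<in> ?g" "joined ?S' y z" using cl linked by blast+
      then show ?case using step.IH by (auto intro: rtrancl_into_rtrancl)
    qed
    then show ?thesis ..
  qed
  have 2: "f \<in> ?g" if "(e, f) \<in> {(x, y). joined ?S' x y}\<^sup>*" for f
    using that
  proof (induction rule: rtrancl_induct)
    case base
    show ?case by (rule eg)
  next
    case (step y z)
    then show ?case using cl linked by blast
  qed
  have "?g = {f. (e, f) \<in> {(x, y). joined ?S' x y}\<^sup>*}"
    using 1 2 e(2) by blast
  moreover have "e \<in> ?S'"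
  proof -
    have "incident (fst e) e" by (simp add: incident_def)
    then show ?thesis using edge[OF eg] e(1) by blast
  qed
  ultimately show "?g \<in> pieces ?S'" unfolding pieces_def by blast
qed

lemma interface_cost:
  assumes x: "0 < x" "x \<le> 1 / 5" and l: "0 \<le> l"
  shows "pf x N low l (\<lambda>m. interface_of N m = \<gamma>) * pf x N {} 0 (\<lambda>_. True)
    \<le> exp (l * loop_const * real (card (collar \<gamma>))) * (pf x N low 0 (\<lambda>m. interface_of N m = \<gamma>) * pf x N {} l (\<lambda>_. True))"
proof (cases "\<exists>m\<in>Pow (Lam N). interface_of N m = \<gamma>")
  case False
  then have z: "pf x N low l' (\<lambda>m. interface_of N m = \<gamma>) = 0" for l'
    unfolding pf_def by (intro sum.neutral) auto
  show ?thesis by (simp add: z)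
next
  case True
  then obtain m0 where m0: "m0 \<subseteq> Lam N" "\<gamma> = interface_of N m0" by auto
  have "\<gamma> \<subseteq> dedges N" using interface_of_spec(1)[OF m0(1)] pieces_subset m0(2) by (fastforce simp: contour_of_def)
  then have fin: "finite \<gamma>" using finite_dedges finite_subset by blast
  let ?F = "collar \<gamma>" and ?T = "\<lambda>_ :: site set. True" and ?G = "\<lambda>m. interface_of N m = \<gamma>"
  have P0: "pf x N D l A \<ge> 0" for D l A using x by (simp add: pf_nonneg)
  \<comment> \<open>The union of a set with interface \<gamma> and a set avoiding the collar still
    has interface \<gamma>, and the intersection avoids the collar: exactly the closure property
    that FKG asks for.\<close>
  have four: "pf x N low l ?G * pf x N {} 0 (avoid ?F) \<le> pf x N low 0 ?G * pf x N {} l (avoid ?F)"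
  proof (rule pf_four)
    fix a b assume ab: "a \<subseteq> Lam N" "b \<subseteq> Lam N"
    have "card (a \<inter> b) \<le> card a" using ab finite_subset[OF _ finite_Lam] by (intro card_mono) auto
    then show "0 * real (card (a \<union> b)) + l * real (card (a \<inter> b)) \<le> l * real (card a) + 0 * real (card b)"
      using l by (simp add: mult_left_mono)
    assume g: "interface_of N a = \<gamma>" and "avoid ?F b"
    then have "v \<in> a \<longleftrightarrow> v \<in> a \<union> b" if "v \<in> collar (interface_of N a)" for v
      using that by (auto simp: avoid_def)
    then have "interface_of N (a \<union> b) = interface_of N a" using ab by (intro interface_of_local) auto
    then show "interface_of N (a \<union> b) = \<gamma> \<and> avoid ?F (a \<inter> b)" using g \<open>avoid ?F b\<close> by (auto simp: avoid_def)
  qed (use x low_Lam in auto)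
  have pos: "pf x N {} 0 (avoid ?F) > 0"
  proof -
    have "0 < of_bool (avoid ?F {}) * (x ^ cut (pedges N) ({} \<union> {}) * exp (- 0 * real (card ({} :: site set))))"
      using x by (simp add: avoid_def)
    also have "\<dots> \<le> pf x N {} 0 (avoid ?F)"
      unfolding pf_def by (rule member_le_sum) (use x finite_Lam in auto)
    finally show ?thesis .
  qed
  have pin: "pf x N {} l (avoid ?F) * pf x N {} 0 ?T
    \<le> exp (l * loop_const * real (card ?F)) * (pf x N {} l ?T * pf x N {} 0 (avoid ?F))"
    by (rule pinning_cost) (use x l collar_bound(1)[OF fin] in auto)
  have "(pf x N low l ?G * pf x N {} 0 ?T) * pf x N {} 0 (avoid ?F)
    = (pf x N low l ?G * pf x N {} 0 (avoid ?F)) * pf x N {} 0 ?T" by (simp only: mult_ac)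
  also have "\<dots> \<le> (pf x N low 0 ?G * pf x N {} l (avoid ?F)) * pf x N {} 0 ?T"
    by (intro mult_right_mono four P0)
  also have "\<dots> = pf x N low 0 ?G * (pf x N {} l (avoid ?F) * pf x N {} 0 ?T)" by (simp only: mult_ac)
  also have "\<dots> \<le> pf x N low 0 ?G * (exp (l * loop_const * real (card ?F)) * (pf x N {} l ?T * pf x N {} 0 (avoid ?F)))"
    by (intro mult_left_mono pin P0)
  also have "\<dots> = (exp (l * loop_const * real (card ?F)) * (pf x N low 0 ?G * pf x N {} l ?T)) * pf x N {} 0 (avoid ?F)"
    by (simp only: mult_ac)
  finally show ?thesis using pos by simp
qed

section \<open>Peierls bound for long interfaces\<close>

lemma card_dpaths: "card {\<gamma>. is_dpath N \<gamma> a b \<and> card \<gamma> = n} \<le> 4 ^ n" "finite {\<gamma>. is_dpath N \<gamma> a b}"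
proof -
  have "{\<gamma>. is_dpath N \<gamma> a b \<and> card \<gamma> = n} \<subseteq> (\<lambda>ps. set (walk_edges ps)) ` walks a n"
  proof
    fix \<gamma> assume "\<gamma> \<in> {\<gamma>. is_dpath N \<gamma> a b \<and> card \<gamma> = n}"
    then obtain ps where ps: "trail ps" "hd ps = a" "\<gamma> = set (walk_edges ps)" "card \<gamma> = n"
      unfolding is_dpath_trail by blast
    have "length (walk_edges ps) = n" using ps by (simp add: trail_def distinct_card)
    then have "ps \<in> walks a n" using ps(1,2) length_walk_edges[of ps] by (cases ps) (auto simp: walks_def trail_def)
    then show "\<gamma> \<in> (\<lambda>ps. set (walk_edges ps)) ` walks a n" unfolding ps(3) by (rule imageI)
  qed
  then have "card {\<gamma>. is_dpath N \<gamma> a b \<and> card \<gamma> = n} \<le> card ((\<lambda>ps. set (walk_edges ps)) ` walks a n)"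
    using walks_bound by (intro card_mono) auto
  also have "\<dots> \<le> card (walks a n)" using walks_bound by (intro card_image_le) blast
  also have "\<dots> \<le> 4 ^ n" using walks_bound by blast
  finally show "card {\<gamma>. is_dpath N \<gamma> a b \<and> card \<gamma> = n} \<le> 4 ^ n" .
  have "{\<gamma>. is_dpath N \<gamma> a b} \<subseteq> Pow (dedges N)" unfolding is_dpath_trail by blast
  then show "finite {\<gamma>. is_dpath N \<gamma> a b}" using finite_dedges finite_subset by (metis finite_Pow_iff)
qed

text \<open>The path and \<open>base\<close> add up to an even edge set \<open>W\<close>. Flipping
  the sites it encloses erases the path and leaves a closed contour, that is, plus boundary
  conditions.\<close>

lemma peierls_path:
  fixes x :: real
  assumes x: "0 \<le> x" and g: "is_dpath N \<gamma> dstart (dend N)"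
  shows "(\<Sum>m\<in>Pow (Lam N). of_bool (\<gamma> \<subseteq> contour_of N (m \<union> low)) * x ^ cut (pedges N) (m \<union> low))
    \<le> x ^ card \<gamma> * (\<Sum>m\<in>Pow (Lam N). x ^ cut (pedges N) m)"
proof -
  obtain ps where ps: "trail ps" "hd ps = dstart" "last ps = dend N" "\<gamma> = set (walk_edges ps)" "\<gamma> \<subseteq> dedges N"
    using g unfolding is_dpath_trail by blast
  define W where "W = sd \<gamma> (base N)"
  have W: "W \<subseteq> dedges N" using sd_subset[OF ps(5) base_dedges] by (simp add: W_def)
  have ev: "even_edges W" unfolding even_edges_def W_def ps(4) odd_at_sd odd_at_base trail_par[OF ps(1)] ps(2,3) by simp
  have fin: "finite W" using W finite_dedges finite_subset by blast
  have b: "bdry (enclosed W) = W" using W dedges_is_dedge by (intro bdry_enclosed fin ev) blast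
  show ?thesis
  proof (rule peierls_flip[OF x enclosed_Lam[OF ev W]])
    fix m assume "m \<subseteq> Lam N"
    have "contour_of N (enclosed W) = W" using W by (simp add: contour_of_def b Int_absorb1)
    then show "contour_of N (sd m (enclosed W)) = sd (contour_of N (m \<union> low)) \<gamma>"
      unfolding contour_of_sd contour_of_Un_low[OF \<open>m \<subseteq> Lam N\<close>] by (auto simp: W_def)
  qed
qed

text \<open>\<open>peierls_path\<close> compares with the plus partition function. Returning to the
  Dobrushin one costs \<open>x ^ Suc N\<close>, as \<open>base\<close> adds at most
  \<open>Suc N\<close> edges to a contour. The 5 is the sum of the geometric series of ratio
  4/5.\<close>

lemma long_interface:
  assumes x: "0 < x" "x \<le> 1 / 5"
  shows "pf x N low 0 (\<lambda>m. L \<le> card (interface_of N m)) \<le> 5 * (4 / 5) ^ L / x ^ Suc N * pf x N low 0 (\<lambda>_. True)"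
proof -
  define DP where "DP = {\<gamma>. is_dpath N \<gamma> dstart (dend N) \<and> L \<le> card \<gamma>}"
  define Z where "Z = (\<Sum>m\<in>Pow (Lam N). x ^ cut (pedges N) m)"
  have fDP: "finite DP" unfolding DP_def using card_dpaths(2) by (rule rev_finite_subset) auto
  have Z0: "Z \<ge> 0" unfolding Z_def using x by (intro sum_nonneg) auto
  have "pf x N low 0 (\<lambda>m. L \<le> card (interface_of N m))
    \<le> (\<Sum>m\<in>Pow (Lam N). \<Sum>\<gamma>\<in>DP. of_bool (\<gamma> \<subseteq> contour_of N (m \<union> low)) * x ^ cut (pedges N) (m \<union> low))"
    unfolding pf_def
  proof (rule sum_mono)
    fix m assume "m \<in> Pow (Lam N)"
    then have m: "m \<subseteq> Lam N" by simp
    show "of_bool (L \<le> card (interface_of N m)) * (x ^ cut (pedges N) (m \<union> low) * exp (- 0 * real (card m)))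
      \<le> (\<Sum>\<gamma>\<in>DP. of_bool (\<gamma> \<subseteq> contour_of N (m \<union> low)) * x ^ cut (pedges N) (m \<union> low))"
    proof (cases "L \<le> card (interface_of N m)")
      case True
      then have "interface_of N m \<in> DP" using interface_of_spec(2)[OF m] by (simp add: DP_def)
      moreover have "interface_of N m \<subseteq> contour_of N (m \<union> low)" using interface_of_spec(1)[OF m] by (rule pieces_subset)
      ultimately have "of_bool (interface_of N m \<subseteq> contour_of N (m \<union> low)) * x ^ cut (pedges N) (m \<union> low)
        \<le> (\<Sum>\<gamma>\<in>DP. of_bool (\<gamma> \<subseteq> contour_of N (m \<union> low)) * x ^ cut (pedges N) (m \<union> low))"
        using x fDP by (intro member_le_sum) auto
      then show ?thesis using True \<open>interface_of N m \<subseteq> _\<close> by simp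
    next
      case False
      then show ?thesis using x by (simp add: sum_nonneg)
    qed
  qed
  also have "\<dots> = (\<Sum>\<gamma>\<in>DP. \<Sum>m\<in>Pow (Lam N). of_bool (\<gamma> \<subseteq> contour_of N (m \<union> low)) * x ^ cut (pedges N) (m \<union> low))"
    by (rule sum.swap)
  also have "\<dots> \<le> (\<Sum>\<gamma>\<in>DP. x ^ card \<gamma> * Z)"
    unfolding Z_def using x by (intro sum_mono peierls_path) (auto simp: DP_def)
  also have "\<dots> = (\<Sum>\<gamma>\<in>DP. x ^ card \<gamma>) * Z" by (simp add: sum_distrib_right)
  also have "\<dots> \<le> (5 * (4 / 5) ^ L) * Z"
  proof (rule mult_right_mono[OF _ Z0])
    have "(\<Sum>\<gamma>\<in>DP. x ^ card \<gamma>) = (\<Sum>n\<in>card ` DP. \<Sum>\<gamma>\<in>{\<gamma> \<in> DP. card \<gamma> = n}. x ^ card \<gamma>)"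
      by (rule sum.image_gen[OF fDP])
    also have "\<dots> = (\<Sum>n\<in>card ` DP. real (card {\<gamma> \<in> DP. card \<gamma> = n}) * x ^ n)"
      by (intro sum.cong) auto
    also have "\<dots> \<le> (\<Sum>n\<in>card ` DP. (4 / 5) ^ n)"
    proof (rule sum_mono)
      fix n
      have "card {\<gamma> \<in> DP. card \<gamma> = n} \<le> card {\<gamma>. is_dpath N \<gamma> dstart (dend N) \<and> card \<gamma> = n}"
        by (rule card_mono) (auto simp: DP_def intro: rev_finite_subset[OF card_dpaths(2)])
      also have "\<dots> \<le> 4 ^ n" by (rule card_dpaths)
      finally have "real (card {\<gamma> \<in> DP. card \<gamma> = n}) * x ^ n \<le> real (4 ^ n) * x ^ n"
        using x by (intro mult_right_mono of_nat_mono) auto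
      also have "\<dots> = (4 * x) ^ n" by (simp add: power_mult_distrib)
      also have "\<dots> \<le> (4 / 5) ^ n" using x by (intro power_mono) auto
      finally show "real (card {\<gamma> \<in> DP. card \<gamma> = n}) * x ^ n \<le> (4 / 5) ^ n" .
    qed
    also have "\<dots> = (\<Sum>k\<in>(\<lambda>n. n - L) ` card ` DP. (4 / 5) ^ L * (4 / 5) ^ k)"
    proof -
      have i: "inj_on (\<lambda>n. n - L) (card ` DP)" by (auto simp: inj_on_def DP_def)
      have "(\<Sum>n\<in>card ` DP. (4 / 5 :: real) ^ n) = (\<Sum>n\<in>card ` DP. (4 / 5) ^ L * (4 / 5) ^ (n - L))"
        by (intro sum.cong) (auto simp: DP_def power_add[symmetric])
      then show ?thesis using sum.reindex[OF i, of "\<lambda>k. (4 / 5 :: real) ^ L * (4 / 5) ^ k"] by (simp add: o_def)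
    qed
    also have "\<dots> = (4 / 5) ^ L * (\<Sum>k\<in>(\<lambda>n. n - L) ` card ` DP. (4 / 5) ^ k)" by (simp add: sum_distrib_left)
    also have "\<dots> \<le> (4 / 5) ^ L * (\<Sum>k. (4 / 5) ^ k)"
      using fDP by (intro mult_left_mono sum_le_suminf) (auto intro: summable_geometric)
    also have "(\<Sum>k. (4 / 5 :: real) ^ k) = 5" by (subst suminf_geometric) auto
    finally show "(\<Sum>\<gamma>\<in>DP. x ^ card \<gamma>) \<le> 5 * (4 / 5) ^ L" by simp
  qed
  also have "\<dots> \<le> (5 * (4 / 5) ^ L) * (pf x N low 0 (\<lambda>_. True) / x ^ Suc N)"
  proof (rule mult_left_mono)
    have "x ^ Suc N * Z \<le> pf x N low 0 (\<lambda>_. True)"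
      unfolding Z_def pf_def sum_distrib_left
    proof (rule sum_mono)
      fix m assume "m \<in> Pow (Lam N)"
      then have m: "m \<subseteq> Lam N" by simp
      have "card (sd (contour_of N m) (base N)) \<le> card (contour_of N m \<union> base N)"
        using finite_contour_of finite_subset[OF base_dedges finite_dedges] by (intro card_mono) auto
      also have "\<dots> \<le> card (contour_of N m) + card (base N)" by (rule card_Un_le)
      finally have "cut (pedges N) (m \<union> low) \<le> Suc N + cut (pedges N) m"
        unfolding contour_of_Un_low[OF m, symmetric] card_contour_of card_base by simp
      then have "x ^ (Suc N + cut (pedges N) m) \<le> x ^ cut (pedges N) (m \<union> low)"
        using x by (intro power_decreasing) auto
      then show "x ^ Suc N * x ^ cut (pedges N) m \<le> of_bool True * (x ^ cut (pedges N) (m \<union> low) * exp (- 0 * real (card m)))"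
        by (simp add: power_add)
    qed
    then show "Z \<le> pf x N low 0 (\<lambda>_. True) / x ^ Suc N" using x by (simp add: field_simps)
  qed simp
  finally show ?thesis by simp
qed

section \<open>The partition function estimate for interfaces\<close>

lemma hamil_spin_of: "hamil N (spin_of m) = cut (pedges N) (m \<union> low)"
proof -
  have "spin_of m v \<noteq> spin_of m w \<longleftrightarrow> (v \<in> m \<union> low) \<noteq> (w \<in> m \<union> low)" for v w by (simp add: spin_of_def)
  then show ?thesis unfolding hamil_def cut_def by (simp only:) (rule arg_cong[where f = card], force)
qed

lemma configs_spin_of: "bij_betw spin_of (Pow (Lam N)) (configs N)"
proof (rule bij_betw_byWitness[where f' = "\<lambda>\<sigma>. {v \<in> Lam N. \<sigma> v = - 1}"])
  show "\<forall>m\<in>Pow (Lam N). {v \<in> Lam N. spin_of m v = - 1} = m"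
    using low_Lam[of N] by (auto simp: spin_of_def)
  show "\<forall>\<sigma>\<in>configs N. spin_of {v \<in> Lam N. \<sigma> v = - 1} = \<sigma>"
  proof
    fix \<sigma> assume "\<sigma> \<in> configs N"
    then have s: "v \<in> Lam N \<Longrightarrow> \<sigma> v = - 1 \<or> \<sigma> v = 1" "v \<notin> Lam N \<Longrightarrow> \<sigma> v = dob v" for v
      unfolding configs_def by blast+
    show "spin_of {v \<in> Lam N. \<sigma> v = - 1} = \<sigma>"
    proof
      fix v show "spin_of {v \<in> Lam N. \<sigma> v = - 1} v = \<sigma> v"
        using s[of v] low_Lam[of N] by (cases "v \<in> Lam N") (auto simp: spin_of_def dob_def low_def)
    qed
  qed
  show "spin_of ` Pow (Lam N) \<subseteq> configs N"
    by (auto simp: configs_def spin_of_def dob_def low_def split: if_splits)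
qed (auto simp: configs_def)

lemma ising_weight_spin_of:
  assumes "m \<subseteq> Lam N"
  shows "ising_weight \<beta> h N (spin_of m) = exp (h * real (card (Lam N))) *
    (exp (- 2 * \<beta>) ^ cut (pedges N) (m \<union> low) * exp (- (2 * h) * real (card m)))"
proof -
  have "(\<Sum>v\<in>Lam N. real_of_int (spin_of m v)) = (\<Sum>v\<in>Lam N. 1 - 2 * of_bool (v \<in> m))"
    using low_Lam[of N] by (intro sum.cong) (auto simp: spin_of_def)
  also have "\<dots> = real (card (Lam N)) - 2 * real (card (Lam N \<inter> m))"
    by (simp add: sum_subtractf sum_distrib_left[symmetric] sum_of_bool_eq finite_Lam)
  also have "Lam N \<inter> m = m" using assms by auto
  finally have s: "(\<Sum>v\<in>Lam N. real_of_int (spin_of m v)) = real (card (Lam N)) - 2 * real (card m)" .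
  have "exp (- 2 * \<beta>) ^ cut (pedges N) (m \<union> low) = exp (- 2 * \<beta> * real (cut (pedges N) (m \<union> low)))"
    by (simp only: exp_of_nat_mult[symmetric]) (simp add: algebra_simps)
  then show ?thesis
    unfolding ising_weight_def s hamil_spin_of by (simp add: exp_add[symmetric] algebra_simps)
qed

lemma ising_prob_pf:
  fixes \<beta> h :: real
  defines "x \<equiv> exp (- 2 * \<beta>)"
  shows "ising_prob \<beta> h N {\<sigma>. interface N \<sigma> \<in> \<Gamma>}
    = pf x N low (2 * h) (\<lambda>m. interface_of N m \<in> \<Gamma>) / pf x N low (2 * h) (\<lambda>_. True)"
proof -
  define K where "K = exp (h * real (card (Lam N)))"
  have K: "K \<noteq> 0" by (simp add: K_def)
  have fin: "finite (configs N)" using configs_spin_of[of N] bij_betw_finite finite_Lam by (metis finite_Pow_iff)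
  have s: "(\<Sum>\<sigma>\<in>configs N. f \<sigma>) = (\<Sum>m\<in>Pow (Lam N). f (spin_of m))" for f :: "_ \<Rightarrow> real"
    by (rule sum.reindex_bij_betw[OF configs_spin_of, symmetric])
  have "(\<Sum>\<sigma>\<in>configs N \<inter> {\<sigma>. interface N \<sigma> \<in> \<Gamma>}. ising_weight \<beta> h N \<sigma>)
    = (\<Sum>\<sigma>\<in>configs N. of_bool (interface N \<sigma> \<in> \<Gamma>) * ising_weight \<beta> h N \<sigma>)"
    by (rule sum.mono_neutral_cong_left) (use fin in auto)
  also have "\<dots> = (\<Sum>m\<in>Pow (Lam N). K * (of_bool (interface_of N m \<in> \<Gamma>) * (x ^ cut (pedges N) (m \<union> low) * exp (- (2 * h) * real (card m)))))"
    unfolding s by (intro sum.cong) (auto simp: ising_weight_spin_of interface_of_def K_def x_def)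
  also have "\<dots> = K * pf x N low (2 * h) (\<lambda>m. interface_of N m \<in> \<Gamma>)"
    by (simp add: pf_def sum_distrib_left)
  finally have 1: "(\<Sum>\<sigma>\<in>configs N \<inter> {\<sigma>. interface N \<sigma> \<in> \<Gamma>}. ising_weight \<beta> h N \<sigma>)
    = K * pf x N low (2 * h) (\<lambda>m. interface_of N m \<in> \<Gamma>)" .
  have 2: "(\<Sum>\<sigma>\<in>configs N. ising_weight \<beta> h N \<sigma>) = K * pf x N low (2 * h) (\<lambda>_. True)"
    unfolding s pf_def sum_distrib_left by (intro sum.cong) (auto simp: ising_weight_spin_of K_def x_def)
  show ?thesis unfolding ising_prob_def 1 2 using K by simp
qed

lemma pf_pos:
  assumes "0 < x"
  shows "0 < pf x N D l (\<lambda>_. True)"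
  unfolding pf_def by (rule sum_pos) (use assms finite_Lam in auto)

lemma pf_mono:
  assumes "0 \<le> x" "\<And>m. m \<subseteq> Lam N \<Longrightarrow> A m \<Longrightarrow> B m"
  shows "pf x N D l A \<le> pf x N D l B"
  unfolding pf_def using assms by (intro sum_mono mult_right_mono) auto

text \<open>For l of order 1 / N this is off by exp (O(N)), which only the exponentially rare long
  interfaces can afford.\<close>

lemma pf_field_mono:
  assumes "0 \<le> x" "0 \<le> l"
  shows "pf x N D l A \<le> pf x N D 0 A" "pf x N D 0 A \<le> exp (l * real (card (Lam N))) * pf x N D l A"
proof -
  show "pf x N D l A \<le> pf x N D 0 A"
    unfolding pf_def using assms by (intro sum_mono mult_left_mono) auto
  show "pf x N D 0 A \<le> exp (l * real (card (Lam N))) * pf x N D l A"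
    unfolding pf_def sum_distrib_left
  proof (rule sum_mono)
    fix m assume "m \<in> Pow (Lam N)"
    then have "card m \<le> card (Lam N)" using finite_Lam by (intro card_mono) auto
    then have "1 \<le> exp (l * real (card (Lam N))) * exp (- l * real (card m))"
      using assms by (simp add: exp_add[symmetric] mult_left_mono)
    from mult_left_mono[OF this, of "of_bool (A m) * x ^ cut (pedges N) (m \<union> D)"] assms
    show "of_bool (A m) * (x ^ cut (pedges N) (m \<union> D) * exp (- 0 * real (card m)))
      \<le> exp (l * real (card (Lam N))) * (of_bool (A m) * (x ^ cut (pedges N) (m \<union> D) * exp (- l * real (card m))))"
      by (simp add: mult_ac)
  qed
qed

text \<open>For each interface, \<open>interface_cost\<close> compares with plus partition functions
  and \<open>partition_ratio\<close> exchanges these for Dobrushin ones. A collar has at most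
  \<open>8 * L\<close> sites, so the factor is uniform in the interface.\<close>

lemma short_interface:
  fixes b l :: real and N h L :: nat
  defines "x \<equiv> exp (- 2 * b)"
  assumes x5: "x < 1 / 5" and l: "l \<ge> 0" and h: "2 \<le> h" "h \<le> Suc N"
  shows "pf x N low l (\<lambda>m. interface_of N m \<in> \<Gamma> \<and> card (interface_of N m) < L) * pf x N low 0 (\<lambda>_. True)
    \<le> exp (l * loop_const * (8 * real L) + (b * (8 * real h + 4) + ln 8 * real h + pi\<^sup>2 * decay_rate x / (1 - (decay_rate x)\<^sup>2) * real N / (real h)\<^sup>2 + l * (real h * (real N + 1))))
      * (pf x N low 0 (\<lambda>m. interface_of N m \<in> \<Gamma> \<and> card (interface_of N m) < L) * pf x N low l (\<lambda>_. True))"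
proof -
  let ?T = "\<lambda>_ :: site set. True"
  define E where "E = b * (8 * real h + 4) + ln 8 * real h + pi\<^sup>2 * decay_rate x / (1 - (decay_rate x)\<^sup>2) * real N / (real h)\<^sup>2 + l * (real h * (real N + 1))"
  have x0: "0 < x" by (simp add: x_def)
  have ratio: "pf x N low 0 ?T * pf x N {} l ?T \<le> exp E * (pf x N low l ?T * pf x N {} 0 ?T)"
    unfolding E_def x_def by (rule partition_ratio) (use x5 l h x_def in auto)
  have P0: "pf x N D l A \<ge> 0" for D l A using x0 by (simp add: pf_nonneg)
  have loop_const: "loop_const \<ge> 0" unfolding loop_const_def by (intro suminf_nonneg summable_loop_const) auto
  define M where "M = l * loop_const * (8 * real L)"
  define G where "G = {\<gamma> \<in> interface_of N ` Pow (Lam N). \<gamma> \<in> \<Gamma> \<and> card \<gamma> < L}"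
  have fG: "finite G" by (simp add: G_def finite_Lam)
  have split: "pf x N low l (\<lambda>m. interface_of N m \<in> \<Gamma> \<and> card (interface_of N m) < L) = (\<Sum>\<gamma>\<in>G. pf x N low l (\<lambda>m. interface_of N m = \<gamma>))" for l
  proof -
    have "of_bool (interface_of N m \<in> \<Gamma> \<and> card (interface_of N m) < L) = (\<Sum>\<gamma>\<in>G. of_bool (interface_of N m = \<gamma>) :: real)" if "m \<in> Pow (Lam N)" for m
    proof -
      have "(\<Sum>\<gamma>\<in>G. of_bool (interface_of N m = \<gamma>) :: real) = (\<Sum>\<gamma>\<in>G. if \<gamma> = interface_of N m then 1 else 0)"
        by (intro sum.cong) auto
      also have "\<dots> = of_bool (interface_of N m \<in> G)" using fG by simp
      finally show ?thesis using that by (auto simp: G_def)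
    qed
    then show ?thesis
      unfolding pf_def by (subst sum.swap) (simp add: sum_distrib_right)
  qed
  have each: "pf x N low l (\<lambda>m. interface_of N m = \<gamma>) * pf x N low 0 ?T
    \<le> exp (M + E) * (pf x N low 0 (\<lambda>m. interface_of N m = \<gamma>) * pf x N low l ?T)" if g: "\<gamma> \<in> G" for \<gamma>
  proof -
    let ?a = "pf x N low l (\<lambda>m. interface_of N m = \<gamma>)" and ?b = "pf x N low 0 (\<lambda>m. interface_of N m = \<gamma>)"
    obtain m where m: "m \<subseteq> Lam N" "\<gamma> = interface_of N m" "card \<gamma> < L" using g by (auto simp: G_def)
    have "\<gamma> \<subseteq> contour_of N (m \<union> low)" using interface_of_spec(1)[OF m(1)] pieces_subset m(2) by blast
    then have "card (collar \<gamma>) \<le> 8 * card \<gamma>"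
      using collar_bound(2) finite_subset[OF _ finite_contour_of] by blast
    then have "real (card (collar \<gamma>)) \<le> 8 * real L" using m(3) by linarith
    then have "l * loop_const * real (card (collar \<gamma>)) \<le> M"
      unfolding M_def using l loop_const by (intro mult_left_mono) auto
    then have eM: "exp (l * loop_const * real (card (collar \<gamma>))) \<le> exp M" by simp
    have "?a * pf x N {} 0 ?T \<le> exp (l * loop_const * real (card (collar \<gamma>))) * (?b * pf x N {} l ?T)"
      by (rule interface_cost) (use x0 x5 l in auto)
    also have "\<dots> \<le> exp M * (?b * pf x N {} l ?T)"
      by (intro mult_right_mono eM mult_nonneg_nonneg P0)
    finally have c: "?a * pf x N {} 0 ?T \<le> exp M * (?b * pf x N {} l ?T)" .
    have "(?a * pf x N low 0 ?T) * pf x N {} 0 ?T = (?a * pf x N {} 0 ?T) * pf x N low 0 ?T" by (simp only: mult_ac)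
    also have "\<dots> \<le> (exp M * (?b * pf x N {} l ?T)) * pf x N low 0 ?T" by (intro mult_right_mono c P0)
    also have "\<dots> = exp M * ?b * (pf x N low 0 ?T * pf x N {} l ?T)" by (simp only: mult_ac)
    also have "\<dots> \<le> exp M * ?b * (exp E * (pf x N low l ?T * pf x N {} 0 ?T))"
      by (intro mult_left_mono ratio mult_nonneg_nonneg P0) simp
    also have "\<dots> = (exp (M + E) * (?b * pf x N low l ?T)) * pf x N {} 0 ?T" by (simp only: exp_add mult_ac)
    finally show ?thesis using pf_pos[OF x0, of N "{}" 0] by simp
  qed
  have "(\<Sum>\<gamma>\<in>G. pf x N low l (\<lambda>m. interface_of N m = \<gamma>) * pf x N low 0 ?T)
    \<le> (\<Sum>\<gamma>\<in>G. exp (M + E) * (pf x N low 0 (\<lambda>m. interface_of N m = \<gamma>) * pf x N low l ?T))"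
    by (rule sum_mono[OF each])
  then show ?thesis
    unfolding split M_def[symmetric] E_def[symmetric] by (simp add: sum_distrib_left sum_distrib_right)
qed

text \<open>The square of exp \<open>beta_c\<close> is 3 + 2 sqrt 2, which exceeds 5; and 1/5 keeps
  the Peierls ratio 4 x below 1.\<close>

lemma exp_beta_bound:
  assumes "\<beta> > beta_c"
  shows "exp (- 2 * \<beta>) < 1 / 5" "\<beta> > 0"
proof -
  have s: "sqrt 2 \<ge> 1" by simp
  have "beta_c > 0" unfolding beta_c_def using s by (intro ln_gt_zero) linarith
  then show "\<beta> > 0" using assms by simp
  have "exp beta_c = 1 + sqrt 2" unfolding beta_c_def using s by (intro exp_ln) linarith
  then have "1 + sqrt 2 < exp \<beta>" using assms by (metis exp_less_cancel_iff)
  then have "(1 + sqrt 2) * (1 + sqrt 2) < exp \<beta> * exp \<beta>" using s by (intro mult_strict_mono) auto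
  moreover have "(1 + sqrt 2) * (1 + sqrt 2) \<ge> 5" using s by (simp add: algebra_simps)
  ultimately have "5 < exp (2 * \<beta>)" by (simp add: exp_add[symmetric])
  then show "exp (- 2 * \<beta>) < 1 / 5" by (simp add: exp_minus field_simps)
qed

theorem theorem4p1:
  fixes \<beta> c_lam :: real
  assumes "\<beta> > beta_c" and "c_lam > 0"
  shows "\<exists>C1>0. \<exists>C2>0. \<forall>N::nat. N \<ge> 1 \<longrightarrow>
           (\<forall>\<Gamma>. \<Gamma> \<subseteq> {\<gamma>. admissible N \<gamma>} \<longrightarrow>
              ising_prob \<beta> (c_lam / real N) N {\<sigma>. interface N \<sigma> \<in> \<Gamma>}
                \<le> exp (C1 * real N powr (1/3)) * ising_prob \<beta> 0 N {\<sigma>. interface N \<sigma> \<in> \<Gamma>}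
                  + exp (- C2 * real N))"
proof -
  define x where "x = exp (- 2 * \<beta>)"
  have x: "x < 1 / 5" "0 < x" and b0: "\<beta> > 0" using exp_beta_bound[OF assms(1)] by (simp_all add: x_def)
  have loop_const: "loop_const \<ge> 0" unfolding loop_const_def by (intro suminf_nonneg summable_loop_const) auto
  define D where "D = pi\<^sup>2 * decay_rate x / (1 - (decay_rate x)\<^sup>2)"
  have D: "D \<ge> 0"
  proof -
    have c: "0 \<le> decay_rate x" unfolding decay_rate_def using x by simp
    have "x * (1 + x) \<le> 1 / 5 * (6 / 5)" using x by (intro mult_mono) auto
    then have "x * (1 + x) \<le> 1 - x" using x by simp
    then have "decay_rate x \<le> 1" unfolding decay_rate_def using x by simp
    then have "(decay_rate x)\<^sup>2 \<le> 1" using c by (simp add: power_le_one)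
    then show ?thesis unfolding D_def using c by simp
  qed
  \<comment> \<open>Per column, \<open>K\<close> edges at 4/5 each have to beat the inverse of
    \<open>x\<close> (the \<open>2 * \<beta>\<close>) and the crude field bound (the
    \<open>4 * c_lam\<close>); the 3 pays for the prefactor 5 and leaves exp (- N).\<close>
  obtain K :: nat where K: "(4 / 5) ^ K < exp (- (2 * \<beta> + 4 * c_lam + 3))"
    using real_arch_pow_inv[of "exp (- (2 * \<beta> + 4 * c_lam + 3))" "4 / 5"] by auto
  \<comment> \<open>One summand for each term of the exponent in \<open>short_interface\<close>, by
    means of \<open>h \<le> 3 * p\<close> and \<open>l * (N + 1) \<le> 4 * c_lam\<close>; for
    instance 28 = 8 * 3 + 4 and 32 = 4 * 8.\<close>
  define C1 where "C1 = 28 * \<beta> + 3 * ln 8 + D + 12 * c_lam + 32 * c_lam * loop_const * real K"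
  have "ln (8::real) > 0" by simp
  then have C1: "C1 > 0" unfolding C1_def using b0 assms(2) loop_const D by (intro add_pos_nonneg) auto
  have main: "ising_prob \<beta> (c_lam / real N) N {\<sigma>. interface N \<sigma> \<in> \<Gamma>}
    \<le> exp (C1 * real N powr (1/3)) * ising_prob \<beta> 0 N {\<sigma>. interface N \<sigma> \<in> \<Gamma>} + exp (- 1 * real N)"
    if N: "N \<ge> 1" for N \<Gamma>
  proof -
    define l where "l = 2 * (c_lam / real N)"
    have l: "l \<ge> 0" using assms(2) by (simp add: l_def)
    define p where "p = real N powr (1/3)"
    have p1: "p \<ge> 1" unfolding p_def using N by (simp add: ge_one_powr_ge_zero)
    have p3: "p ^ 3 = real N" unfolding p_def using N by (simp add: powr_realpow[symmetric] powr_powr)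
    have pN: "p \<le> real N" using p3 p1 self_le_power[of p 3] by simp
    \<comment> \<open>The additional 1 ensures \<open>2 \<le> h\<close>, while
      \<open>h \<le> 3 * p\<close> and \<open>h \<le> Suc N\<close> still hold.\<close>
    define h where "h = nat \<lceil>p\<rceil> + 1"
    have hp: "p \<le> real h" "real h \<le> 3 * p" unfolding h_def using p1 by linarith+
    have "\<lceil>p\<rceil> \<ge> 1" using p1 by (simp add: one_le_ceiling)
    moreover have "\<lceil>p\<rceil> \<le> int N" using pN by (simp add: ceiling_le_iff)
    ultimately have h: "2 \<le> h" "h \<le> Suc N" unfolding h_def by linarith+
    define L where "L = K * Suc N"
    define Z where "Z = pf x N low l (\<lambda>_. True)"
    define Z0 where "Z0 = pf x N low 0 (\<lambda>_. True)"
    have Z: "Z > 0" "Z0 > 0" unfolding Z_def Z0_def using x by (simp_all add: pf_pos)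
    define ES where "ES = l * loop_const * (8 * real L) + (\<beta> * (8 * real h + 4) + ln 8 * real h + pi\<^sup>2 * decay_rate x / (1 - (decay_rate x)\<^sup>2) * real N / (real h)\<^sup>2 + l * (real h * (real N + 1)))"
    let ?S = "\<lambda>m. interface_of N m \<in> \<Gamma> \<and> card (interface_of N m) < L" and ?G = "\<lambda>m. interface_of N m \<in> \<Gamma>"
    have lN: "l * (real N + 1) \<le> 4 * c_lam"
    proof -
      have "l * (real N + 1) \<le> l * (2 * real N)" using l N by (intro mult_left_mono) auto
      also have "\<dots> = 4 * c_lam" using N by (simp add: l_def)
      finally show ?thesis .
    qed
    have ES: "ES \<le> C1 * p"
    proof -
      have "l * loop_const * (8 * real L) = (l * (real N + 1)) * (8 * loop_const * real K)" by (simp add: L_def algebra_simps)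
      also have "\<dots> \<le> (4 * c_lam) * (8 * loop_const * real K)" using lN loop_const by (intro mult_right_mono) auto
      also have "\<dots> \<le> (4 * c_lam) * (8 * loop_const * real K) * p"
        using p1 assms(2) loop_const mult_left_mono[OF p1, of "(4 * c_lam) * (8 * loop_const * real K)"] by simp
      finally have 1: "l * loop_const * (8 * real L) \<le> 32 * c_lam * loop_const * real K * p" by simp
      have "\<beta> * (8 * real h + 4) \<le> \<beta> * (28 * p)" using hp p1 b0 by (intro mult_left_mono) auto
      then have 2: "\<beta> * (8 * real h + 4) \<le> 28 * \<beta> * p" by simp
      have "ln 8 * real h \<le> ln 8 * (3 * p)" using hp by (intro mult_left_mono) auto
      then have 3: "ln 8 * real h \<le> 3 * ln 8 * p" by simp
      have 4: "D * real N / (real h)\<^sup>2 \<le> D * p"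
      proof -
        have "real N = p * p\<^sup>2" using p3 by (simp add: power3_eq_cube power2_eq_square)
        also have "\<dots> \<le> p * (real h)\<^sup>2" using hp p1 by (intro mult_left_mono power_mono) auto
        finally have "real N / (real h)\<^sup>2 \<le> p" using h by (simp add: field_simps)
        from mult_left_mono[OF this D] show ?thesis by simp
      qed
      have "l * (real h * (real N + 1)) = (l * (real N + 1)) * real h" by simp
      also have "\<dots> \<le> (4 * c_lam) * (3 * p)" by (rule mult_mono[OF lN hp(2)]) (use assms(2) in auto)
      finally have 5: "l * (real h * (real N + 1)) \<le> 12 * c_lam * p" by simp
      have "C1 * p = 28 * \<beta> * p + 3 * ln 8 * p + D * p + 12 * c_lam * p + 32 * c_lam * loop_const * real K * p"
        unfolding C1_def by (simp only: distrib_right)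
      then show ?thesis using 1 2 3 4 5 unfolding ES_def D_def by linarith
    qed
    have short: "pf x N low l ?S / Z \<le> exp (C1 * p) * (pf x N low 0 ?G / Z0)"
    proof -
      have "pf x N low l ?S * Z0 \<le> exp ES * (pf x N low 0 ?S * Z)"
        unfolding ES_def Z_def Z0_def x_def by (rule short_interface) (use x l h in \<open>auto simp: x_def\<close>)
      also have "\<dots> \<le> exp (C1 * p) * (pf x N low 0 ?G * Z)"
      proof (rule mult_mono)
        show "pf x N low 0 ?S * Z \<le> pf x N low 0 ?G * Z"
          using Z x by (intro mult_right_mono pf_mono) auto
      qed (use ES Z x in \<open>auto intro!: mult_nonneg_nonneg pf_nonneg\<close>)
      finally show ?thesis using Z by (simp add: field_simps)
    qed
    have long: "pf x N low l (\<lambda>m. L \<le> card (interface_of N m)) / Z \<le> exp (- 1 * real N)"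
    proof -
      have cL: "real (card (Lam N)) = (real N + 1) * (real N + 1)" by (simp add: Lam_def card_cartesian_product)
      have Z0Z: "Z0 \<le> exp (4 * c_lam * (real N + 1)) * Z"
      proof -
        have "Z0 \<le> exp (l * real (card (Lam N))) * Z"
          unfolding Z_def Z0_def using x l by (intro pf_field_mono) auto
        also have "l * real (card (Lam N)) = (l * (real N + 1)) * (real N + 1)" by (simp add: cL)
        also have "exp ((l * (real N + 1)) * (real N + 1)) \<le> exp (4 * c_lam * (real N + 1))"
          using lN by (simp add: mult_right_mono)
        finally show ?thesis using Z by simp
      qed
      have "pf x N low l (\<lambda>m. L \<le> card (interface_of N m)) \<le> pf x N low 0 (\<lambda>m. L \<le> card (interface_of N m))"
        using x l by (intro pf_field_mono) auto
      also have "\<dots> \<le> 5 * (4 / 5) ^ L / x ^ Suc N * Z0"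
        unfolding Z0_def using x by (intro long_interface) auto
      also have "\<dots> \<le> 5 * (4 / 5) ^ L / x ^ Suc N * (exp (4 * c_lam * (real N + 1)) * Z)"
        using x by (intro mult_left_mono Z0Z) auto
      also have "\<dots> = (5 * (4 / 5) ^ L / x ^ Suc N * exp (4 * c_lam * (real N + 1))) * Z" by simp
      also have "\<dots> \<le> exp (- real N) * Z"
      proof (rule mult_right_mono)
        have "(4 / 5 :: real) ^ L = ((4 / 5) ^ K) ^ Suc N" by (simp only: L_def power_mult)
        also have "\<dots> \<le> exp (- (2 * \<beta> + 4 * c_lam + 3)) ^ Suc N" using K by (intro power_mono) auto
        finally have a: "(4 / 5 :: real) ^ L \<le> exp (- (2 * \<beta> + 4 * c_lam + 3)) ^ Suc N" .
        have "1 / x ^ Suc N = exp (2 * \<beta>) ^ Suc N" by (simp add: x_def exp_minus power_inverse divide_inverse del: power_Suc)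
        moreover have "exp (4 * c_lam * (real N + 1)) = exp (4 * c_lam) ^ Suc N"
          by (simp only: exp_of_nat_mult[symmetric]) (simp add: algebra_simps)
        ultimately have "5 * (4 / 5) ^ L / x ^ Suc N * exp (4 * c_lam * (real N + 1))
          = 5 * ((4 / 5) ^ L * (exp (2 * \<beta>) ^ Suc N * exp (4 * c_lam) ^ Suc N))"
          by (simp only: divide_inverse mult_1_left mult_ac)
        also have "\<dots> \<le> 5 * (exp (- (2 * \<beta> + 4 * c_lam + 3)) ^ Suc N * (exp (2 * \<beta>) ^ Suc N * exp (4 * c_lam) ^ Suc N))"
          using a by (intro mult_left_mono mult_right_mono) auto
        also have "\<dots> = 5 * exp (- 3) ^ Suc N"
          unfolding power_mult_distrib[symmetric] exp_add[symmetric] by simp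
        also have "\<dots> = 5 * exp (- 3 * (real N + 1))"
          by (simp only: exp_of_nat_mult[symmetric]) (simp add: algebra_simps)
        also have "\<dots> \<le> exp 3 * exp (- 3 * (real N + 1))"
        proof (rule mult_right_mono)
          have "(5::real) \<le> 2 * 2 * 2" by simp
          also have "\<dots> \<le> exp 1 * exp 1 * exp 1"
            using exp_ge_add_one_self[of "1::real"] by (intro mult_mono) auto
          also have "\<dots> = exp (3::real)" by (simp add: exp_add[symmetric])
          finally show "(5::real) \<le> exp 3" .
        qed simp
        also have "\<dots> \<le> exp (- real N)" by (simp add: exp_add[symmetric])
        finally show "5 * (4 / 5) ^ L / x ^ Suc N * exp (4 * c_lam * (real N + 1)) \<le> exp (- real N)" .
      qed (use Z in simp)
      finally show ?thesis using Z by (simp add: field_simps)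
    qed
    have "pf x N low l ?G \<le> pf x N low l ?S + pf x N low l (\<lambda>m. L \<le> card (interface_of N m))"
      unfolding pf_def sum.distrib[symmetric] distrib_right[symmetric]
      using x by (intro sum_mono mult_right_mono) auto
    then have "pf x N low l ?G / Z \<le> pf x N low l ?S / Z + pf x N low l (\<lambda>m. L \<le> card (interface_of N m)) / Z"
      using Z by (simp add: add_divide_distrib[symmetric] divide_right_mono)
    also have "\<dots> \<le> exp (C1 * p) * (pf x N low 0 ?G / Z0) + exp (- 1 * real N)"
      using short long by (rule add_mono)
    finally show ?thesis
      unfolding ising_prob_pf x_def[symmetric] using l_def Z_def Z0_def p_def by simp
  qed
  show ?thesis
    by (rule exI[of _ C1], rule conjI[OF C1], rule exI[of _ 1], rule conjI[OF zero_less_one])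
      (use main in blast)
qed

end
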